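(* Let $(X_t)_{t\in\mathbb Z}$ be a strictly stationary sequence of real-valued random variables (generic element $X$) which is regularly varying with index $\alpha>1$, has mean zero, and has spectral tail process $(\Theta_t)_{t\in\mathbb Z}$. For $x,\varepsilon>0$ write $\overline X_t=X_t\mathbf 1_{|X_t|\le\varepsilon x}$, $S_0=0$, $S_t=\sum_{i=1}^tX_i$ and $\overline S_t=\sum_{i=1}^t\overline X_i$. Assume that for every choice of constants $0<C_1<C_2$, with $\Lambda_n=[C_1n,C_2n]$, 1. $\displaystyle\lim_{k\to\infty}\limsup_{n\to\infty}\sup_{x\in\Lambda_n}\mathbb P\Big(\max_{k\le i\le n}|X_i|>x\delta\ \Big|\ |X_0|>x\delta\Big)=0$ for every $\delta>0$; 2. $\displaystyle\lim_{\varepsilon\downarrow0}\limsup_{n\to\infty}\sup_{x\in\Lambda_n}\frac{\mathbb P\big(x^{-1}\sup_{t\le n}|\overline S_t|>\delta\big)}{n\,\mathbb P(|X|>x)}=0$ for every $\delta>0$; and that 3. $\mathbb E\big(\sum_{i=1}^\infty|\Theta_i|\big)^{\alpha-1}<\infty$. Then for every $\rho>0$, $$\lim_{x\to\infty}\frac{\mathbb P\big(\sup_{t\ge0}(S_t-\rho t)>x\big)}{x\,\mathbb P(|X|>x)}=\frac{\mathbb E\Big[\Big(\sup_{t\ge0}\sum_{i=0}^t\Theta_i\Big)_+^\alpha-\Big(\sup_{t\ge1}\sum_{i=1}^t\Theta_i\Big)_+^\alpha\Big]}{(\alpha-1)\rho} .$$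
   Context: $z_+=\max(z,0)$; in $\sup_{t\ge0}(S_t-\rho t)$ and in the suprema of sums, $t$ runs over integers. Regular variation. A random vector $V$ is regularly varying with index $\alpha>0$ if there is a random vector $\Theta$ on the unit sphere such that for every $u>0$, $\mathbb P(|V|>ux,\,V/|V|\in\cdot)/\mathbb P(|V|>x)\to u^{-\alpha}\mathbb P(\Theta\in\cdot)$ weakly as $x\to\infty$. A strictly stationary sequence $(X_t)$ is regularly varying with index $\alpha$ if $(X_1,\ldots,X_k)$ is regularly varying with index $\alpha$ for every $k\ge1$. Equivalently, there is a sequence $(Y_t)_{t\in\mathbb Z}$ (the tail process) with $\mathbb P(|Y_0|>y)=y^{-\alpha}$ for $y>1$ and, for every $k\ge0$, $\mathbb P(x^{-1}(X_{-k},\ldots,X_k)\in\cdot\mid|X_0|>x)\to\mathbb P((Y_{-k},\ldots,Y_k)\in\cdot)$ weakly as $x\to\infty$. The spectral tail process is $\Theta_t=Y_t/|Y_0|$, $t\in\mathbb Z$; it is independent of $|Y_0|$, and $|\Theta_0|=1$. *)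

theory Defs
  imports "HOL-Probability.Probability"
begin

text \<open>
  Weak convergence of finite Borel measures along a filter.  The Borel sigma-algebra on
  \<^typ>\<open>int \<Rightarrow> real\<close> used below is that of the product topology.
\<close>

definition weakly_tendsto ::
    "('i \<Rightarrow> 'a::topological_space measure) \<Rightarrow> 'a measure \<Rightarrow> 'i filter \<Rightarrow> bool" where
  "weakly_tendsto \<mu> \<nu> F \<longleftrightarrow>
     (\<forall>f::'a \<Rightarrow> real. f \<in> bcontfun \<longrightarrow> ((\<lambda>i. \<integral>v. f v \<partial>\<mu> i) \<longlongrightarrow> (\<integral>v. f v \<partial>\<nu>)) F)"

text \<open>
  For a finite set \<open>I\<close> of integers, the Euclidean space of vectors indexed by \<open>I\<close> is
  represented by the closed subspace of \<^typ>\<open>int \<Rightarrow> real\<close> of functions vanishing outside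
  \<open>I\<close>; this allows the dimension to be quantified over.  Bounded continuous functions on the
  subspace are exactly the restrictions of those on the whole space (compose with
  \<open>window I\<close>), so weak convergence means the same in both.
\<close>

definition window :: "int set \<Rightarrow> (int \<Rightarrow> real) \<Rightarrow> int \<Rightarrow> real" where
  "window I v = (\<lambda>i. if i \<in> I then v i else 0)"

definition unit_sphere :: "int set \<Rightarrow> (int \<Rightarrow> real) set" where
  "unit_sphere I = {v. (\<forall>i. i \<notin> I \<longrightarrow> v i = 0) \<and> L2_set v I = 1}"

text \<open>
  Regular variation of a random vector \<open>V\<close> indexed by \<open>I\<close>.  The measure \<open>Q\<close> is the law of
  the spectral vector on the unit sphere.  The measure on the left of the convergence assigns
  to \<open>B\<close> the value \<open>P(|V| > u x, V / |V| \<in> B) / P(|V| > x)\<close>.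
\<close>

definition regularly_varying_vector ::
    "'a measure \<Rightarrow> int set \<Rightarrow> ('a \<Rightarrow> int \<Rightarrow> real) \<Rightarrow> real \<Rightarrow> bool" where
  "regularly_varying_vector M I V \<alpha> \<longleftrightarrow>
     \<alpha> > 0 \<and>
     (\<exists>Q. prob_space Q \<and> sets Q = sets borel \<and> (AE \<theta> in Q. \<theta> \<in> unit_sphere I) \<and>
        (\<forall>u>0. weakly_tendsto
           (\<lambda>x::real.
              distr (density M (\<lambda>\<omega>. indicator {\<omega> \<in> space M. L2_set (V \<omega>) I > u * x} \<omega>
                                   / emeasure M {\<omega> \<in> space M. L2_set (V \<omega>) I > x}))
                borel (\<lambda>\<omega>. window I (\<lambda>i. V \<omega> i / L2_set (V \<omega>) I)))
           (density Q (\<lambda>_. ennreal (u powr - \<alpha>)))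
           at_top))"

definition strictly_stationary :: "'a measure \<Rightarrow> (int \<Rightarrow> 'a \<Rightarrow> real) \<Rightarrow> bool" where
  "strictly_stationary M X \<longleftrightarrow>
     (\<forall>h. distr M (\<Pi>\<^sub>M t\<in>UNIV. borel) (\<lambda>\<omega> t. X (t + h) \<omega>)
        = distr M (\<Pi>\<^sub>M t\<in>UNIV. borel) (\<lambda>\<omega> t. X t \<omega>))"

definition regularly_varying_sequence ::
    "'a measure \<Rightarrow> (int \<Rightarrow> 'a \<Rightarrow> real) \<Rightarrow> real \<Rightarrow> bool" where
  "regularly_varying_sequence M X \<alpha> \<longleftrightarrow>
     (\<forall>k::nat. k \<ge> 1 \<longrightarrow> regularly_varying_vector M {1..int k} (\<lambda>\<omega> t. X t \<omega>) \<alpha>)"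

text \<open>
  The tail process \<open>Y\<close> may live on a probability space \<open>N\<close> different from that of \<open>X\<close>.
\<close>

definition tail_process ::
    "'a measure \<Rightarrow> (int \<Rightarrow> 'a \<Rightarrow> real) \<Rightarrow> real \<Rightarrow> 'b measure \<Rightarrow> (int \<Rightarrow> 'b \<Rightarrow> real) \<Rightarrow> bool" where
  "tail_process M X \<alpha> N Y \<longleftrightarrow>
     prob_space N \<and> (\<forall>t. Y t \<in> borel_measurable N) \<and>
     (\<forall>y>1. \<P>(\<omega> in N. \<bar>Y 0 \<omega>\<bar> > y) = y powr - \<alpha>) \<and>
     (\<forall>k::nat. weakly_tendsto
        (\<lambda>x::real. distr (uniform_measure M {\<omega> \<in> space M. \<bar>X 0 \<omega>\<bar> > x}) borel
                      (\<lambda>\<omega>. window {- int k..int k} (\<lambda>t. X t \<omega> / x)))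
        (distr N borel (\<lambda>\<omega>. window {- int k..int k} (\<lambda>t. Y t \<omega>)))
        at_top)"

definition spectral_process :: "(int \<Rightarrow> 'b \<Rightarrow> real) \<Rightarrow> int \<Rightarrow> 'b \<Rightarrow> real" where
  "spectral_process Y t \<omega> = Y t \<omega> / \<bar>Y 0 \<omega>\<bar>"

definition psum :: "(int \<Rightarrow> 'a \<Rightarrow> real) \<Rightarrow> nat \<Rightarrow> 'a \<Rightarrow> real" where
  "psum X t \<omega> = (\<Sum>i=1..t. X (int i) \<omega>)"

definition truncated :: "real \<Rightarrow> (int \<Rightarrow> 'a \<Rightarrow> real) \<Rightarrow> int \<Rightarrow> 'a \<Rightarrow> real" where
  "truncated c X t \<omega> = (if \<bar>X t \<omega>\<bar> \<le> c then X t \<omega> else 0)"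

text \<open>Meant for positive exponents only, where the power of infinity is infinity.\<close>

definition ennreal_powr :: "ennreal \<Rightarrow> real \<Rightarrow> ennreal" where
  "ennreal_powr a p = (if a = \<infinity> then \<infinity> else ennreal (enn2real a powr p))"

end

(*
  Split every X_i at the level eps x.  By the hypothesis on small values the small parts move the
  partial sums by at most delta x, so only the values exceeding eps x matter.  Telescoping the ruin
  event over the index j of a large value, and using anticlustering to cut the future of j to a
  window of length k, stationarity turns the probability into an expectation of the cluster that
  starts at time 0; summing over j gives the piecewise linear functional
  (1 / rho) ((G + X_0 - x)_+ - (G - x)_+), where G is the largest partial sum of the cluster after
  time 0.  It is convergent under the tail process, which factorises as Y = |Y_0| Theta with |Y_0|
  Pareto.  The difference of the two positive parts is at most |X_0| and vanishes unless
  |X_0| (1 + sum |Theta_i|) exceeds x, so that it is dominated by means of the moment of order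
  alpha - 1 only, although each of the two terms separately would need the moment of order alpha.
  Times beyond K x contribute a dyadic sum of order K^(1 - alpha).
*)
theory Submission
  imports Defs
begin

text \<open>The order of the limits is forced. For a fixed horizon \<open>K\<close>, slack
  \<open>\<delta>\<close> and tolerance \<open>\<eta>\<close>, the hypothesis on small values
  determines \<open>\<epsilon>\<close>, and only then does anticlustering at the level \<epsilon> x
  determine \<open>k\<close>. Each choice yields two-sided bounds for large x, and a sequence of
  choices is sent to the limit afterwards. Hence the limit functional carries all these parameters,
  and its dominating function has to be uniform in them.

  The cut at \<epsilon> x makes the cluster functional discontinuous. Weak convergence is therefore
  applied to continuous ramps, and the error is controlled because no |Y_t| has an atom at 1.
  Conditioning at level \<epsilon> x while normalising by the probability at level x produces the
  measure \<alpha> y^(-\<alpha>-1) dy on y \<ge> \<epsilon>, the same one for every \<epsilon> up to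
  restriction. Its mass explodes as \<epsilon> tends to 0; the limit survives because the functional
  vanishes on small clusters. Integrating (y c - 1)_+ against it gives c_+^\<alpha> / (\<alpha> -
  1), the origin of the power and of the constant in the limit.\<close>

section \<open>Deterministic facts on large values, maximal partial sums and clamping\<close>

definition big :: "real \<Rightarrow> real \<Rightarrow> real" where
  "big c r = (if \<bar>r\<bar> > c then r else 0)"

text \<open>The empty sum takes part in the maximum, so the value is its own positive part. The
  recursion lets continuity, measurability and scaling follow by induction.\<close>

primrec maxsum :: "nat \<Rightarrow> (nat \<Rightarrow> real) \<Rightarrow> real" where
  "maxsum 0 a = 0"
| "maxsum (Suc k) a = max (maxsum k a) (\<Sum>i=1..Suc k. a i)"

text \<open>For K \<ge> 0 this is the length of the set of s in [0, K] with s < r. Such lengths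
  replace the number of starting times at which a cluster overshoots.\<close>

definition cutoff :: "real \<Rightarrow> real \<Rightarrow> real" where
  "cutoff K r = min K (max 0 r)"

lemma big_mult: "0 < x \<Longrightarrow> big (c * x) (x * r) = x * big c r"
  by (auto simp: big_def abs_mult mult.commute)

lemma abs_big_le: "\<bar>big c r\<bar> \<le> \<bar>r\<bar>"
  by (simp add: big_def)

lemma maxsum_ge: "t \<le> k \<Longrightarrow> (\<Sum>i=1..t. a i) \<le> maxsum k a"
  by (induction k) (auto simp: le_Suc_eq)

lemma maxsum_attained: "\<exists>t\<le>k. maxsum k a = (\<Sum>i=1..t. a i)"
proof (induction k)
  case (Suc k)
  then obtain t where "t \<le> k" "maxsum k a = (\<Sum>i=1..t. a i)" by blast
  then show ?case
    by (cases "maxsum k a \<le> (\<Sum>i=1..Suc k. a i)") (auto simp: max_def intro: exI[of _ t] exI[of _ "Suc k"])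
qed auto

lemma maxsum_cong: "(\<And>i. 1 \<le> i \<Longrightarrow> i \<le> k \<Longrightarrow> a i = b i) \<Longrightarrow> maxsum k a = maxsum k b"
proof (induction k)
  case (Suc k)
  have "(\<Sum>i=1..Suc k. a i) = (\<Sum>i=1..Suc k. b i)" by (rule sum.cong) (use Suc in auto)
  with Suc show ?case by simp
qed auto

lemma maxsum_mult: "0 \<le> c \<Longrightarrow> maxsum k (\<lambda>i. c * a i) = c * maxsum k a"
  by (induction k) (auto simp: max_mult_distrib_left sum_distrib_left distrib_left)

lemma maxsum_diff_le: "maxsum k a - maxsum k b \<le> (\<Sum>i=1..k. \<bar>a i - b i\<bar>)"
proof -
  obtain t where t: "t \<le> k" "maxsum k a = (\<Sum>i=1..t. a i)" using maxsum_attained by blast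
  have "(\<Sum>i=1..t. a i) - (\<Sum>i=1..t. b i) = (\<Sum>i=1..t. a i - b i)" by (simp add: sum_subtractf)
  also have "\<dots> \<le> (\<Sum>i=1..t. \<bar>a i - b i\<bar>)" by (rule sum_mono) auto
  also have "\<dots> \<le> (\<Sum>i=1..k. \<bar>a i - b i\<bar>)" by (rule sum_mono2) (use t in auto)
  finally show ?thesis using maxsum_ge[OF t(1), of b] t(2) by linarith
qed

lemma maxsum_diff: "\<bar>maxsum k a - maxsum k b\<bar> \<le> (\<Sum>i=1..k. \<bar>a i - b i\<bar>)"
  using maxsum_diff_le[of k a b] maxsum_diff_le[of k b a] by (simp add: abs_minus_commute abs_le_iff)

lemma cutoff_bounds: "0 \<le> K \<Longrightarrow> 0 \<le> cutoff K r" "cutoff K r \<le> K"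
  by (auto simp: cutoff_def)

lemma cutoff_lipschitz: "\<bar>cutoff K r - cutoff K s\<bar> \<le> \<bar>r - s\<bar>"
  by (auto simp: cutoff_def min_def max_def)

lemma cutoff_lipschitz_left: "\<bar>cutoff K r - cutoff L r\<bar> \<le> \<bar>K - L\<bar>"
  by (auto simp: cutoff_def min_def max_def)

lemma cutoff_mult: "0 \<le> c \<Longrightarrow> cutoff (c * K) (c * r) = c * cutoff K r"
  by (simp add: cutoff_def min_mult_distrib_left max_mult_distrib_left)

lemma cutoff_eq_0: "r \<le> 0 \<Longrightarrow> 0 \<le> K \<Longrightarrow> cutoff K r = 0"
  by (simp add: cutoff_def)

lemma cutoff_Suc: "cutoff (real (Suc n)) r = cutoff (real n) r + cutoff 1 (r - real n)"
  by (auto simp: cutoff_def min_def max_def)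

text \<open>Cut [0, n] at the integers: each unit interval contributes at least the indicator of its
  right end and at most that of its left end to the length.\<close>

lemma count_le_cutoff: "(\<Sum>j=1..n. of_bool (real j < r)) \<le> cutoff (real n) r"
proof (induction n)
  case (Suc n)
  have "of_bool (real (Suc n) < r) \<le> cutoff 1 (r - real n)" by (auto simp: cutoff_def)
  with Suc show ?case unfolding cutoff_Suc by simp
qed (simp add: cutoff_def)

lemma cutoff_le_count: "cutoff (real n) r \<le> 1 + (\<Sum>j=1..n. of_bool (real j < r))"
proof -
  \<comment> \<open>The left ends are 0, ..., n - 1; the extra 1 in the claim pays for the point 0,
    which the count from 1 lacks.\<close>
  have "cutoff (real n) r \<le> (\<Sum>j<n. of_bool (real j < r))"
  proof (induction n)
    case (Suc n)
    have "cutoff 1 (r - real n) \<le> of_bool (real n < r)" by (auto simp: cutoff_def)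
    with Suc show ?case unfolding cutoff_Suc by simp
  qed (simp add: cutoff_def)
  also have "\<dots> \<le> (\<Sum>j\<in>{0..n}. of_bool (real j < r))" by (rule sum_mono2) auto
  also have "\<dots> \<le> 1 + (\<Sum>j=1..n. of_bool (real j < r))"
    by (subst sum.atLeast_Suc_atMost) (auto simp: of_bool_def)
  finally show ?thesis .
qed

section \<open>Telescoping the ruin event over the first value kept\<close>

text \<open>Ruin by time n when only the values from time j on are kept, while the drift is still
  charged from time 0. So j = 1 is the ruin event itself, and the step from j to j + 1 drops b j
  together with the time j.\<close>

definition overshoot :: "real \<Rightarrow> real \<Rightarrow> (nat \<Rightarrow> real) \<Rightarrow> nat \<Rightarrow> nat \<Rightarrow> bool" where
  "overshoot \<rho> z b n j \<longleftrightarrow> (\<exists>t\<in>{j..n}. z < (\<Sum>i=j..t. b i) - \<rho> * real t)"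

lemma overshoot_telescope:
  "of_bool (overshoot \<rho> z b n 1)
     = (\<Sum>j=1..n. of_bool (overshoot \<rho> z b n j) - of_bool (overshoot \<rho> z b n (Suc j)) :: real)"
proof (cases n)
  case 0 then show ?thesis by (simp add: overshoot_def)
next
  case (Suc m)
  then have "1 \<le> n" by simp
  have "\<not> overshoot \<rho> z b n (Suc n)" by (simp add: overshoot_def)
  then show ?thesis using sum_Suc_diff[of 1 n "\<lambda>j. - of_bool (overshoot \<rho> z b n j) :: real"] by simp
qed

text \<open>Dropping a zero value changes no later sum, and at t = j the value - \<rho> j cannot
  exceed z > 0. Hence only indices with a nonzero value contribute to the telescoping sum.\<close>

lemma overshoot_Suc_eq:
  assumes "b j = 0" "0 < z" "0 \<le> \<rho>"
  shows "overshoot \<rho> z b n j = overshoot \<rho> z b n (Suc j)"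
proof -
  have 1: "(\<Sum>i=j..t. b i) = (\<Sum>i=Suc j..t. b i)" if "j < t" for t
    using assms(1) that by (simp add: sum.atLeast_Suc_atMost)
  have "0 \<le> \<rho> * real j" using assms(3) by simp
  then have 2: "\<not> z < (\<Sum>i=j..j. b i) - \<rho> * real j" using assms(1,2) by simp
  show ?thesis unfolding overshoot_def
  proof safe
    fix t assume t: "t \<in> {j..n}" "z < sum b {j..t} - \<rho> * real t"
    then have "j \<noteq> t" using 2 by auto
    then show "\<exists>t\<in>{Suc j..n}. z < sum b {Suc j..t} - \<rho> * real t" using 1[of t] t by (intro bexI[of _ t]) auto
  next
    fix t assume t: "t \<in> {Suc j..n}" "z < sum b {Suc j..t} - \<rho> * real t"
    then show "\<exists>t\<in>{j..n}. z < sum b {j..t} - \<rho> * real t" using 1[of t] by (intro bexI[of _ t]) auto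
  qed
qed

lemma sum_shift_1: "(\<Sum>i=1..s. f (j + i)) = sum f {Suc j..j + s}" for f :: "nat \<Rightarrow> real"
  using sum.shift_bounds_cl_nat_ivl[of f 1 j s] by (simp add: add.commute)

context
  fixes b :: "nat \<Rightarrow> real" and n k j :: nat and \<rho> z :: real
  assumes z: "0 < z" and \<rho>: "0 \<le> \<rho>" and k: "1 \<le> k"
begin

text \<open>When no value is left k or more steps after j, every longer sum equals the one stopped
  after k steps; the drift paid is at least the drift at time j.\<close>

lemma overshoot_SucD:
  assumes nobad: "\<And>i. k \<le> i \<Longrightarrow> i \<le> n \<Longrightarrow> b (j + i) = 0" and "overshoot \<rho> z b n (Suc j)"
  shows "z + \<rho> * real j < maxsum k (\<lambda>i. b (j + i))"
proof -
  obtain t where t: "Suc j \<le> t" "t \<le> n" "z < (\<Sum>i=Suc j..t. b i) - \<rho> * real t"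
    using assms(2) by (auto simp: overshoot_def)
  define s where "s = min (t - j) k"
  have "(\<Sum>i=Suc j..t. b i) = (\<Sum>i=1..t - j. b (j + i))" using t(1) sum_shift_1[of b j "t - j"] by simp
  also have "\<dots> = (\<Sum>i=1..s. b (j + i))"
    by (rule sum.mono_neutral_right) (use nobad t in \<open>auto simp: s_def\<close>)
  also have "\<dots> \<le> maxsum k (\<lambda>i. b (j + i))" by (rule maxsum_ge) (simp add: s_def)
  finally have "(\<Sum>i=Suc j..t. b i) \<le> maxsum k (\<lambda>i. b (j + i))" .
  moreover have "\<rho> * real j \<le> \<rho> * real t" using t \<rho> by (intro mult_left_mono) auto
  ultimately show ?thesis using t(3) by linarith
qed

lemma overshootD:
  assumes nobad: "\<And>i. k \<le> i \<Longrightarrow> i \<le> n \<Longrightarrow> b (j + i) = 0" and "overshoot \<rho> z b n j"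
  shows "z + \<rho> * real j < b j + maxsum k (\<lambda>i. b (j + i))"
proof -
  obtain t where t: "j \<le> t" "t \<le> n" "z < (\<Sum>i=j..t. b i) - \<rho> * real t"
    using assms(2) by (auto simp: overshoot_def)
  define s where "s = min (t - j) k"
  have "(\<Sum>i=j..t. b i) = b j + (\<Sum>i=1..t - j. b (j + i))"
    using t(1) sum_shift_1[of b j "t - j"] by (simp add: sum.atLeast_Suc_atMost)
  also have "(\<Sum>i=1..t - j. b (j + i)) = (\<Sum>i=1..s. b (j + i))"
    by (rule sum.mono_neutral_right) (use nobad t in \<open>auto simp: s_def\<close>)
  also have "\<dots> \<le> maxsum k (\<lambda>i. b (j + i))" by (rule maxsum_ge) (simp add: s_def)
  finally have "(\<Sum>i=j..t. b i) \<le> b j + maxsum k (\<lambda>i. b (j + i))" by simp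
  moreover have "\<rho> * real j \<le> \<rho> * real t" using t \<rho> by (intro mult_left_mono) auto
  ultimately show ?thesis using t(3) by linarith
qed

text \<open>The converse of \<open>overshoot_SucD\<close> up to a drift of k more steps: the
  maximising sum ends no later than j + k. This loss becomes negligible after division by x.\<close>

lemma overshoot_SucI:
  assumes "j + k \<le> n" and G: "z + \<rho> * (real j + real k) < maxsum k (\<lambda>i. b (j + i))"
  shows "overshoot \<rho> z b n (Suc j)"
proof -
  obtain s where s: "s \<le> k" "maxsum k (\<lambda>i. b (j + i)) = (\<Sum>i=1..s. b (j + i))"
    using maxsum_attained by blast
  \<comment> \<open>The empty sum would end at time j, which is not admissible when starting from j
    + 1; the positive level rules it out.\<close>
  have "s \<noteq> 0"
  proof
    assume "s = 0"
    with s G have "z + \<rho> * (real j + real k) < 0" by simp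
    moreover have "0 \<le> \<rho> * (real j + real k)" using \<rho> by simp
    ultimately show False using z by linarith
  qed
  have "\<rho> * real (j + s) \<le> \<rho> * (real j + real k)" using s \<rho> by (intro mult_left_mono) auto
  then have "z < (\<Sum>i=Suc j..j + s. b i) - \<rho> * real (j + s)"
    using G unfolding s(2) sum_shift_1 by linarith
  then show ?thesis unfolding overshoot_def using s(1) assms(1) \<open>s \<noteq> 0\<close> by (intro bexI[of _ "j + s"]) auto
qed

lemma overshootI:
  assumes "j + k \<le> n" and G: "z + \<rho> * (real j + real k) < b j + maxsum k (\<lambda>i. b (j + i))"
  shows "overshoot \<rho> z b n j"
proof -
  obtain s where s: "s \<le> k" "maxsum k (\<lambda>i. b (j + i)) = (\<Sum>i=1..s. b (j + i))"
    using maxsum_attained by blast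
  have "\<rho> * real (j + s) \<le> \<rho> * (real j + real k)" using s \<rho> by (intro mult_left_mono) auto
  moreover have "(\<Sum>i=j..j + s. b i) = b j + (\<Sum>i=Suc j..j + s. b i)"
    by (simp add: sum.atLeast_Suc_atMost)
  ultimately have "z < (\<Sum>i=j..j + s. b i) - \<rho> * real (j + s)"
    using G unfolding s(2) sum_shift_1 by linarith
  then show ?thesis unfolding overshoot_def using s(1) assms(1) by (intro bexI[of _ "j + s"]) auto
qed

text \<open>The thresholds are separate because an upper bound charges the drift at j in the first
  term and at j + k in the second, and a lower bound does the opposite.\<close>

abbreviation "jumpdiff s r \<equiv> (of_bool (s < b j + maxsum k (\<lambda>i. b (j + i)))
   - of_bool (r < maxsum k (\<lambda>i. b (j + i))) :: real)"

text \<open>The two ways in which k steps misrepresent the future of j: a nonzero value returns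
  after k or more steps, or the window runs past n.\<close>

abbreviation "bad \<equiv> (of_bool (b j \<noteq> 0 \<and> (\<exists>i\<in>{k..n}. b (j + i) \<noteq> 0)) + of_bool (n < j + k \<and> b j \<noteq> 0) :: real)"

text \<open>Both differences of indicators lie in [-1, 1], so the slack 2 makes the inequality
  trivial on the exceptional events. Off them the implications above apply.\<close>

lemma overshoot_diff_le:
  "of_bool (overshoot \<rho> z b n j) - of_bool (overshoot \<rho> z b n (Suc j))
     \<le> of_bool (b j \<noteq> 0) * jumpdiff (z + \<rho> * real j) (z + \<rho> * (real j + real k)) + 2 * bad"
proof (cases "b j = 0")
  case True then show ?thesis using overshoot_Suc_eq[of b j z \<rho> n] z \<rho> by simp
next
  case False
  then show ?thesis using overshootD overshoot_SucI
    by (cases "\<exists>i\<in>{k..n}. b (j + i) \<noteq> 0"; cases "n < j + k") (auto simp: not_less split: if_splits)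
qed

lemma overshoot_diff_ge:
  "of_bool (b j \<noteq> 0) * jumpdiff (z + \<rho> * (real j + real k)) (z + \<rho> * real j) - 2 * bad
     \<le> of_bool (overshoot \<rho> z b n j) - of_bool (overshoot \<rho> z b n (Suc j))"
proof (cases "b j = 0")
  case True then show ?thesis using overshoot_Suc_eq[of b j z \<rho> n] z \<rho> by simp
next
  case False
  then show ?thesis using overshootI overshoot_SucD
    by (cases "\<exists>i\<in>{k..n}. b (j + i) \<noteq> 0"; cases "n < j + k") (auto simp: not_less split: if_splits)
qed

end

section \<open>Weak convergence to the tail process\<close>

text \<open>If A is null both sides are 0 by the conventions on division. This case matters because
  the formula is applied before the tail probabilities are known to be positive.\<close>

lemma integral_uniform_measure:
  fixes f :: "'a \<Rightarrow> real"
  assumes A: "A \<in> sets M" "emeasure M A \<noteq> \<infinity>" and [measurable]: "f \<in> borel_measurable M"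
  shows "(\<integral>x. f x \<partial>uniform_measure M A) = (\<integral>x. indicator A x * f x \<partial>M) / measure M A"
proof (cases "emeasure M A = 0")
  case True
  have "AE x in M. x \<notin> A" using A True by (intro AE_not_in) (auto simp: null_sets_def)
  then have "uniform_measure M A = density M (\<lambda>_. 0)"
    unfolding uniform_measure_def using A by (intro density_cong) auto
  then have "(\<integral>x. f x \<partial>uniform_measure M A) = (\<integral>x. 0 * f x \<partial>M)"
    by (simp add: integral_density[of f M "\<lambda>_. 0", simplified])
  then show ?thesis using True by (simp add: measure_def)
next
  case False
  then have pos: "0 < measure M A" using A by (simp add: measure_def enn2real_positive_iff less_top zero_less_iff_neq_zero)
  have e: "emeasure M A = ennreal (measure M A)" using A by (simp add: emeasure_eq_ennreal_measure)
  have "uniform_measure M A = density M (\<lambda>x. ennreal (indicator A x / measure M A))"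
    unfolding uniform_measure_def e using pos
    by (intro density_cong) (use A in \<open>auto simp: divide_ennreal[symmetric] ennreal_indicator[symmetric] simp del: ennreal_indicator\<close>)
  then have "(\<integral>x. f x \<partial>uniform_measure M A) = (\<integral>x. (indicator A x / measure M A) * f x \<partial>M)"
    using A pos by (simp add: integral_density)
  also have "\<dots> = (\<integral>x. (indicator A x * f x) / measure M A \<partial>M)" by simp
  also have "\<dots> = (\<integral>x. indicator A x * f x \<partial>M) / measure M A" by simp
  finally show ?thesis .
qed

lemma continuous_on_coordinate [continuous_intros]: "continuous_on S (\<lambda>v::int \<Rightarrow> real. v i)"
  by (rule continuous_on_subset[OF continuous_on_product_coordinates]) auto

lemma measurable_coordinate [measurable]: "(\<lambda>v::int \<Rightarrow> real. v i) \<in> borel_measurable borel"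
  by (intro borel_measurable_continuous_onI continuous_intros)

lemma continuous_on_cutoff [continuous_intros]:
  "continuous_on S f \<Longrightarrow> continuous_on S (\<lambda>x. cutoff K (f x))"
  unfolding cutoff_def by (intro continuous_intros)

lemma measurable_cutoff [measurable]: "cutoff K \<in> borel_measurable borel"
  by (intro borel_measurable_continuous_onI continuous_intros)

lemma continuous_on_maxsum [continuous_intros]:
  "(\<And>i. continuous_on S (\<lambda>x. a x i)) \<Longrightarrow> continuous_on S (\<lambda>x. maxsum k (a x))"
proof (induction k)
  case (Suc k)
  then have "continuous_on S (\<lambda>x. max (maxsum k (a x)) (\<Sum>i=1..Suc k. a x i))"
    by (intro continuous_intros) auto
  then show ?case by simp
qed auto

lemma measurable_maxsum [measurable (raw)]:
  "(\<And>i. (\<lambda>x. a x i) \<in> borel_measurable M) \<Longrightarrow> (\<lambda>x. maxsum k (a x)) \<in> borel_measurable M"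
proof (induction k)
  case (Suc k)
  then have "(\<lambda>x. max (maxsum k (a x)) (\<Sum>i=1..Suc k. a x i)) \<in> borel_measurable M"
    by (intro borel_measurable_max borel_measurable_sum) auto
  then show ?case by simp
qed auto

lemma measurable_big [measurable]: "big c \<in> borel_measurable borel"
  unfolding big_def by measurable

text \<open>For m > 0 this is 1 if |r| \<le> 1/m and 0 if |r| \<ge> 2/m. It is a continuous majorant
  of the error made when the step at 0 is replaced by the ramp \<open>cutoff 1 (real m * r)\<close>,
  and its mean tends to the mass of the atom at 0.\<close>

definition bump :: "nat \<Rightarrow> real \<Rightarrow> real" where
  "bump m r = cutoff 1 (2 - real m * \<bar>r\<bar>)"

lemma bump_bounds [simp]: "0 \<le> bump m r" "bump m r \<le> 1"
  by (auto simp: bump_def cutoff_def)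

lemma continuous_on_bump [continuous_intros]:
  "continuous_on S f \<Longrightarrow> continuous_on S (\<lambda>x. bump m (f x))"
  unfolding bump_def by (intro continuous_intros)

lemma measurable_bump [measurable]: "bump m \<in> borel_measurable borel"
  by (intro borel_measurable_continuous_onI continuous_intros)

lemma step_cutoff_diff: "\<bar>of_bool (0 < r) - cutoff 1 (real m * r)\<bar> \<le> bump m r"
  by (auto simp: cutoff_def bump_def min_def max_def mult_nonneg_nonpos)

lemma bump_tendsto: "(\<lambda>m. bump m r) \<longlonglongrightarrow> of_bool (r = 0)"
proof (cases "r = 0")
  case False
  obtain m0 :: nat where m0: "2 / \<bar>r\<bar> < real m0" using reals_Archimedean2 by blast
  have "bump m r = 0" if "m0 \<le> m" for m
  proof -
    have "2 / \<bar>r\<bar> \<le> real m" using m0 that by linarith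
    then show ?thesis using False by (auto simp: bump_def cutoff_def field_simps)
  qed
  then have "(\<lambda>m. bump m r) \<longlonglongrightarrow> 0"
    by (intro tendsto_eventually) (auto simp: eventually_sequentially)
  then show ?thesis using False by simp
qed (simp add: bump_def cutoff_def)

lemma bcontfun_realI:
  fixes f :: "'a::topological_space \<Rightarrow> real"
  shows "continuous_on UNIV f \<Longrightarrow> (\<And>v. \<bar>f v\<bar> \<le> B) \<Longrightarrow> f \<in> bcontfun"
  by (auto simp: bcontfun_def bounded_iff intro!: exI[of _ B])

lemma bcontfun_realD:
  fixes f :: "'a::topological_space \<Rightarrow> real"
  assumes "f \<in> bcontfun"
  shows "f \<in> borel_measurable borel" "\<exists>B. \<forall>v. \<bar>f v\<bar> \<le> B"
  using assms by (auto simp: bcontfun_def bounded_iff intro: borel_measurable_continuous_onI)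

section \<open>Conditional means given a large value at time 0\<close>

locale tail_pair = prob_space M for M :: "'a measure" +
  fixes X :: "int \<Rightarrow> 'a \<Rightarrow> real" and \<alpha> :: real and N :: "'b measure" and Y :: "int \<Rightarrow> 'b \<Rightarrow> real"
  assumes X_measurable [measurable]: "\<And>t. X t \<in> borel_measurable M"
    and alpha: "1 < \<alpha>"
    and tail: "tail_process M X \<alpha> N Y"
begin

lemma Y_measurable [measurable]: "Y t \<in> borel_measurable N"
  using tail by (simp add: tail_process_def)

sublocale N: prob_space N
  using tail by (simp add: tail_process_def)

definition p :: "real \<Rightarrow> real" where
  "p x = prob {\<omega> \<in> space M. x < \<bar>X 0 \<omega>\<bar>}"

text \<open>Convergence to the tail process is given on finite windows only; functions of this kind
  can nevertheless be evaluated at the whole path.\<close>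

definition windowed :: "nat \<Rightarrow> ((int \<Rightarrow> real) \<Rightarrow> real) \<Rightarrow> bool" where
  "windowed k f \<longleftrightarrow> (\<forall>v. f (window {- int k..int k} v) = f v)"

text \<open>The conditional expectation of f (X / x) given |X_0| > x, written as a quotient so that
  different levels can be compared.\<close>

definition tail_mean :: "((int \<Rightarrow> real) \<Rightarrow> real) \<Rightarrow> real \<Rightarrow> real" where
  "tail_mean f x = (\<integral>\<omega>. indicator {\<omega> \<in> space M. x < \<bar>X 0 \<omega>\<bar>} \<omega> * f (\<lambda>t. X t \<omega> / x) \<partial>M) / p x"

lemma path_measurable:
  fixes Z :: "int \<Rightarrow> 'c \<Rightarrow> real"
  assumes "\<And>t. (\<lambda>\<omega>. Z t \<omega>) \<in> borel_measurable L"
  shows "(\<lambda>\<omega> t. Z t \<omega>) \<in> borel_measurable L"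
  by (rule measurable_coordinatewise_then_product) (use assms in auto)

lemma path_measurable_X [measurable]: "(\<lambda>\<omega> t. X t \<omega> / x) \<in> borel_measurable M"
  by (rule path_measurable) simp

lemma path_measurable_Y [measurable]: "(\<lambda>\<omega> t. Y t \<omega>) \<in> borel_measurable N"
  by (rule path_measurable) simp

lemma window_measurable:
  fixes Z :: "int \<Rightarrow> 'c \<Rightarrow> real"
  assumes "\<And>t. (\<lambda>\<omega>. Z t \<omega>) \<in> borel_measurable L"
  shows "(\<lambda>\<omega>. window I (\<lambda>t. Z t \<omega>)) \<in> borel_measurable L"
  unfolding window_def by (rule measurable_coordinatewise_then_product) (use assms in auto)

lemma tail_mean_tendsto_cont:
  assumes f: "f \<in> bcontfun" and w: "windowed k f"
  shows "(tail_mean f \<longlongrightarrow> (\<integral>\<omega>. f (\<lambda>t. Y t \<omega>) \<partial>N)) at_top"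
proof -
  note [measurable] = bcontfun_realD(1)[OF f]
  let ?W = "window {- int k..int k}"
  have wX [measurable]: "(\<lambda>\<omega>. ?W (\<lambda>t. X t \<omega> / x)) \<in> borel_measurable M" for x
    by (rule window_measurable) simp
  have wY [measurable]: "(\<lambda>\<omega>. ?W (\<lambda>t. Y t \<omega>)) \<in> borel_measurable N"
    by (rule window_measurable) simp
  have "((\<lambda>x. \<integral>v. f v \<partial>distr (uniform_measure M {\<omega> \<in> space M. \<bar>X 0 \<omega>\<bar> > x}) borel (\<lambda>\<omega>. ?W (\<lambda>t. X t \<omega> / x)))
     \<longlongrightarrow> (\<integral>v. f v \<partial>distr N borel (\<lambda>\<omega>. ?W (\<lambda>t. Y t \<omega>)))) at_top"
    using tail f unfolding tail_process_def weakly_tendsto_def by blast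
  moreover have "(\<integral>v. f v \<partial>distr N borel (\<lambda>\<omega>. ?W (\<lambda>t. Y t \<omega>))) = (\<integral>\<omega>. f (\<lambda>t. Y t \<omega>) \<partial>N)"
    using w by (subst integral_distr) (auto simp: windowed_def)
  moreover have "(\<integral>v. f v \<partial>distr (uniform_measure M {\<omega> \<in> space M. \<bar>X 0 \<omega>\<bar> > x}) borel (\<lambda>\<omega>. ?W (\<lambda>t. X t \<omega> / x)))
     = tail_mean f x" for x
    using w by (subst integral_distr) (auto simp: windowed_def integral_uniform_measure tail_mean_def p_def)
  ultimately show ?thesis by simp
qed

lemma p_antimono: "x \<le> y \<Longrightarrow> p y \<le> p x"
  unfolding p_def by (rule finite_measure_mono) auto

text \<open>The tail mean of the constant 1 tends to 1. It equals p y / p y, which would be 0 for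
  all large y if the antimonotone \<open>p\<close> vanished anywhere.\<close>

lemma p_pos: "0 < p x"
proof -
  have "(tail_mean (\<lambda>_. 1) \<longlongrightarrow> (\<integral>\<omega>. 1 \<partial>N)) at_top"
    by (rule tail_mean_tendsto_cont[of _ 0]) (auto simp: const_bcontfun windowed_def)
  moreover have "tail_mean (\<lambda>_. 1) = (\<lambda>y. p y / p y)"
    by (rule ext) (simp add: tail_mean_def p_def)
  ultimately have "((\<lambda>y. p y / p y) \<longlongrightarrow> (\<integral>\<omega>. 1 \<partial>N)) at_top" by (simp only:)
  then have "((\<lambda>y. p y / p y) \<longlongrightarrow> 1) at_top" by (subst (asm) lebesgue_integral_const) (simp add: N.prob_space)
  then have "\<forall>\<^sub>F y in at_top. 0 < p y / p y" by (rule order_tendstoD) simp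
  then have "\<forall>\<^sub>F y in at_top. x \<le> y \<and> 0 < p y / p y" by (intro eventually_conj eventually_ge_at_top)
  then obtain y where "x \<le> y" "0 < p y / p y" using eventually_happens trivial_limit_at_top_linorder by blast
  moreover have "0 \<le> p y" by (simp add: p_def)
  ultimately show ?thesis using p_antimono[of x y] by (cases "p y = 0") auto
qed

text \<open>Extends weak convergence to discontinuous f: continuous g m approximate f within
  continuous h m, and convergence for h m itself carries the smallness of the error from the tail
  process back to the conditional means.\<close>

lemma tail_mean_tendsto:
  assumes [measurable]: "f \<in> borel_measurable borel"
    and w: "windowed k f"
    and g: "\<And>m. g m \<in> bcontfun" "\<And>m. windowed k (g m)"
    and h: "\<And>m. h m \<in> bcontfun" "\<And>m. windowed k (h m)"
    and le: "\<And>m v. \<bar>f v - g m v\<bar> \<le> h m v"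
    and h0: "(\<lambda>m. \<integral>\<omega>. h m (\<lambda>t. Y t \<omega>) \<partial>N) \<longlonglongrightarrow> 0"
  shows "(tail_mean f \<longlongrightarrow> (\<integral>\<omega>. f (\<lambda>t. Y t \<omega>) \<partial>N)) at_top"
proof (rule tendstoI)
  fix e :: real assume e: "0 < e"
  note [measurable] = bcontfun_realD(1)[OF g(1)] bcontfun_realD(1)[OF h(1)]
  have bnd: "\<exists>B. \<forall>v. \<bar>g m v\<bar> \<le> B" "\<exists>B. \<forall>v. \<bar>h m v\<bar> \<le> B" for m
    using bcontfun_realD(2)[OF g(1)] bcontfun_realD(2)[OF h(1)] by auto
  have bf: "\<exists>B. \<forall>v. \<bar>f v\<bar> \<le> B"
  proof -
    obtain B1 B2 where B: "\<And>v. \<bar>g 0 v\<bar> \<le> B1" "\<And>v. \<bar>h 0 v\<bar> \<le> B2" using bnd[of 0] by blast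
    have "\<bar>f v\<bar> \<le> B1 + B2" for v using le[of v 0] B[of v] by linarith
    then show ?thesis by blast
  qed
  have iN: "integrable N (\<lambda>\<omega>. F (\<lambda>t. Y t \<omega>))"
    and iM: "integrable M (\<lambda>\<omega>. indicator {\<omega> \<in> space M. x < \<bar>X 0 \<omega>\<bar>} \<omega> * F (\<lambda>t. X t \<omega> / x))"
    if mF [measurable]: "F \<in> borel_measurable borel" and bF: "\<exists>B. \<forall>v. \<bar>F v\<bar> \<le> B" for F :: "(int \<Rightarrow> real) \<Rightarrow> real" and x
  proof -
    obtain B where B: "\<And>v. \<bar>F v\<bar> \<le> B" using bF by blast
    show "integrable N (\<lambda>\<omega>. F (\<lambda>t. Y t \<omega>))"
      by (rule N.integrable_const_bound[of _ B]) (auto simp: B)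
    show "integrable M (\<lambda>\<omega>. indicator {\<omega> \<in> space M. x < \<bar>X 0 \<omega>\<bar>} \<omega> * F (\<lambda>t. X t \<omega> / x))"
      by (rule integrable_const_bound[of _ "\<bar>B\<bar>"]) (use B in \<open>auto simp: indicator_def intro!: AE_I2 order.trans[OF B abs_ge_self]\<close>)
  qed
  obtain m where m: "(\<integral>\<omega>. h m (\<lambda>t. Y t \<omega>) \<partial>N) < e / 4"
    using order_tendstoD(2)[OF h0, of "e / 4"] e eventually_happens'[OF sequentially_bot] by auto
  have N: "\<bar>(\<integral>\<omega>. f (\<lambda>t. Y t \<omega>) \<partial>N) - (\<integral>\<omega>. g m (\<lambda>t. Y t \<omega>) \<partial>N)\<bar> \<le> (\<integral>\<omega>. h m (\<lambda>t. Y t \<omega>) \<partial>N)"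
  proof -
    have "\<bar>(\<integral>\<omega>. f (\<lambda>t. Y t \<omega>) - g m (\<lambda>t. Y t \<omega>) \<partial>N)\<bar> \<le> (\<integral>\<omega>. \<bar>f (\<lambda>t. Y t \<omega>) - g m (\<lambda>t. Y t \<omega>)\<bar> \<partial>N)"
      by (rule integral_abs_bound)
    also have "\<dots> \<le> (\<integral>\<omega>. h m (\<lambda>t. Y t \<omega>) \<partial>N)"
      by (intro integral_mono integrable_abs Bochner_Integration.integrable_diff iN bf bnd) (auto simp: le)
    finally show ?thesis by (simp add: iN bf bnd)
  qed
  have M: "\<bar>tail_mean f x - tail_mean (g m) x\<bar> \<le> tail_mean (h m) x" for x
  proof -
    let ?I = "indicator {\<omega> \<in> space M. x < \<bar>X 0 \<omega>\<bar>} :: 'a \<Rightarrow> real"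
    have "\<bar>(\<integral>\<omega>. ?I \<omega> * f (\<lambda>t. X t \<omega> / x) - ?I \<omega> * g m (\<lambda>t. X t \<omega> / x) \<partial>M)\<bar>
       \<le> (\<integral>\<omega>. \<bar>?I \<omega> * f (\<lambda>t. X t \<omega> / x) - ?I \<omega> * g m (\<lambda>t. X t \<omega> / x)\<bar> \<partial>M)"
      by (rule integral_abs_bound)
    also have "\<dots> \<le> (\<integral>\<omega>. ?I \<omega> * h m (\<lambda>t. X t \<omega> / x) \<partial>M)"
      by (intro integral_mono integrable_abs Bochner_Integration.integrable_diff iM bf bnd) (auto simp: le indicator_def)
    finally have "\<bar>(\<integral>\<omega>. ?I \<omega> * f (\<lambda>t. X t \<omega> / x) \<partial>M) - (\<integral>\<omega>. ?I \<omega> * g m (\<lambda>t. X t \<omega> / x) \<partial>M)\<bar>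
       \<le> (\<integral>\<omega>. ?I \<omega> * h m (\<lambda>t. X t \<omega> / x) \<partial>M)" by (simp add: iM bf bnd)
    then show ?thesis unfolding tail_mean_def diff_divide_distrib[symmetric] abs_divide
      using p_pos[of x] by (simp add: divide_right_mono)
  qed
  have "\<forall>\<^sub>F x in at_top. tail_mean (h m) x < e / 4"
    by (rule order_tendstoD(2)[OF tail_mean_tendsto_cont[OF h] m])
  moreover have "\<forall>\<^sub>F x in at_top. dist (tail_mean (g m) x) (\<integral>\<omega>. g m (\<lambda>t. Y t \<omega>) \<partial>N) < e / 4"
    by (rule tendstoD[OF tail_mean_tendsto_cont[OF g]]) (use e in simp)
  ultimately show "\<forall>\<^sub>F x in at_top. dist (tail_mean f x) (\<integral>\<omega>. f (\<lambda>t. Y t \<omega>) \<partial>N) < e"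
  proof eventually_elim
    case (elim x)
    then show ?case using M[of x] N m unfolding dist_real_def by linarith
  qed
qed

lemma bump_mean_tendsto:
  "(\<lambda>m. \<integral>\<omega>. bump m (\<bar>Y t \<omega>\<bar> - u) \<partial>N) \<longlonglongrightarrow> \<P>(\<omega> in N. \<bar>Y t \<omega>\<bar> = u)"
proof -
  have "(\<lambda>m. \<integral>\<omega>. bump m (\<bar>Y t \<omega>\<bar> - u) \<partial>N) \<longlonglongrightarrow> (\<integral>\<omega>. of_bool (\<bar>Y t \<omega>\<bar> - u = 0) \<partial>N)"
  proof (rule integral_dominated_convergence[of _ _ _ "\<lambda>_. 1"])
    show "AE \<omega> in N. (\<lambda>m. bump m (\<bar>Y t \<omega>\<bar> - u)) \<longlonglongrightarrow> of_bool (\<bar>Y t \<omega>\<bar> - u = 0)"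
      using bump_tendsto by (intro AE_I2)
  qed auto
  also have "(\<integral>\<omega>. of_bool (\<bar>Y t \<omega>\<bar> - u = 0) \<partial>N) = (\<integral>\<omega>. indicator {\<omega> \<in> space N. \<bar>Y t \<omega>\<bar> = u} \<omega> \<partial>N)"
    by (rule Bochner_Integration.integral_cong) (auto simp: indicator_def)
  finally show ?thesis by simp
qed

lemma Y0_tail: "1 < y \<Longrightarrow> \<P>(\<omega> in N. y < \<bar>Y 0 \<omega>\<bar>) = y powr - \<alpha>"
  using tail by (simp add: tail_process_def)

text \<open>The Pareto tail is given for y > 1 only; letting y decrease to 1 puts the full mass
  above 1.\<close>

lemma Y0_gt_1: "AE \<omega> in N. 1 < \<bar>Y 0 \<omega>\<bar>"
proof -
  have "\<P>(\<omega> in N. 1 < \<bar>Y 0 \<omega>\<bar>) \<ge> 1"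
  proof (rule tendsto_upperbound)
    show "((\<lambda>y. y powr - \<alpha>) \<longlongrightarrow> 1) (at_right 1)"
      using tendsto_powr[OF tendsto_ident_at[of "1::real" "{1<..}"] tendsto_const[of "- \<alpha>"]] by simp
    show "\<forall>\<^sub>F y in at_right 1. y powr - \<alpha> \<le> \<P>(\<omega> in N. 1 < \<bar>Y 0 \<omega>\<bar>)"
      using eventually_at_right_less[of "1::real"]
      by eventually_elim (subst Y0_tail[symmetric], auto intro!: N.finite_measure_mono)
  qed auto
  then show ?thesis using N.prob_le_1 by (subst N.prob_Collect_eq_1[symmetric]) (auto intro: antisym)
qed

lemma Y0_no_atom:
  assumes "1 \<le> u" shows "\<P>(\<omega> in N. \<bar>Y 0 \<omega>\<bar> = u) = 0"
proof (cases "u = 1")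
  case True
  then show ?thesis using Y0_gt_1 by (subst N.prob_Collect_eq_0) (auto elim: eventually_mono)
next
  case False
  have "\<P>(\<omega> in N. \<bar>Y 0 \<omega>\<bar> = u) \<le> 0"
  proof (rule tendsto_lowerbound)
    have "((\<lambda>y. y powr - \<alpha>) \<longlongrightarrow> u powr - \<alpha>) (at_left u)"
      by (rule tendsto_powr[OF tendsto_ident_at tendsto_const]) (use assms in auto)
    from tendsto_diff[OF this tendsto_const, of "u powr - \<alpha>"]
    show "((\<lambda>y. y powr - \<alpha> - u powr - \<alpha>) \<longlongrightarrow> 0) (at_left u)"
      by simp
    have "\<forall>\<^sub>F y in at_left u. y \<in> {1<..<u}"
      by (rule eventually_at_leftI[of 1]) (use False assms in auto)
    then show "\<forall>\<^sub>F y in at_left u. \<P>(\<omega> in N. \<bar>Y 0 \<omega>\<bar> = u) \<le> y powr - \<alpha> - u powr - \<alpha>"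
    proof eventually_elim
      case (elim y)
      have "\<P>(\<omega> in N. \<bar>Y 0 \<omega>\<bar> = u) + \<P>(\<omega> in N. u < \<bar>Y 0 \<omega>\<bar>)
         = N.prob ({\<omega>\<in>space N. \<bar>Y 0 \<omega>\<bar> = u} \<union> {\<omega>\<in>space N. u < \<bar>Y 0 \<omega>\<bar>})"
        by (subst N.finite_measure_Union) auto
      also have "\<dots> \<le> \<P>(\<omega> in N. y < \<bar>Y 0 \<omega>\<bar>)"
        by (rule N.finite_measure_mono) (use elim in auto)
      finally show ?case using elim by (simp add: Y0_tail)
    qed
  qed auto
  then show ?thesis by (simp add: antisym)
qed

lemma Y0_tail_ge: "1 \<le> y \<Longrightarrow> \<P>(\<omega> in N. y < \<bar>Y 0 \<omega>\<bar>) = y powr - \<alpha>"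
  using Y0_tail Y0_gt_1 by (cases "y = 1") (auto simp: N.prob_Collect_eq_1)

text \<open>The step is discontinuous only on |v 0| = u, and |Y 0| has no atom at u, so replacing
  the step by a ramp costs a bump of vanishing mean.\<close>

lemma tail_mean_tendsto_step:
  assumes u: "1 \<le> u" and f: "f \<in> bcontfun" "windowed k f"
  shows "(tail_mean (\<lambda>v. of_bool (u < \<bar>v 0\<bar>) * f v)
     \<longlongrightarrow> (\<integral>\<omega>. of_bool (u < \<bar>Y 0 \<omega>\<bar>) * f (\<lambda>t. Y t \<omega>) \<partial>N)) at_top"
proof -
  note [measurable] = bcontfun_realD(1)[OF f(1)]
  obtain B where B: "\<And>v. \<bar>f v\<bar> \<le> B" using bcontfun_realD(2)[OF f(1)] by blast
  then have B0: "0 \<le> B" using abs_ge_zero order.trans by blast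
  have cf: "continuous_on UNIV f" using f by (simp add: bcontfun_def)
  let ?c = "\<lambda>m v. cutoff 1 (real m * (\<bar>v 0\<bar> - u))"
  have c1: "\<bar>?c m v\<bar> \<le> 1" for m v by (auto simp: cutoff_def)
  show ?thesis
  proof (rule tail_mean_tendsto[where g="\<lambda>m v. ?c m v * f v" and h="\<lambda>m v. bump m (\<bar>v 0\<bar> - u) * B" and k=k])
    show "(\<lambda>v. ?c m v * f v) \<in> bcontfun" for m
      by (rule bcontfun_realI[of _ B])
        (use mult_mono[OF c1 B] in \<open>auto simp: abs_mult intro!: continuous_intros cf\<close>)
    show "(\<lambda>v. bump m (\<bar>v 0\<bar> - u) * B) \<in> bcontfun" for m
      by (rule bcontfun_realI[of _ B]) (use B0 in \<open>auto simp: mult_left_le_one_le intro!: continuous_intros\<close>)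
    show "windowed k (\<lambda>v. of_bool (u < \<bar>v 0\<bar>) * f v)" "windowed k (\<lambda>v. ?c m v * f v)"
      "windowed k (\<lambda>v. bump m (\<bar>v 0\<bar> - u) * B)" for m
      using f(2) by (auto simp: windowed_def window_def)
    show "\<bar>of_bool (u < \<bar>v 0\<bar>) * f v - ?c m v * f v\<bar> \<le> bump m (\<bar>v 0\<bar> - u) * B" for m v
      using mult_mono[OF step_cutoff_diff[of "\<bar>v 0\<bar> - u" m] B[of v]]
      unfolding left_diff_distrib[symmetric] abs_mult by simp
    have "(\<lambda>m. (\<integral>\<omega>. bump m (\<bar>Y 0 \<omega>\<bar> - u) \<partial>N) * B) \<longlonglongrightarrow> 0 * B"
      using bump_mean_tendsto[of 0 u] unfolding Y0_no_atom[OF u] by (intro tendsto_mult_right)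
    then show "(\<lambda>m. \<integral>\<omega>. bump m (\<bar>Y 0 \<omega>\<bar> - u) * B \<partial>N) \<longlonglongrightarrow> 0" by simp
    show "(\<lambda>v. of_bool (u < \<bar>v 0\<bar>) * f v) \<in> borel_measurable borel"
      by (intro borel_measurable_times bcontfun_realD(1)[OF f(1)]) measurable
  qed
qed

text \<open>For u \<ge> 1 the event |X 0| > u x is contained in |X 0| > x, so that the ratio is
  itself a tail mean.\<close>

lemma p_regular_ge:
  assumes "1 \<le> u" shows "((\<lambda>x. p (u * x) / p x) \<longlongrightarrow> u powr - \<alpha>) at_top"
proof -
  have "(tail_mean (\<lambda>v. of_bool (u < \<bar>v 0\<bar>) * 1) \<longlongrightarrow> (\<integral>\<omega>. of_bool (u < \<bar>Y 0 \<omega>\<bar>) * (1::real) \<partial>N)) at_top"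
    by (rule tail_mean_tendsto_step[of _ _ 0]) (use assms in \<open>auto simp: const_bcontfun windowed_def\<close>)
  moreover have "(\<integral>\<omega>. of_bool (u < \<bar>Y 0 \<omega>\<bar>) * (1::real) \<partial>N) = (\<integral>\<omega>. indicator {\<omega> \<in> space N. u < \<bar>Y 0 \<omega>\<bar>} \<omega> \<partial>N)"
    by (rule Bochner_Integration.integral_cong) (auto simp: indicator_def)
  ultimately have "(tail_mean (\<lambda>v. of_bool (u < \<bar>v 0\<bar>) * 1) \<longlongrightarrow> u powr - \<alpha>) at_top"
    using Y0_tail_ge[OF assms] by simp
  moreover have "\<forall>\<^sub>F x in at_top. tail_mean (\<lambda>v. of_bool (u < \<bar>v 0\<bar>) * 1) x = p (u * x) / p x"
    using eventually_gt_at_top[of 0]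
  proof eventually_elim
    case (elim x)
    have "x < \<bar>X 0 \<omega>\<bar>" if "u * x < \<bar>X 0 \<omega>\<bar>" for \<omega>
      using that mult_right_mono[of 1 u x] assms elim by linarith
    then have "(\<integral>\<omega>. indicator {\<omega> \<in> space M. x < \<bar>X 0 \<omega>\<bar>} \<omega> * (of_bool (u < \<bar>X 0 \<omega> / x\<bar>) * (1::real)) \<partial>M)
       = (\<integral>\<omega>. indicator {\<omega> \<in> space M. u * x < \<bar>X 0 \<omega>\<bar>} \<omega> \<partial>M)"
      using elim by (intro Bochner_Integration.integral_cong) (auto simp: indicator_def field_simps)
    then show ?case by (simp add: tail_mean_def p_def)
  qed
  ultimately show ?thesis by (rule Lim_transform_eventually)
qed

text \<open>For u < 1 the two levels exchange roles: use the factor 1/u at the level u x and take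
  reciprocals.\<close>

lemma p_regular:
  assumes "0 < u" shows "((\<lambda>x. p (u * x) / p x) \<longlongrightarrow> u powr - \<alpha>) at_top"
proof (cases "1 \<le> u")
  case True then show ?thesis by (rule p_regular_ge)
next
  case False
  have "((\<lambda>x. p (inverse u * x) / p x) \<longlongrightarrow> inverse u powr - \<alpha>) at_top"
    by (rule p_regular_ge) (use False assms in \<open>auto simp: one_le_inverse_iff\<close>)
  moreover have "filterlim (\<lambda>x. u * x) at_top at_top"
    by (rule filterlim_tendsto_pos_mult_at_top[OF tendsto_const assms filterlim_ident])
  ultimately have "((\<lambda>x. p (inverse u * (u * x)) / p (u * x)) \<longlongrightarrow> inverse u powr - \<alpha>) at_top"
    by (rule filterlim_compose[of "\<lambda>x. p (inverse u * x) / p x"])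
  then have "((\<lambda>x. inverse (p (inverse u * (u * x)) / p (u * x))) \<longlongrightarrow> inverse (inverse u powr - \<alpha>)) at_top"
    by (rule tendsto_inverse) (use assms in simp)
  moreover have "inverse (inverse u powr - \<alpha>) = u powr - \<alpha>"
    using assms by (simp add: powr_def ln_inverse exp_minus)
  moreover have "inverse u * (u * x) = x" for x using assms by simp
  ultimately show ?thesis by simp
qed

end

section \<open>Polar decomposition of the tail process\<close>

text \<open>The indicator of a closed set is a pointwise limit of bounded continuous functions of
  the distance to it, and closed sets are an intersection-stable generator.\<close>

lemma measure_eqI_bcontfun:
  fixes \<mu> \<nu> :: "'a::metric_space measure"
  assumes "finite_measure \<mu>" "finite_measure \<nu>"
    and sets: "sets \<mu> = sets borel" "sets \<nu> = sets borel"
    and eq: "\<And>f::'a \<Rightarrow> real. f \<in> bcontfun \<Longrightarrow> (\<integral>v. f v \<partial>\<mu>) = (\<integral>v. f v \<partial>\<nu>)"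
  shows "\<mu> = \<nu>"
proof (rule measure_eqI_generator_eq[where E="Collect closed" and \<Omega>=UNIV and A="\<lambda>_. UNIV"])
  interpret \<mu>: finite_measure \<mu> by fact
  interpret \<nu>: finite_measure \<nu> by fact
  note [measurable_cong] = sets
  have space: "space \<mu> = UNIV" "space \<nu> = UNIV"
    using sets_eq_imp_space_eq[OF sets(1)] sets_eq_imp_space_eq[OF sets(2)] by simp_all
  show "Int_stable (Collect closed)" by (auto simp: Int_stable_def)
  show "sets \<mu> = sigma_sets UNIV (Collect closed)" "sets \<nu> = sigma_sets UNIV (Collect closed)"
    using sets by (auto simp: borel_eq_closed sets_measure_of)
  show "emeasure \<mu> UNIV \<noteq> \<infinity>" by simp
  fix C :: "'a set" assume "C \<in> Collect closed"
  then have C: "closed C" by simp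
  show "emeasure \<mu> C = emeasure \<nu> C"
  \<comment> \<open>The distance to the empty set is 0 by convention, so the approximation below
    would give the wrong limit there.\<close>
  proof (cases "C = {}")
    case False
    define f where "f m v = max 0 (1 - real m * infdist v C)" for m :: nat and v
    have cf: "continuous_on UNIV (f m)" for m unfolding f_def by (intro continuous_intros)
    have f01: "\<bar>f m v\<bar> \<le> 1" for m v unfolding f_def using infdist_nonneg[of v C] by (simp add: abs_le_iff)
    have fb: "f m \<in> bcontfun" for m by (rule bcontfun_realI[OF cf f01])
    have [measurable]: "f m \<in> borel_measurable borel" for m by (rule bcontfun_realD[OF fb])
    have [measurable]: "C \<in> sets borel" using C by simp
    have lim: "(\<lambda>m. f m v) \<longlonglongrightarrow> indicator C v" for v
    proof (cases "v \<in> C")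
      case True then show ?thesis by (simp add: f_def)
    next
      case vC: False
      then have pos: "0 < infdist v C"
        using in_closed_iff_infdist_zero[OF C False] infdist_nonneg[of v C] by (simp add: less_le)
      obtain m0 :: nat where "1 / infdist v C < real m0" using reals_Archimedean2 by blast
      then have "f m v = 0" if "m0 \<le> m" for m
      proof -
        have "1 / infdist v C \<le> real m" using \<open>1 / infdist v C < real m0\<close> that by linarith
        then show ?thesis using pos by (simp add: f_def field_simps)
      qed
      then have "(\<lambda>m. f m v) \<longlonglongrightarrow> 0"
        by (intro tendsto_eventually) (auto simp: eventually_sequentially)
      then show ?thesis using vC by simp
    qed
    have "(\<lambda>m. \<integral>v. f m v \<partial>\<mu>) \<longlonglongrightarrow> (\<integral>v. indicator C v \<partial>\<mu>)"
      by (rule integral_dominated_convergence[of _ _ _ "\<lambda>_. 1"]) (auto intro!: lim f01)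
    moreover have "(\<lambda>m. \<integral>v. f m v \<partial>\<nu>) \<longlonglongrightarrow> (\<integral>v. indicator C v \<partial>\<nu>)"
      by (rule integral_dominated_convergence[of _ _ _ "\<lambda>_. 1"]) (auto intro!: lim f01)
    ultimately have "(\<integral>v. indicator C v \<partial>\<mu>) = (\<integral>v. indicator C v \<partial>\<nu> :: real)"
      unfolding eq[OF fb] by (rule LIMSEQ_unique)
    then show ?thesis by (simp add: space \<mu>.emeasure_eq_measure \<nu>.emeasure_eq_measure)
  qed simp
qed auto

context tail_pair
begin

definition \<Theta> :: "int \<Rightarrow> 'b \<Rightarrow> real" where
  "\<Theta> = spectral_process Y"

lemma \<Theta>_measurable [measurable]: "\<Theta> t \<in> borel_measurable N"
  unfolding \<Theta>_def spectral_process_def by measurable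

lemma continuous_on_window: "continuous_on UNIV (window I)"
  unfolding window_def
proof (rule continuous_on_coordinatewise_then_product)
  show "continuous_on UNIV (\<lambda>v. if i \<in> I then v i else (0::real))" for i
    by (cases "i \<in> I") (auto intro!: continuous_intros)
qed

text \<open>The source of independence: the same tail mean has two limits. Conditioning at level x
  gives the left side directly. Since v / |v 0| is invariant under scaling, the event |X 0| > u x
  may also be conditioned at level u x, which gives the factor p (u x) / p x and hence the right
  side.\<close>

lemma spectral_step:
  fixes f :: "(int \<Rightarrow> real) \<Rightarrow> real"
    and k :: nat
  assumes u: "1 \<le> u" and f: "f \<in> bcontfun"
  defines "W \<equiv> \<lambda>\<omega>. window {- int k..int k} (\<lambda>t. \<Theta> t \<omega>)"
  shows "(\<integral>\<omega>. of_bool (u < \<bar>Y 0 \<omega>\<bar>) * f (W \<omega>) \<partial>N) = u powr - \<alpha> * (\<integral>\<omega>. f (W \<omega>) \<partial>N)"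
proof -
  \<comment> \<open>Dividing by \<open>max 1 \<bar>v 0\<bar>\<close> keeps the function continuous
    at v 0 = 0, and is division by |v 0| wherever the conditioning event places the path.\<close>
  define g where "g v = f (window {- int k..int k} (\<lambda>t. v t / max 1 \<bar>v 0\<bar>))" for v
  have cf: "continuous_on UNIV f" using f by (simp add: bcontfun_def)
  obtain B where B: "\<And>v. \<bar>f v\<bar> \<le> B" using bcontfun_realD(2)[OF f] by blast
  have "continuous_on UNIV (\<lambda>v::int\<Rightarrow>real. (\<lambda>t. v t / max 1 \<bar>v 0\<bar>))"
    by (intro continuous_on_coordinatewise_then_product continuous_intros) auto
  then have "continuous_on UNIV (\<lambda>v::int\<Rightarrow>real. window {- int k..int k} (\<lambda>t. v t / max 1 \<bar>v 0\<bar>))"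
    by (rule continuous_on_compose2[OF continuous_on_window]) auto
  then have "continuous_on UNIV g" unfolding g_def by (rule continuous_on_compose2[OF cf]) auto
  then have gb: "g \<in> bcontfun" by (rule bcontfun_realI[of _ B]) (simp add: g_def B)
  have gw: "windowed k g" unfolding windowed_def g_def by (auto simp: window_def if_distrib cong: if_cong)
  have gY: "AE \<omega> in N. g (\<lambda>t. Y t \<omega>) = f (W \<omega>)"
    using Y0_gt_1 by eventually_elim (auto simp: g_def W_def \<Theta>_def spectral_process_def max_def)
  have "(tail_mean (\<lambda>v. of_bool (u < \<bar>v 0\<bar>) * g v)
     \<longlongrightarrow> (\<integral>\<omega>. of_bool (u < \<bar>Y 0 \<omega>\<bar>) * g (\<lambda>t. Y t \<omega>) \<partial>N)) at_top"
    by (rule tail_mean_tendsto_step[OF u gb gw])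
  moreover have "((\<lambda>x. p (u * x) / p x * tail_mean g (u * x)) \<longlongrightarrow> u powr - \<alpha> * (\<integral>\<omega>. g (\<lambda>t. Y t \<omega>) \<partial>N)) at_top"
  proof (rule tendsto_mult[OF p_regular])
    show "((\<lambda>x. tail_mean g (u * x)) \<longlongrightarrow> (\<integral>\<omega>. g (\<lambda>t. Y t \<omega>) \<partial>N)) at_top"
      by (rule filterlim_compose[OF tail_mean_tendsto_cont[OF gb gw]],
          rule filterlim_tendsto_pos_mult_at_top[OF tendsto_const _ filterlim_ident]) (use u in simp)
  qed (use u in simp)
  moreover have "\<forall>\<^sub>F x in at_top. tail_mean (\<lambda>v. of_bool (u < \<bar>v 0\<bar>) * g v) x = p (u * x) / p x * tail_mean g (u * x)"
    using eventually_gt_at_top[of 0]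
  proof eventually_elim
    case (elim x)
    have "indicator {\<omega> \<in> space M. x < \<bar>X 0 \<omega>\<bar>} \<omega> * (of_bool (u < \<bar>X 0 \<omega> / x\<bar>) * g (\<lambda>t. X t \<omega> / x))
       = indicator {\<omega> \<in> space M. u * x < \<bar>X 0 \<omega>\<bar>} \<omega> * g (\<lambda>t. X t \<omega> / (u * x))" for \<omega>
    proof (cases "u * x < \<bar>X 0 \<omega>\<bar>")
      case True
      have "x \<le> u * x" using mult_right_mono[of 1 u x] u elim by simp
      then have "x < \<bar>X 0 \<omega>\<bar>" using True by linarith
      moreover have "g (\<lambda>t. X t \<omega> / x) = g (\<lambda>t. X t \<omega> / (u * x))"
      proof -
        have "1 \<le> \<bar>X 0 \<omega> / x\<bar>" "1 \<le> \<bar>X 0 \<omega> / (u * x)\<bar>"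
          using elim u True \<open>x < _\<close> by (auto simp: field_simps abs_mult)
        then have "max 1 \<bar>X 0 \<omega> / x\<bar> = \<bar>X 0 \<omega>\<bar> / x" "max 1 \<bar>X 0 \<omega> / (u * x)\<bar> = \<bar>X 0 \<omega>\<bar> / (u * x)"
          using elim u by (auto simp: max_def abs_mult)
        then show ?thesis using elim u by (simp add: g_def)
      qed
      ultimately show ?thesis using True elim by (auto simp: indicator_def field_simps)
    next
      case False
      then show ?thesis using elim by (auto simp: indicator_def field_simps)
    qed
    then have "(\<integral>\<omega>. indicator {\<omega> \<in> space M. x < \<bar>X 0 \<omega>\<bar>} \<omega> * (of_bool (u < \<bar>X 0 \<omega> / x\<bar>) * g (\<lambda>t. X t \<omega> / x)) \<partial>M)
       = (\<integral>\<omega>. indicator {\<omega> \<in> space M. u * x < \<bar>X 0 \<omega>\<bar>} \<omega> * g (\<lambda>t. X t \<omega> / (u * x)) \<partial>M)"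
      by presburger
    then show ?case unfolding tail_mean_def using p_pos[of "u * x"] by simp
  qed
  ultimately have "((\<lambda>x. p (u * x) / p x * tail_mean g (u * x))
     \<longlongrightarrow> (\<integral>\<omega>. of_bool (u < \<bar>Y 0 \<omega>\<bar>) * g (\<lambda>t. Y t \<omega>) \<partial>N)) at_top"
    by (rule_tac Lim_transform_eventually)
  with \<open>((\<lambda>x. p (u * x) / p x * tail_mean g (u * x)) \<longlongrightarrow> u powr - \<alpha> * (\<integral>\<omega>. g (\<lambda>t. Y t \<omega>) \<partial>N)) at_top\<close>
  have "(\<integral>\<omega>. of_bool (u < \<bar>Y 0 \<omega>\<bar>) * g (\<lambda>t. Y t \<omega>) \<partial>N) = u powr - \<alpha> * (\<integral>\<omega>. g (\<lambda>t. Y t \<omega>) \<partial>N)"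
    by (intro tendsto_unique[of at_top]) auto
  moreover have "W \<in> borel_measurable N" unfolding W_def by (rule window_measurable) simp
  then have [measurable]: "(\<lambda>\<omega>. f (W \<omega>)) \<in> borel_measurable N"
    using bcontfun_realD(1)[OF f] by measurable
  have [measurable]: "(\<lambda>\<omega>. g (\<lambda>t. Y t \<omega>)) \<in> borel_measurable N"
    using bcontfun_realD(1)[OF gb] by measurable
  have "(\<integral>\<omega>. g (\<lambda>t. Y t \<omega>) \<partial>N) = (\<integral>\<omega>. f (W \<omega>) \<partial>N)"
    by (rule integral_cong_AE) (use gY in auto)
  moreover have "(\<integral>\<omega>. of_bool (u < \<bar>Y 0 \<omega>\<bar>) * g (\<lambda>t. Y t \<omega>) \<partial>N) = (\<integral>\<omega>. of_bool (u < \<bar>Y 0 \<omega>\<bar>) * f (W \<omega>) \<partial>N)"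
    by (rule integral_cong_AE) (use gY in auto)
  ultimately show ?thesis by simp
qed

text \<open>Bounded continuous functions determine a finite Borel measure, so
  \<open>spectral_step\<close> extends from them to indicators of Borel sets.\<close>

lemma spectral_tail:
  fixes k :: nat
  assumes u: "1 \<le> u" and A: "A \<in> sets borel"
  defines "W \<equiv> \<lambda>\<omega>. window {- int k..int k} (\<lambda>t. \<Theta> t \<omega>)"
  shows "\<P>(\<omega> in N. W \<omega> \<in> A \<and> u < \<bar>Y 0 \<omega>\<bar>) = u powr - \<alpha> * \<P>(\<omega> in N. W \<omega> \<in> A)"
proof -
  have W [measurable]: "W \<in> borel_measurable N" unfolding W_def by (rule window_measurable) simp
  have prob_density_eq: "(\<integral>v. f v \<partial>distr (density N (\<lambda>\<omega>. ennreal (h \<omega>))) borel W) = (\<integral>\<omega>. h \<omega> * f (W \<omega>) \<partial>N)"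
    if [measurable]: "h \<in> borel_measurable N" "f \<in> borel_measurable borel" and "\<And>\<omega>. 0 \<le> h \<omega>"
    for h :: "'b \<Rightarrow> real" and f :: "(int \<Rightarrow> real) \<Rightarrow> real"
    using that(3) by (subst integral_distr; (subst integral_density)?; simp)
  have fin: "finite_measure (distr (density N (\<lambda>\<omega>. ennreal (h \<omega>))) borel W)"
    if [measurable]: "h \<in> borel_measurable N" and h: "\<And>\<omega>. h \<omega> \<le> 1" for h :: "'b \<Rightarrow> real"
  proof (rule finite_measureI)
    have "emeasure (density N (\<lambda>\<omega>. ennreal (h \<omega>))) (space N) = (\<integral>\<^sup>+\<omega>. ennreal (h \<omega>) * indicator (space N) \<omega> \<partial>N)"
      by (rule emeasure_density) auto
    also have "\<dots> \<le> (\<integral>\<^sup>+\<omega>. 1 \<partial>N)"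
      by (rule nn_integral_mono) (use h in \<open>auto simp: indicator_def ennreal_le_1\<close>)
    also have "\<dots> < \<infinity>" by (simp add: N.emeasure_space_1)
    finally show "emeasure (distr (density N (\<lambda>\<omega>. ennreal (h \<omega>))) borel W) (space (distr (density N (\<lambda>\<omega>. ennreal (h \<omega>))) borel W)) \<noteq> \<infinity>"
      by (subst emeasure_distr) (auto simp: space_density)
  qed
  have u1: "u powr - \<alpha> \<le> 1" using u alpha by (simp add: powr_le_one_le powr_minus inverse_le_1_iff ge_one_powr_ge_zero)
  have eq: "distr (density N (\<lambda>\<omega>. ennreal (of_bool (u < \<bar>Y 0 \<omega>\<bar>)))) borel W
    = distr (density N (\<lambda>\<omega>. ennreal (u powr - \<alpha>))) borel W"
  proof (rule measure_eqI_bcontfun)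
    fix f :: "(int \<Rightarrow> real) \<Rightarrow> real" assume f: "f \<in> bcontfun"
    note [measurable] = bcontfun_realD(1)[OF f]
    show "(\<integral>v. f v \<partial>distr (density N (\<lambda>\<omega>. ennreal (of_bool (u < \<bar>Y 0 \<omega>\<bar>)))) borel W)
       = (\<integral>v. f v \<partial>distr (density N (\<lambda>\<omega>. ennreal (u powr - \<alpha>))) borel W)"
      using spectral_step[OF u f, of k] by (subst (1 2) prob_density_eq) (auto simp: W_def)
  qed (use u1 in \<open>auto intro!: fin\<close>)
  have "(\<integral>\<omega>. of_bool (u < \<bar>Y 0 \<omega>\<bar>) * indicator A (W \<omega>) \<partial>N) = (\<integral>\<omega>. u powr - \<alpha> * indicator A (W \<omega>) \<partial>N)"
    using arg_cong[OF eq, of "\<lambda>L. \<integral>v. indicator A v \<partial>L :: real"] A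
    by (subst (asm) (1 2) prob_density_eq) auto
  moreover have "of_bool (u < \<bar>Y 0 \<omega>\<bar>) * indicator A (W \<omega>) = (indicator {\<omega>. W \<omega> \<in> A \<and> u < \<bar>Y 0 \<omega>\<bar>} \<omega> :: real)"
    "indicator A (W \<omega>) = (indicator {\<omega>. W \<omega> \<in> A} \<omega> :: real)" for \<omega>
    by (auto simp: indicator_def)
  ultimately show ?thesis
    by (simp add: Int_def conj_commute)
qed

text \<open>The law of \<epsilon> |Y 0|, as \<open>spectral_law\<close> confirms, given by its
  Lebesgue density.\<close>

definition pareto :: "real \<Rightarrow> real measure" where
  "pareto \<epsilon> = density lborel (\<lambda>y. ennreal (\<epsilon> powr \<alpha> * (\<alpha> * y powr (- \<alpha> - 1)) * of_bool (\<epsilon> \<le> y)))"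

lemma pareto_tail:
  assumes e: "0 < \<epsilon>" and u: "\<epsilon> \<le> u"
  shows "emeasure (pareto \<epsilon>) {u<..} = ennreal ((u / \<epsilon>) powr - \<alpha>)"
proof -
  have "emeasure (pareto \<epsilon>) {u<..}
    = (\<integral>\<^sup>+y. ennreal (\<epsilon> powr \<alpha> * (\<alpha> * y powr (- \<alpha> - 1)) * of_bool (\<epsilon> \<le> y)) * indicator {u<..} y \<partial>lborel)"
    unfolding pareto_def by (subst emeasure_density) auto
  also have "\<dots> = (\<integral>\<^sup>+y. ennreal (\<epsilon> powr \<alpha> * (\<alpha> * y powr (- \<alpha> - 1))) * indicator {u..} y \<partial>lborel)"
    using AE_lborel_singleton[of u] u
    by (intro nn_integral_cong_AE) (auto simp: indicator_def elim!: eventually_mono)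
  also have "\<dots> = ennreal (0 - (- (\<epsilon> powr \<alpha> * u powr - \<alpha>)))"
  proof (rule nn_integral_FTC_atLeast)
    show "((\<lambda>y. - (\<epsilon> powr \<alpha> * y powr - \<alpha>)) has_real_derivative \<epsilon> powr \<alpha> * (\<alpha> * y powr (- \<alpha> - 1))) (at y)"
      if "u \<le> y" for y
      using that e u by (auto intro!: derivative_eq_intros)
    show "((\<lambda>y. - (\<epsilon> powr \<alpha> * y powr - \<alpha>)) \<longlongrightarrow> 0) at_top"
      using tendsto_minus[OF tendsto_mult_left[OF tendsto_neg_powr[OF _ filterlim_ident], of "- \<alpha>" "\<epsilon> powr \<alpha>"]] alpha
      by simp
  qed (use alpha in auto)
  also have "0 - (- (\<epsilon> powr \<alpha> * u powr - \<alpha>)) = (u / \<epsilon>) powr - \<alpha>"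
    using e u by (simp add: powr_divide powr_minus field_simps)
  finally show ?thesis .
qed

lemma prob_space_pareto: "0 < \<epsilon> \<Longrightarrow> prob_space (pareto \<epsilon>)"
proof (rule prob_spaceI)
  assume e: "0 < \<epsilon>"
  let ?g = "\<lambda>y. ennreal (\<epsilon> powr \<alpha> * (\<alpha> * y powr (- \<alpha> - 1)) * of_bool (\<epsilon> \<le> y)) * indicator {..\<epsilon>} y"
  have "AE y in lborel. ?g y = 0"
    using AE_lborel_singleton[of \<epsilon>] by eventually_elim (auto simp: indicator_def)
  then have "(\<integral>\<^sup>+y. ?g y \<partial>lborel) = 0"
    by (subst nn_integral_0_iff_AE) auto
  then have "emeasure (pareto \<epsilon>) {..\<epsilon>} = 0"
    unfolding pareto_def by (subst emeasure_density) auto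
  moreover have "emeasure (pareto \<epsilon>) ({..\<epsilon>} \<union> {\<epsilon><..}) = emeasure (pareto \<epsilon>) {..\<epsilon>} + emeasure (pareto \<epsilon>) {\<epsilon><..}"
    by (rule plus_emeasure[symmetric]) (auto simp: pareto_def)
  moreover have "{..\<epsilon>} \<union> {\<epsilon><..} = space (pareto \<epsilon>)" by (auto simp: pareto_def)
  ultimately show "emeasure (pareto \<epsilon>) (space (pareto \<epsilon>)) = 1" using e by (simp add: pareto_tail)
qed

text \<open>Independence in the form needed for integration. For fixed A both sides are finite
  measures in B, hence determined by half-lines, where \<open>spectral_tail\<close> evaluates
  them.\<close>

lemma spectral_law:
  fixes k :: nat
  assumes e: "0 < \<epsilon>"
  defines "W \<equiv> \<lambda>\<omega>. window {- int k..int k} (\<lambda>t. \<Theta> t \<omega>)"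
  shows "distr N borel W \<Otimes>\<^sub>M pareto \<epsilon> = distr N (borel \<Otimes>\<^sub>M borel) (\<lambda>\<omega>. (W \<omega>, \<epsilon> * \<bar>Y 0 \<omega>\<bar>))"
proof (rule pair_measure_eqI)
  have W [measurable]: "W \<in> borel_measurable N" unfolding W_def by (rule window_measurable) simp
  interpret P: prob_space "pareto \<epsilon>" by (rule prob_space_pareto[OF e])
  interpret D: prob_space "distr N borel W" by (rule N.prob_space_distr) simp
  show "sigma_finite_measure (pareto \<epsilon>)" "sigma_finite_measure (distr N borel W)" by unfold_locales
  have [simp, measurable_cong]: "sets (pareto \<epsilon>) = sets borel" by (simp add: pareto_def)
  show "sets (distr N borel W \<Otimes>\<^sub>M pareto \<epsilon>) = sets (distr N (borel \<Otimes>\<^sub>M borel) (\<lambda>\<omega>. (W \<omega>, \<epsilon> * \<bar>Y 0 \<omega>\<bar>)))"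
    by (simp cong: sets_pair_measure_cong)
  fix A B assume "A \<in> sets (distr N borel W)" "B \<in> sets (pareto \<epsilon>)"
  then have [measurable]: "A \<in> sets borel" "B \<in> sets borel" by simp_all
  let ?S = "{\<omega> \<in> space N. W \<omega> \<in> A}"
  let ?L = "density (pareto \<epsilon>) (\<lambda>_. emeasure N ?S)"
  let ?R = "distr (density N (indicator ?S)) borel (\<lambda>\<omega>. \<epsilon> * \<bar>Y 0 \<omega>\<bar>)"
  have R: "emeasure ?R C = emeasure N {\<omega> \<in> space N. W \<omega> \<in> A \<and> \<epsilon> * \<bar>Y 0 \<omega>\<bar> \<in> C}" if [measurable]: "C \<in> sets borel" for C
  proof -
    have "emeasure ?R C = (\<integral>\<^sup>+\<omega>. indicator ?S \<omega> * indicator ((\<lambda>\<omega>. \<epsilon> * \<bar>Y 0 \<omega>\<bar>) -` C \<inter> space N) \<omega> \<partial>N)"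
      by (subst emeasure_distr; (subst emeasure_density)?; simp)
    also have "\<dots> = (\<integral>\<^sup>+\<omega>. indicator {\<omega> \<in> space N. W \<omega> \<in> A \<and> \<epsilon> * \<bar>Y 0 \<omega>\<bar> \<in> C} \<omega> \<partial>N)"
      by (rule nn_integral_cong) (auto simp: indicator_def)
    finally show ?thesis by simp
  qed
  have L: "emeasure ?L C = emeasure N ?S * emeasure (pareto \<epsilon>) C" if "C \<in> sets borel" for C
    using that by (simp add: emeasure_density_const)
  have "?L = ?R"
  proof (rule measure_eqI_lessThan)
    fix u :: real
    show "emeasure ?L {u<..} < \<infinity>"
      by (subst L) (auto simp: N.emeasure_eq_measure P.emeasure_eq_measure ennreal_mult[symmetric])
    have ge: "emeasure ?L {u<..} = emeasure ?R {u<..}" if "\<epsilon> \<le> u" for u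
    proof -
      have "\<P>(\<omega> in N. W \<omega> \<in> A \<and> \<epsilon> * \<bar>Y 0 \<omega>\<bar> \<in> {u<..}) = \<P>(\<omega> in N. W \<omega> \<in> A \<and> u / \<epsilon> < \<bar>Y 0 \<omega>\<bar>)"
        using e by (intro arg_cong[of _ _ "measure N"]) (auto simp: field_simps)
      also have "\<dots> = (u / \<epsilon>) powr - \<alpha> * measure N ?S"
        unfolding W_def by (rule spectral_tail) (use that e in auto)
      finally show ?thesis
        by (subst L; (subst R)?; simp add: pareto_tail[OF e that] N.emeasure_eq_measure ennreal_mult[symmetric] mult.commute)
    qed
    show "emeasure ?L {u<..} = emeasure ?R {u<..}"
    proof (cases "\<epsilon> \<le> u")
      \<comment> \<open>Neither measure has mass between u and \<epsilon>, because |Y 0| > 1 almost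
        surely; so u may be raised to \<epsilon>.\<close>
      case False
      then have ue: "u \<le> \<epsilon>" by simp
      have "emeasure ?R {u<..} = emeasure ?R {\<epsilon><..}"
      proof -
        have "AE \<omega> in N. (W \<omega> \<in> A \<and> \<epsilon> * \<bar>Y 0 \<omega>\<bar> \<in> {u<..}) = (W \<omega> \<in> A \<and> \<epsilon> * \<bar>Y 0 \<omega>\<bar> \<in> {\<epsilon><..})"
          using Y0_gt_1
        proof eventually_elim
          case (elim \<omega>)
          have "\<epsilon> * 1 < \<epsilon> * \<bar>Y 0 \<omega>\<bar>" using elim e by (intro mult_strict_left_mono)
          then show ?case using ue by auto
        qed
        then show ?thesis by (subst (1 2) R) (auto intro!: emeasure_eq_AE)
      qed
      moreover have "emeasure (pareto \<epsilon>) {u<..} = emeasure (pareto \<epsilon>) {\<epsilon><..}"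
        unfolding pareto_def using AE_lborel_singleton[of \<epsilon>] ue
        by (subst (1 2) emeasure_density; (intro nn_integral_cong_AE)?) (auto simp: indicator_def elim!: eventually_mono)
      ultimately show ?thesis using ge[of \<epsilon>] by (subst L) (auto simp: L)
    qed (rule ge)
  qed auto
  then have "emeasure ?L B = emeasure ?R B" by simp
  moreover have "emeasure (distr N (borel \<Otimes>\<^sub>M borel) (\<lambda>\<omega>. (W \<omega>, \<epsilon> * \<bar>Y 0 \<omega>\<bar>))) (A \<times> B)
     = emeasure N {\<omega> \<in> space N. W \<omega> \<in> A \<and> \<epsilon> * \<bar>Y 0 \<omega>\<bar> \<in> B}"
    by (subst emeasure_distr) (auto intro!: arg_cong[of _ _ "emeasure N"])
  moreover have "emeasure (distr N borel W) A = emeasure N ?S"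
    by (subst emeasure_distr) (auto intro!: arg_cong[of _ _ "emeasure N"])
  ultimately show "emeasure (distr N borel W) A * emeasure (pareto \<epsilon>) B
     = emeasure (distr N (borel \<Otimes>\<^sub>M borel) (\<lambda>\<omega>. (W \<omega>, \<epsilon> * \<bar>Y 0 \<omega>\<bar>))) (A \<times> B)"
    by (simp add: L R)
qed

text \<open>On y > 0, the density of the measure that gives (u, \<infinity>) the mass u^-\<alpha>;
  it is infinite near 0.\<close>

definition weight :: "real \<Rightarrow> real" where
  "weight y = \<alpha> * y powr (- \<alpha> - 1)"

lemma weight_nonneg: "0 \<le> weight y"
  using alpha by (simp add: weight_def)

lemma weight_measurable [measurable]: "weight \<in> borel_measurable borel"
  unfolding weight_def by measurable

text \<open>The factor \<epsilon>^-\<alpha> cancels the normalisation \<epsilon>^\<alpha> of the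
  Pareto density. The reference measure then depends on \<epsilon> only through the restriction y
  \<ge> \<epsilon>, so integrals for different \<epsilon> live on one space and can be dominated
  together.\<close>

lemma spectral_integral:
  fixes F :: "(int \<Rightarrow> real) \<Rightarrow> real"
  assumes e: "0 < \<epsilon>" and F: "F \<in> borel_measurable borel" and w: "windowed k F"
  shows "\<epsilon> powr - \<alpha> * (\<integral>\<omega>. F (\<lambda>t. \<epsilon> * Y t \<omega>) \<partial>N)
    = (\<integral>(\<omega>, y). weight y * of_bool (\<epsilon> \<le> y) * F (\<lambda>t. y * \<Theta> t \<omega>) \<partial>(N \<Otimes>\<^sub>M lborel))"
proof -
  define W where "W \<omega> = window {- int k..int k} (\<lambda>t. \<Theta> t \<omega>)" for \<omega>
  have W: "W \<in> borel_measurable N" unfolding W_def by (rule window_measurable) simp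
  interpret P: prob_space "pareto \<epsilon>" by (rule prob_space_pareto[OF e])
  interpret D: prob_space "distr N borel W" by (rule N.prob_space_distr[OF W])
  have [simp, measurable_cong]: "sets (pareto \<epsilon>) = sets borel" by (simp add: pareto_def)
  have [measurable]: "(\<lambda>y. y) \<in> borel_measurable (pareto \<epsilon>)" by (rule measurable_ident_sets) simp
  define G where "G q = F (\<lambda>t. snd q * fst q t)" for q :: "(int \<Rightarrow> real) \<times> real"
  have mq: "(\<lambda>q::(int \<Rightarrow> real) \<times> real. (\<lambda>t. snd q * fst q t)) \<in> borel_measurable (borel \<Otimes>\<^sub>M borel)"
  proof (rule measurable_coordinatewise_then_product)
    show "(\<lambda>q::(int \<Rightarrow> real) \<times> real. snd q * fst q t) \<in> borel_measurable (borel \<Otimes>\<^sub>M borel)" for t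
      by (intro borel_measurable_times measurable_snd measurable_compose[OF measurable_fst measurable_coordinate])
  qed
  have G: "G \<in> borel_measurable (borel \<Otimes>\<^sub>M borel)"
    unfolding G_def by (rule measurable_compose[OF mq F])
  have GW: "G (W \<omega>, y) = F (\<lambda>t. y * \<Theta> t \<omega>)" for \<omega> y
  proof -
    have "G (W \<omega>, y) = F (window {- int k..int k} (\<lambda>t. y * \<Theta> t \<omega>))"
      unfolding G_def W_def by (intro arg_cong[of _ _ F]) (auto simp: window_def)
    then show ?thesis using w by (simp add: windowed_def)
  qed
  have m1: "(\<lambda>\<omega>. F (\<lambda>t. \<epsilon> * Y t \<omega>)) \<in> borel_measurable N"
    by (rule measurable_compose[OF path_measurable F]) simp
  have "(\<lambda>\<omega>. \<epsilon> * \<bar>Y 0 \<omega>\<bar>) \<in> borel_measurable N" by simp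
  then have WY: "(\<lambda>\<omega>. (W \<omega>, \<epsilon> * \<bar>Y 0 \<omega>\<bar>)) \<in> N \<rightarrow>\<^sub>M borel \<Otimes>\<^sub>M borel"
    by (intro measurable_Pair W)
  have mW: "(\<lambda>(\<omega>, y). (W \<omega>, y)) \<in> N \<Otimes>\<^sub>M lborel \<rightarrow>\<^sub>M borel \<Otimes>\<^sub>M borel"
    unfolding case_prod_beta by (rule measurable_Pair[OF measurable_compose[OF measurable_fst W]]) simp
  have "(\<integral>\<omega>. F (\<lambda>t. \<epsilon> * Y t \<omega>) \<partial>N) = (\<integral>\<omega>. G (W \<omega>, \<epsilon> * \<bar>Y 0 \<omega>\<bar>) \<partial>N)"
  proof (rule integral_cong_AE)
    show "AE \<omega> in N. F (\<lambda>t. \<epsilon> * Y t \<omega>) = G (W \<omega>, \<epsilon> * \<bar>Y 0 \<omega>\<bar>)"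
      using Y0_gt_1
    proof eventually_elim
      case (elim \<omega>)
      then have "Y 0 \<omega> \<noteq> 0" by auto
      then show ?case by (simp add: GW \<Theta>_def spectral_process_def)
    qed
    show "(\<lambda>\<omega>. G (W \<omega>, \<epsilon> * \<bar>Y 0 \<omega>\<bar>)) \<in> borel_measurable N"
      by (rule measurable_compose[OF WY G])
  qed (rule m1)
  also have "\<dots> = (\<integral>q. G q \<partial>distr N (borel \<Otimes>\<^sub>M borel) (\<lambda>\<omega>. (W \<omega>, \<epsilon> * \<bar>Y 0 \<omega>\<bar>)))"
    by (rule integral_distr[symmetric, OF WY G])
  also have "\<dots> = (\<integral>q. G q \<partial>(distr N borel W \<Otimes>\<^sub>M pareto \<epsilon>))"
    unfolding W_def spectral_law[OF e] by simp
  also have "distr N borel W \<Otimes>\<^sub>M pareto \<epsilon> = distr N borel W \<Otimes>\<^sub>M distr (pareto \<epsilon>) borel (\<lambda>y. y)"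
    by (simp add: distr_id2)
  also have "\<dots> = distr (N \<Otimes>\<^sub>M pareto \<epsilon>) (borel \<Otimes>\<^sub>M borel) (\<lambda>(\<omega>, y). (W \<omega>, y))"
    by (rule pair_measure_distr[OF W]) (simp_all add: distr_id2 P.sigma_finite_measure_axioms)
  also have "N \<Otimes>\<^sub>M pareto \<epsilon> = density (N \<Otimes>\<^sub>M lborel) (\<lambda>(\<omega>, y). 1 * ennreal (\<epsilon> powr \<alpha> * (\<alpha> * y powr (- \<alpha> - 1)) * of_bool (\<epsilon> \<le> y)))"
    using pair_measure_density[of "\<lambda>_. 1" N "\<lambda>y. ennreal (\<epsilon> powr \<alpha> * (\<alpha> * y powr (- \<alpha> - 1)) * of_bool (\<epsilon> \<le> y))" lborel]
      P.sigma_finite_measure_axioms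
    by (simp add: density_1 pareto_def lborel.sigma_finite_measure_axioms)
  also have "(\<lambda>(\<omega>::'b, y). 1 * ennreal (\<epsilon> powr \<alpha> * (\<alpha> * y powr (- \<alpha> - 1)) * of_bool (\<epsilon> \<le> y)))
     = (\<lambda>q. ennreal (\<epsilon> powr \<alpha> * (weight (snd q) * of_bool (\<epsilon> \<le> snd q))))"
    by (auto simp: weight_def mult.assoc fun_eq_iff)
  also have "(\<integral>q. G q \<partial>distr (density (N \<Otimes>\<^sub>M lborel) (\<lambda>q. ennreal (\<epsilon> powr \<alpha> * (weight (snd q) * of_bool (\<epsilon> \<le> snd q)))))
       (borel \<Otimes>\<^sub>M borel) (\<lambda>(\<omega>, y). (W \<omega>, y)))
     = (\<integral>q. G (case q of (\<omega>, y) \<Rightarrow> (W \<omega>, y)) \<partial>density (N \<Otimes>\<^sub>M lborel) (\<lambda>q. ennreal (\<epsilon> powr \<alpha> * (weight (snd q) * of_bool (\<epsilon> \<le> snd q)))))"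
    by (rule integral_distr[OF _ G]) (use mW in simp)
  also have "\<dots> = (\<integral>q. (\<epsilon> powr \<alpha> * (weight (snd q) * of_bool (\<epsilon> \<le> snd q))) *\<^sub>R G (case q of (\<omega>, y) \<Rightarrow> (W \<omega>, y)) \<partial>(N \<Otimes>\<^sub>M lborel))"
    by (rule integral_density[OF measurable_compose[OF mW G]]) (simp_all add: weight_nonneg)
  also have "\<dots> = \<epsilon> powr \<alpha> * (\<integral>(\<omega>, y). weight y * of_bool (\<epsilon> \<le> y) * F (\<lambda>t. y * \<Theta> t \<omega>) \<partial>(N \<Otimes>\<^sub>M lborel))"
    by (subst integral_mult_right_zero[symmetric]) (simp add: GW case_prod_beta mult.assoc)
  finally show ?thesis using e by (simp add: powr_minus)
qed

lemma \<Theta>0: "AE \<omega> in N. \<bar>\<Theta> 0 \<omega>\<bar> = 1"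
  using Y0_gt_1 by eventually_elim (auto simp: \<Theta>_def spectral_process_def)

text \<open>Given the spectral process, y |\<Theta>_t| = 1 holds for at most one y, a Lebesgue null
  set. This disposes of the points where \<open>big 1\<close> jumps.\<close>

lemma Y_no_atom: "\<P>(\<omega> in N. \<bar>Y t \<omega>\<bar> = 1) = 0"
proof -
  define F where "F v = (of_bool (\<bar>v t\<bar> = 1) :: real)" for v :: "int \<Rightarrow> real"
  have [measurable]: "F \<in> borel_measurable borel" unfolding F_def by measurable
  have wF: "windowed (nat \<bar>t\<bar>) F" by (auto simp: windowed_def F_def window_def)
  have "(\<integral>\<omega>. F (\<lambda>t. 1 * Y t \<omega>) \<partial>N) = (\<integral>\<omega>. indicator {\<omega> \<in> space N. \<bar>Y t \<omega>\<bar> = 1} \<omega> \<partial>N)"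
    by (rule Bochner_Integration.integral_cong) (auto simp: F_def indicator_def)
  then have "\<P>(\<omega> in N. \<bar>Y t \<omega>\<bar> = 1) = 1 powr - \<alpha> * (\<integral>\<omega>. F (\<lambda>t. 1 * Y t \<omega>) \<partial>N)" by simp
  also have "\<dots> = (\<integral>(\<omega>, y). weight y * of_bool (1 \<le> y) * F (\<lambda>t. y * \<Theta> t \<omega>) \<partial>(N \<Otimes>\<^sub>M lborel))"
    by (rule spectral_integral[OF _ _ wF]) auto
  also have "\<dots> = 0"
  proof (rule integral_eq_zero_AE)
    interpret NL: pair_sigma_finite N lborel ..
    have [measurable]: "(\<lambda>q. \<Theta> t (fst q)) \<in> borel_measurable (N \<Otimes>\<^sub>M lborel)" by measurable
    have "AE q in N \<Otimes>\<^sub>M lborel. \<not> (1 \<le> snd q \<and> \<bar>snd q * \<Theta> t (fst q)\<bar> = 1)"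
    proof (rule NL.AE_pair_measure)
      show "AE \<omega> in N. AE y in lborel. \<not> (1 \<le> snd (\<omega>, y) \<and> \<bar>snd (\<omega>, y) * \<Theta> t (fst (\<omega>, y))\<bar> = 1)"
      proof (rule AE_I2)
        fix \<omega>
        show "AE y in lborel. \<not> (1 \<le> snd (\<omega>, y) \<and> \<bar>snd (\<omega>, y) * \<Theta> t (fst (\<omega>, y))\<bar> = 1)"
          using AE_lborel_singleton[of "1 / \<bar>\<Theta> t \<omega>\<bar>"]
          by eventually_elim (auto simp: abs_mult eq_divide_eq split: if_splits)
      qed
    qed measurable
    then show "AE q in N \<Otimes>\<^sub>M lborel. (case q of (\<omega>, y) \<Rightarrow> weight y * of_bool (1 \<le> y) * F (\<lambda>t. y * \<Theta> t \<omega>)) = 0"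
      by eventually_elim (auto simp: F_def)
  qed
  finally show ?thesis .
qed

end

section \<open>The limiting cluster functional\<close>

text \<open>
  The supremum of an unbounded set of reals is a junk value, but the same one for all such sets;
  hence suprema of countable families are measurable without any boundedness.
\<close>

lemma real_Sup_unbounded:
  fixes A B :: "real set"
  assumes "\<not> bdd_above A" "\<not> bdd_above B"
  shows "Sup A = Sup B"
proof -
  have "(\<lambda>z. \<forall>x\<in>A. x \<le> z) = (\<lambda>z. \<forall>x\<in>B. x \<le> z)"
    using assms by (auto simp: bdd_above_def fun_eq_iff)
  then show ?thesis unfolding Sup_real_def by simp
qed

lemma borel_measurable_real_SUP:
  fixes f :: "'i \<Rightarrow> 'a \<Rightarrow> real"
  assumes I: "countable I" "I \<noteq> {}" and [measurable]: "\<And>i. i \<in> I \<Longrightarrow> f i \<in> borel_measurable L"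
  shows "(\<lambda>x. SUP i\<in>I. f i x) \<in> borel_measurable L"
proof -
  define S where "S x = (SUP i\<in>I. ereal (f i x))" for x
  define c where "c = Sup (UNIV :: real set)"
  have S [measurable]: "S \<in> borel_measurable L" unfolding S_def using I by measurable
  have "(SUP i\<in>I. f i x) = (if S x = \<infinity> then c else real_of_ereal (S x))" for x
  proof (cases "bdd_above ((\<lambda>i. f i x) ` I)")
    case True
    then obtain u where "\<And>i. i \<in> I \<Longrightarrow> f i x \<le> u" by (auto simp: bdd_above_def)
    then have "S x \<le> ereal u" unfolding S_def by (intro SUP_least) simp
    moreover obtain i where "i \<in> I" using I by blast
    then have "ereal (f i x) \<le> S x" unfolding S_def by (rule SUP_upper)
    ultimately have "\<bar>S x\<bar> \<noteq> \<infinity>" by (cases "S x") auto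
    then show ?thesis using ereal_SUP[of "\<lambda>i. f i x" I] by (auto simp: S_def[symmetric])
  next
    case False
    have "S x = \<infinity>"
    proof (rule ccontr)
      assume "S x \<noteq> \<infinity>"
      then obtain u where "S x \<le> ereal u" by (cases "S x") (auto intro: that)
      then have "f i x \<le> u" if "i \<in> I" for i
        using SUP_upper[OF that, of "\<lambda>i. ereal (f i x)"] order.trans by (fastforce simp: S_def)
      then show False using False by (auto simp: bdd_above_def)
    qed
    moreover have "\<not> bdd_above (UNIV :: real set)"
      by (metis bdd_above_def UNIV_I gt_ex not_le)
    ultimately show ?thesis unfolding c_def using real_Sup_unbounded[OF False] by simp
  qed
  then show ?thesis by simp
qed

text \<open>Summability bounds the partial sums, so the suprema are genuine. Both suprema of the
  theorem thereby reduce to one limit: since \<open>maxsum\<close> includes the empty sum, it tends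
  to the positive part over t \<ge> 1, and prefixing a 0 shifts this value by a 0.\<close>

lemma maxsum_tendsto_SUP:
  fixes a :: "nat \<Rightarrow> real"
  assumes a: "summable (\<lambda>i. \<bar>a (Suc i)\<bar>)"
  shows "(\<lambda>k. maxsum k a) \<longlonglongrightarrow> max 0 (SUP t\<in>{1..}. \<Sum>i=1..t. a i)"
    and "(SUP t. \<Sum>i=0..t. a i) = a 0 + max 0 (SUP t\<in>{1..}. \<Sum>i=1..t. a i)"
proof -
  define s where "s t = (\<Sum>i=1..t. a i)" for t :: nat
  have bound: "s t \<le> (\<Sum>i. \<bar>a (Suc i)\<bar>)" for t
  proof -
    have "s t \<le> (\<Sum>i=1..t. \<bar>a i\<bar>)" unfolding s_def by (rule sum_mono) auto
    also have "\<dots> = (\<Sum>i<t. \<bar>a (Suc i)\<bar>)"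
      by (rule sum.reindex_bij_witness[of _ Suc "\<lambda>i. i - 1"]) auto
    also have "\<dots> \<le> (\<Sum>i. \<bar>a (Suc i)\<bar>)" by (rule sum_le_suminf[OF a]) auto
    finally show ?thesis .
  qed
  have bdd: "bdd_above (s ` T)" for T using bound by (auto intro!: bdd_aboveI2)
  have max_SUP: "max 0 (SUP t\<in>{1..}. s t) = (SUP t. s t)"
  proof (rule antisym)
    show "max 0 (SUP t\<in>{1..}. s t) \<le> (SUP t. s t)"
    proof (rule max.boundedI)
      show "0 \<le> (SUP t. s t)" using cSUP_upper[OF _ bdd, of 0 UNIV] by (simp add: s_def)
      show "(SUP t\<in>{1..}. s t) \<le> (SUP t. s t)" by (rule cSUP_subset_mono[OF _ bdd]) auto
    qed
    show "(SUP t. s t) \<le> max 0 (SUP t\<in>{1..}. s t)"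
    proof (rule cSUP_least)
      fix t show "s t \<le> max 0 (SUP t\<in>{1..}. s t)"
        using cSUP_upper[OF _ bdd, of t "{1..}"] by (cases "t = 0") (auto simp: s_def le_max_iff_disj)
    qed auto
  qed
  have inc: "incseq (\<lambda>k. maxsum k a)" by (rule incseq_SucI) simp
  have le: "maxsum k a \<le> (SUP t. s t)" for k
    using maxsum_attained[of k a] cSUP_upper[OF _ bdd, of _ UNIV] by (auto simp: s_def)
  have "(SUP k. maxsum k a) = (SUP t. s t)"
  proof (rule antisym)
    show "(SUP k. maxsum k a) \<le> (SUP t. s t)" by (rule cSUP_least) (auto intro: le)
    show "(SUP t. s t) \<le> (SUP k. maxsum k a)"
    proof (rule cSUP_mono)
      show "bdd_above (range (\<lambda>k. maxsum k a))" by (rule bdd_aboveI2[of _ _ "SUP t. s t"]) (rule le)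
      show "\<exists>k\<in>UNIV. s t \<le> maxsum k a" for t using maxsum_ge[of t t a] by (auto simp: s_def)
    qed auto
  qed
  then show "(\<lambda>k. maxsum k a) \<longlonglongrightarrow> max 0 (SUP t\<in>{1..}. \<Sum>i=1..t. a i)"
    using LIMSEQ_incseq_SUP[OF bdd_aboveI2[of UNIV "\<lambda>k. maxsum k a", OF le] inc] max_SUP by (simp add: s_def)
  have "(SUP t. \<Sum>i=0..t. a i) = (SUP t. a 0 + s t)"
    by (rule SUP_cong) (auto simp: s_def sum.atLeast_Suc_atMost)
  also have "\<dots> = a 0 + (SUP t. s t)"
  proof (rule antisym)
    show "(SUP t. a 0 + s t) \<le> a 0 + (SUP t. s t)"
      using cSUP_upper[OF _ bdd, of _ UNIV] by (intro cSUP_least) auto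
    have "bdd_above (range (\<lambda>t. a 0 + s t))"
      using bound by (intro bdd_aboveI2[of _ _ "a 0 + (\<Sum>i. \<bar>a (Suc i)\<bar>)"]) simp
    then have "s t \<le> (SUP t. a 0 + s t) - a 0" for t
      using cSUP_upper[of t UNIV "\<lambda>t. a 0 + s t"] by simp
    then have "(SUP t. s t) \<le> (SUP t. a 0 + s t) - a 0" by (intro cSUP_least) auto
    then show "a 0 + (SUP t. s t) \<le> (SUP t. a 0 + s t)" by simp
  qed
  finally show "(SUP t. \<Sum>i=0..t. a i) = a 0 + max 0 (SUP t\<in>{1..}. \<Sum>i=1..t. a i)"
    using max_SUP by (simp add: s_def)
qed

text \<open>Window and cut vary together, so the error is bounded by the total amount removed by the
  cut. That is a series with terms tending to 0 and dominated by |a i|, to which Tannery's theorem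
  applies.\<close>

lemma maxsum_big_tendsto:
  fixes a :: "nat \<Rightarrow> real"
  assumes a: "summable (\<lambda>i. \<bar>a (Suc i)\<bar>)"
    and k: "filterlim k at_top sequentially"
    and e: "\<epsilon> \<longlonglongrightarrow> 0"
  shows "(\<lambda>m. maxsum (k m) (\<lambda>i. big (\<epsilon> m) (a i))) \<longlonglongrightarrow> max 0 (SUP t\<in>{1..}. \<Sum>i=1..t. a i)"
proof -
  let ?d = "\<lambda>i m. \<bar>big (\<epsilon> m) (a (Suc i)) - a (Suc i)\<bar>"
  have d_le: "?d i m \<le> \<bar>a (Suc i)\<bar>" for i m by (auto simp: big_def)
  have "?d i \<longlonglongrightarrow> 0" for i
  proof (cases "a (Suc i) = 0")
    case True then show ?thesis by (simp add: big_def)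
  next
    case False
    then have "\<forall>\<^sub>F m in sequentially. \<epsilon> m < \<bar>a (Suc i)\<bar>" by (intro order_tendstoD(2)[OF e]) simp
    then have "\<forall>\<^sub>F m in sequentially. ?d i m = 0" by eventually_elim (simp add: big_def)
    then show ?thesis by (rule tendsto_eventually)
  qed
  moreover have "\<forall>\<^sub>F (i, m) in at_top \<times>\<^sub>F sequentially. norm (?d i m) \<le> \<bar>a (Suc i)\<bar>"
    using d_le by (intro always_eventually) auto
  ultimately have "(\<lambda>m. \<Sum>i. ?d i m) \<longlonglongrightarrow> (\<Sum>i. 0)"
    using tannerys_theorem[of ?d "\<lambda>_. 0" sequentially "\<lambda>i. \<bar>a (Suc i)\<bar>"] a sequentially_bot by blast
  then have d0: "(\<lambda>m. \<Sum>i. ?d i m) \<longlonglongrightarrow> 0" by simp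
  have le: "\<bar>maxsum (k m) (\<lambda>i. big (\<epsilon> m) (a i)) - maxsum (k m) a\<bar> \<le> (\<Sum>i. ?d i m)" for m
  proof -
    have "\<bar>maxsum (k m) (\<lambda>i. big (\<epsilon> m) (a i)) - maxsum (k m) a\<bar> \<le> (\<Sum>i=1..k m. \<bar>big (\<epsilon> m) (a i) - a i\<bar>)"
      by (rule maxsum_diff)
    also have "\<dots> = (\<Sum>i<k m. ?d i m)"
      by (rule sum.reindex_bij_witness[of _ Suc "\<lambda>i. i - 1"]) auto
    also have "\<dots> \<le> (\<Sum>i. ?d i m)"
      by (rule sum_le_suminf[OF summable_comparison_test'[OF a, of 0]]) (use d_le in auto)
    finally show ?thesis .
  qed
  have "(\<lambda>m. maxsum (k m) (\<lambda>i. big (\<epsilon> m) (a i)) - maxsum (k m) a) \<longlonglongrightarrow> 0"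
    by (rule tendsto_rabs_zero_cancel, rule tendsto_sandwich[OF _ _ tendsto_const d0]) (use le in auto)
  from tendsto_add[OF this filterlim_compose[OF maxsum_tendsto_SUP(1)[OF a] k]] show ?thesis by simp
qed

lemma cutoff_tendsto:
  assumes K: "filterlim K at_top sequentially" and r: "r \<longlonglongrightarrow> s"
  shows "(\<lambda>m. cutoff (K m) (r m)) \<longlonglongrightarrow> max 0 s"
proof -
  have "\<forall>\<^sub>F m in sequentially. max 0 (s + 1) \<le> K m" using K by (simp only: filterlim_at_top)
  moreover have "\<forall>\<^sub>F m in sequentially. r m < s + 1" by (rule order_tendstoD(2)[OF r]) simp
  ultimately have "\<forall>\<^sub>F m in sequentially. max 0 (r m) = cutoff (K m) (r m)"
    by eventually_elim (auto simp: cutoff_def)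
  then show ?thesis
    by (rule Lim_transform_eventually[OF tendsto_max[OF tendsto_const r]])
qed

text \<open>
  A cluster consisting of \<open>u\<close> followed by \<open>a\<close>, all in units of the level \<open>x\<close>, overshoots
  \<open>\<zeta> + \<rho> s\<close> for a set of starting times \<open>s x\<close>, \<open>0 \<le> s \<le> K\<close>; \<open>jumpfun\<close> is the length of that set
  minus the length of the corresponding set for \<open>a\<close> alone.
\<close>

definition jumpfun :: "real \<Rightarrow> real \<Rightarrow> real \<Rightarrow> nat \<Rightarrow> real \<Rightarrow> (nat \<Rightarrow> real) \<Rightarrow> real" where
  "jumpfun \<rho> \<zeta> K k u a = cutoff K ((u + maxsum k a - \<zeta>) / \<rho>) - cutoff K ((maxsum k a - \<zeta>) / \<rho>)"

lemma jumpfun_bounded: "0 \<le> K \<Longrightarrow> \<bar>jumpfun \<rho> \<zeta> K k u a\<bar> \<le> K"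
  unfolding jumpfun_def
  using cutoff_bounds[of K "(u + maxsum k a - \<zeta>) / \<rho>"] cutoff_bounds[of K "(maxsum k a - \<zeta>) / \<rho>"] by linarith

lemma jumpfun_le: "0 < \<rho> \<Longrightarrow> \<bar>jumpfun \<rho> \<zeta> K k u a\<bar> \<le> \<bar>u\<bar> / \<rho>"
  unfolding jumpfun_def
  using cutoff_lipschitz[of K "(u + maxsum k a - \<zeta>) / \<rho>" "(maxsum k a - \<zeta>) / \<rho>"]
  by (simp add: diff_divide_distrib[symmetric] abs_divide)

text \<open>A cluster of absolute sum at most \<zeta> does not exceed the level, with or without its
  first value. This keeps the integrand zero near y = 0, where \<open>weight\<close> is not
  integrable.\<close>

lemma jumpfun_eq_0:
  assumes "0 < \<rho>" "0 \<le> K" "\<bar>u\<bar> + (\<Sum>i=1..k. \<bar>a i\<bar>) \<le> \<zeta>"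
  shows "jumpfun \<rho> \<zeta> K k u a = 0"
proof -
  have "maxsum k a \<le> (\<Sum>i=1..k. \<bar>a i\<bar>)"
    using maxsum_diff_le[of k a "\<lambda>_. 0"] maxsum_mult[of 0 k "\<lambda>_. 0"] by simp
  then show ?thesis unfolding jumpfun_def
    using assms by (subst (1 2) cutoff_eq_0) (auto simp: divide_le_0_iff)
qed

lemma measurable_jumpfun [measurable (raw)]:
  assumes "u \<in> borel_measurable L" "\<And>i. (\<lambda>x. a x i) \<in> borel_measurable L"
  shows "(\<lambda>x. jumpfun \<rho> \<zeta> K k (u x) (a x)) \<in> borel_measurable L"
proof -
  have "(\<lambda>x. maxsum k (a x)) \<in> borel_measurable L" by (rule measurable_maxsum) fact
  then show ?thesis unfolding jumpfun_def using assms(1) by measurable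
qed

lemma continuous_on_jumpfun [continuous_intros]:
  assumes "continuous_on S u" "\<And>i. continuous_on S (\<lambda>x. a x i)" "\<rho> \<noteq> 0"
  shows "continuous_on S (\<lambda>x. jumpfun \<rho> \<zeta> K k (u x) (a x))"
  unfolding jumpfun_def by (intro continuous_intros assms) (use assms in auto)

text \<open>A bump below 1 forces m |r| > 1, where the ramp has already reached 0 or 1. Thus a
  product with the ramp is exact unless the bump has full height.\<close>

lemma bump_less_1: "bump m r < 1 \<Longrightarrow> cutoff 1 (real m * r) = of_bool (0 < r)"
  by (auto simp: bump_def cutoff_def min_def max_def abs_if mult_nonneg_nonpos split: if_splits)

section \<open>Integrals against the Pareto density\<close>

lemma nn_integral_powr_tail:
  assumes "0 < s" "1 < \<alpha>"
  shows "(\<integral>\<^sup>+y. ennreal (\<alpha> * y powr - \<alpha>) * indicator {s..} y \<partial>lborel) = ennreal (\<alpha> / (\<alpha> - 1) * s powr (1 - \<alpha>))"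
proof -
  have "(\<integral>\<^sup>+y. ennreal (\<alpha> * y powr - \<alpha>) * indicator {s..} y \<partial>lborel)
     = ennreal (0 - (- (\<alpha> / (\<alpha> - 1) * s powr (1 - \<alpha>))))"
  proof (rule nn_integral_FTC_atLeast)
    show "((\<lambda>y. - (\<alpha> / (\<alpha> - 1) * y powr (1 - \<alpha>))) has_real_derivative \<alpha> * y powr - \<alpha>) (at y)" if "s \<le> y" for y
    proof -
      have "((\<lambda>y. y powr (1 - \<alpha>)) has_real_derivative (1 - \<alpha>) * y powr - \<alpha>) (at y)"
        using that assms by (auto intro!: derivative_eq_intros)
      moreover have "- (\<alpha> / (\<alpha> - 1) * ((1 - \<alpha>) * y powr - \<alpha>)) = \<alpha> * y powr - \<alpha>"
        using assms by (simp add: divide_simps) (simp add: algebra_simps)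
      ultimately show ?thesis
        using DERIV_minus[OF DERIV_cmult[of "\<lambda>y. y powr (1 - \<alpha>)" _ y UNIV "\<alpha> / (\<alpha> - 1)"]] by metis
    qed
    have "((\<lambda>y. y powr (1 - \<alpha>)) \<longlongrightarrow> 0) at_top"
      using assms by (intro tendsto_neg_powr filterlim_ident) simp
    then show "((\<lambda>y. - (\<alpha> / (\<alpha> - 1) * y powr (1 - \<alpha>))) \<longlongrightarrow> 0) at_top"
      using tendsto_minus[OF tendsto_mult_left[of _ 0 at_top "\<alpha> / (\<alpha> - 1)"]] by force
  qed (use assms in auto)
  then show ?thesis by simp
qed

text \<open>For c > 0 the integrand lives on y \<ge> 1/c, where an explicit primitive exists. With c
  the supremum of a cluster sum, this turns a linear functional into an \<alpha>-th power with the
  constant 1 / (\<alpha> - 1).\<close>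

lemma has_bochner_integral_positive_part:
  fixes c :: real
  assumes "1 < \<alpha>"
  shows "has_bochner_integral lborel
     (\<lambda>y. of_bool (0 < y) * (\<alpha> * y powr (- \<alpha> - 1)) * max 0 (y * c - 1)) (max 0 c powr \<alpha> / (\<alpha> - 1))"
proof (cases "0 < c")
  case False
  have "of_bool (0 < y) * (\<alpha> * y powr (- \<alpha> - 1)) * max 0 (y * c - 1) = 0" for y
  proof (cases "0 < y")
    case True
    then have "y * c \<le> 0" using False by (simp add: mult_nonneg_nonpos)
    then show ?thesis by simp
  qed simp
  then have "(\<lambda>y. of_bool (0 < y) * (\<alpha> * y powr (- \<alpha> - 1)) * max 0 (y * c - 1)) = (\<lambda>_. 0)"
    by (rule ext)
  moreover have "has_bochner_integral lborel (\<lambda>_::real. 0::real) 0" by (simp add: has_bochner_integral_zero)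
  ultimately show ?thesis using False by simp
next
  case c: True
  have "(\<integral>\<^sup>+y. ennreal (of_bool (0 < y) * (\<alpha> * y powr (- \<alpha> - 1)) * max 0 (y * c - 1)) \<partial>lborel)
     = (\<integral>\<^sup>+y. ennreal (\<alpha> * y powr (- \<alpha> - 1) * (y * c - 1)) * indicator {1 / c..} y \<partial>lborel)"
  proof (rule nn_integral_cong)
    fix y show "ennreal (of_bool (0 < y) * (\<alpha> * y powr (- \<alpha> - 1)) * max 0 (y * c - 1))
       = ennreal (\<alpha> * y powr (- \<alpha> - 1) * (y * c - 1)) * indicator {1 / c..} y"
    proof (cases "1 / c \<le> y")
      case True
      then have "0 < y" using c by (auto intro: less_le_trans[of 0 "1 / c"])
      moreover have "0 \<le> y * c - 1" using True c by (simp add: field_simps)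
      ultimately show ?thesis using True by simp
    next
      case False
      then have "y * c - 1 \<le> 0" using c by (auto simp: field_simps)
      then show ?thesis using False by simp
    qed
  qed
  also have "\<dots> = ennreal (0 - (- (\<alpha> * c / (\<alpha> - 1) * (1 / c) powr (1 - \<alpha>)) + (1 / c) powr - \<alpha>))"
  proof (rule nn_integral_FTC_atLeast)
    fix y assume y: "1 / c \<le> y"
    then have y0: "0 < y" using c by (auto intro: less_le_trans[of 0 "1 / c"])
    have e: "\<alpha> * y powr (- \<alpha> - 1) * (y * c - 1) = \<alpha> * c * y powr - \<alpha> - \<alpha> * y powr (- \<alpha> - 1)"
      using y0 by (simp add: powr_diff field_simps)
    show "((\<lambda>y. - (\<alpha> * c / (\<alpha> - 1) * y powr (1 - \<alpha>)) + y powr - \<alpha>) has_real_derivative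
        \<alpha> * y powr (- \<alpha> - 1) * (y * c - 1)) (at y)"
    proof -
      have 1: "((\<lambda>y. y powr (1 - \<alpha>)) has_real_derivative (1 - \<alpha>) * y powr - \<alpha>) (at y)"
        and 2: "((\<lambda>y. y powr - \<alpha>) has_real_derivative - \<alpha> * y powr (- \<alpha> - 1)) (at y)"
        using y0 by (auto intro!: derivative_eq_intros)
      have "- (\<alpha> * c / (\<alpha> - 1) * ((1 - \<alpha>) * y powr - \<alpha>)) + - \<alpha> * y powr (- \<alpha> - 1)
        = \<alpha> * c * y powr - \<alpha> - \<alpha> * y powr (- \<alpha> - 1)"
        using assms by (simp add: divide_simps) (simp add: algebra_simps)
      then show ?thesis
        unfolding e using DERIV_add[OF DERIV_minus[OF DERIV_cmult[OF 1, of "\<alpha> * c / (\<alpha> - 1)"]] 2] by metis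
    qed
    show "0 \<le> \<alpha> * y powr (- \<alpha> - 1) * (y * c - 1)"
      using y c assms by (intro mult_nonneg_nonneg) (auto simp: field_simps)
  next
    have "((\<lambda>y. y powr (1 - \<alpha>)) \<longlongrightarrow> 0) at_top" "((\<lambda>y. y powr - \<alpha>) \<longlongrightarrow> 0) at_top"
      using assms by (auto intro!: tendsto_neg_powr filterlim_ident)
    from tendsto_add[OF tendsto_minus[OF tendsto_mult_left[OF this(1), of "\<alpha> * c / (\<alpha> - 1)"]] this(2)]
    show "((\<lambda>y. - (\<alpha> * c / (\<alpha> - 1) * y powr (1 - \<alpha>)) + y powr - \<alpha>) \<longlongrightarrow> 0) at_top" by simp
  qed measurable
  also have "0 - (- (\<alpha> * c / (\<alpha> - 1) * (1 / c) powr (1 - \<alpha>)) + (1 / c) powr - \<alpha>) = max 0 c powr \<alpha> / (\<alpha> - 1)"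
  proof -
    have "(1 / c) powr (1 - \<alpha>) = c powr \<alpha> / c" "(1 / c) powr - \<alpha> = c powr \<alpha>"
      using c by (simp_all add: powr_divide powr_minus powr_diff field_simps)
    then show ?thesis using c assms by (simp add: field_simps max_def)
  qed
  finally show ?thesis using assms
    by (intro has_bochner_integral_nn_integral) auto
qed

section \<open>The cluster functional under the tail process\<close>

context tail_pair
begin

text \<open>Here y is the size of the first value in units of x, and y \<Theta> the cluster it
  starts; y \<ge> \<epsilon> reflects that the first value exceeds \<epsilon> x. The product space
  allows one dominated convergence before the integral over y is evaluated.\<close>

definition jump_limit :: "real \<Rightarrow> real \<Rightarrow> real \<Rightarrow> nat \<Rightarrow> real \<Rightarrow> real" where
  "jump_limit \<rho> \<zeta> K k \<epsilon> = (\<integral>(\<omega>, y). weight y * of_bool (\<epsilon> \<le> y) *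
     jumpfun \<rho> \<zeta> K k (y * \<Theta> 0 \<omega>) (\<lambda>i. big \<epsilon> (y * \<Theta> (int i) \<omega>)) \<partial>(N \<Otimes>\<^sub>M lborel))"

text \<open>Convergence is applied at the level \<epsilon> x, where \<open>big \<epsilon>\<close>
  becomes \<open>big 1\<close> and the restriction on X 0 becomes the conditioning event. Returning
  to the normalisation p x multiplies the limit by \<epsilon>^-\<alpha>, as
  \<open>spectral_integral\<close> requires.\<close>

lemma tail_jump:
  assumes e: "0 < \<epsilon>" and K: "0 \<le> K" and \<rho>: "0 < \<rho>"
  shows "((\<lambda>x. (\<integral>\<omega>. indicator {\<omega> \<in> space M. \<epsilon> * x < \<bar>X 0 \<omega>\<bar>} \<omega> *
       jumpfun \<rho> \<zeta> K k (X 0 \<omega> / x) (\<lambda>i. big \<epsilon> (X (int i) \<omega> / x)) \<partial>M) / p x)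
     \<longlongrightarrow> jump_limit \<rho> \<zeta> K k \<epsilon>) at_top"
proof -
  define F0 where "F0 v = jumpfun \<rho> \<zeta> K k (v 0) (\<lambda>i. big \<epsilon> (v (int i)))" for v :: "int \<Rightarrow> real"
  define F where "F v = F0 (\<lambda>t. \<epsilon> * v t)" for v
  have F_eq: "F v = jumpfun \<rho> \<zeta> K k (\<epsilon> * v 0) (\<lambda>i. \<epsilon> * big 1 (v (int i)))" for v
    using big_mult[OF e, of 1] by (simp add: F_def F0_def mult.commute[of _ \<epsilon>])
  \<comment> \<open>The continuous version: the indicator of |v i| > 1 inside \<open>big\<close>
    becomes a ramp.\<close>
  define g where "g m v = jumpfun \<rho> \<zeta> K k (\<epsilon> * v 0) (\<lambda>i. \<epsilon> * (cutoff 1 (real m * (\<bar>v (int i)\<bar> - 1)) * v (int i)))"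
    for m :: nat and v :: "int \<Rightarrow> real"
  \<comment> \<open>Both functionals are bounded by K, and they differ only if some coordinate has a
    bump of full height; then the sum is at least 1 and 2 K suffices.\<close>
  define h where "h m v = 2 * K * (\<Sum>i=1..k. bump m (\<bar>v (int i)\<bar> - 1))" for m and v :: "int \<Rightarrow> real"
  have jump_cong: "jumpfun \<rho> \<zeta> K k u a = jumpfun \<rho> \<zeta> K k u b" if "\<And>i. 1 \<le> i \<Longrightarrow> i \<le> k \<Longrightarrow> a i = b i" for u a b
    using maxsum_cong[OF that] by (simp add: jumpfun_def)
  have win: "i \<le> k \<Longrightarrow> window {- int k..int k} v (int i) = v (int i)" "window {- int k..int k} v 0 = v 0" for i v
    by (auto simp: window_def)
  have wF0: "windowed k F0" unfolding windowed_def F0_def by (auto simp: win intro!: jump_cong)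
  have wF: "windowed k F" unfolding windowed_def F_eq by (auto simp: win intro!: jump_cong)
  have m0 [measurable]: "F0 \<in> borel_measurable borel" unfolding F0_def by measurable
  have m1: "F \<in> borel_measurable borel" unfolding F_eq[abs_def] by measurable
  have "(tail_mean F \<longlongrightarrow> (\<integral>\<omega>. F (\<lambda>t. Y t \<omega>) \<partial>N)) at_top"
  proof (rule tail_mean_tendsto[OF m1 wF])
    fix m
    show "g m \<in> bcontfun"
      by (rule bcontfun_realI[of _ K]) (use \<rho> K in \<open>auto simp: g_def jumpfun_bounded intro!: continuous_intros\<close>)
    show "windowed k (g m)" unfolding windowed_def g_def by (auto simp: win intro!: jump_cong)
    have "\<bar>\<Sum>i=1..k. bump m (\<bar>v (int i)\<bar> - 1)\<bar> \<le> (\<Sum>i=1..k. 1)" for v :: "int \<Rightarrow> real"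
      by (rule order.trans[OF sum_abs sum_mono]) simp
    then have "\<bar>h m v\<bar> \<le> 2 * K * real k" for v
      unfolding h_def abs_mult using K by (intro mult_mono) auto
    then show "h m \<in> bcontfun"
      by (intro bcontfun_realI[of _ "2 * K * real k"]) (auto simp: h_def intro!: continuous_intros)
    show "windowed k (h m)" unfolding windowed_def h_def by (auto simp: win intro!: sum.cong)
    show "\<bar>F v - g m v\<bar> \<le> h m v" for v
    proof (cases "\<exists>i\<in>{1..k}. 1 \<le> bump m (\<bar>v (int i)\<bar> - 1)")
      case True
      then obtain i where i: "i \<in> {1..k}" "1 \<le> bump m (\<bar>v (int i)\<bar> - 1)" by blast
      have "1 \<le> (\<Sum>i=1..k. bump m (\<bar>v (int i)\<bar> - 1))"
        by (rule order.trans[OF i(2)], rule member_le_sum[OF i(1)]) auto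
      then have "2 * K * 1 \<le> h m v" unfolding h_def using K by (intro mult_left_mono) auto
      moreover have "\<bar>F v\<bar> \<le> K" "\<bar>g m v\<bar> \<le> K" using K by (auto simp: F_eq g_def jumpfun_bounded)
      ultimately show ?thesis by linarith
    next
      case False
      have "cutoff 1 (real m * (\<bar>v (int i)\<bar> - 1)) * v (int i) = big 1 (v (int i))" if "1 \<le> i" "i \<le> k" for i
        using False that bump_less_1[of m "\<bar>v (int i)\<bar> - 1"] by (auto simp: big_def not_le)
      then have "F v = g m v" unfolding F_eq g_def by (intro jump_cong) simp
      moreover have "0 \<le> h m v" unfolding h_def using K by (intro mult_nonneg_nonneg sum_nonneg) auto
      ultimately show ?thesis by simp
    qed
  next
    have "(\<lambda>m. 2 * K * (\<Sum>i=1..k. \<integral>\<omega>. bump m (\<bar>Y (int i) \<omega>\<bar> - 1) \<partial>N)) \<longlonglongrightarrow> 2 * K * (\<Sum>i=1..k. 0)"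
      using bump_mean_tendsto[of _ 1] Y_no_atom by (intro tendsto_mult_left tendsto_sum) simp
    moreover have "integrable N (\<lambda>\<omega>. bump m (\<bar>Y t \<omega>\<bar> - 1))" for m t
      by (rule N.integrable_const_bound[of _ 1]) auto
    ultimately show "(\<lambda>m. \<integral>\<omega>. h m (\<lambda>t. Y t \<omega>) \<partial>N) \<longlonglongrightarrow> 0"
      by (simp add: h_def Bochner_Integration.integral_sum)
  qed
  moreover have "filterlim (\<lambda>x. \<epsilon> * x) at_top at_top"
    by (rule filterlim_tendsto_pos_mult_at_top[OF tendsto_const e filterlim_ident])
  ultimately have "((\<lambda>x. tail_mean F (\<epsilon> * x)) \<longlongrightarrow> (\<integral>\<omega>. F (\<lambda>t. Y t \<omega>) \<partial>N)) at_top"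
    by (rule filterlim_compose)
  from tendsto_mult[OF p_regular[OF e] this]
  have "((\<lambda>x. p (\<epsilon> * x) / p x * tail_mean F (\<epsilon> * x)) \<longlongrightarrow> \<epsilon> powr - \<alpha> * (\<integral>\<omega>. F0 (\<lambda>t. \<epsilon> * Y t \<omega>) \<partial>N)) at_top"
    by (simp add: F_def)
  also have "\<epsilon> powr - \<alpha> * (\<integral>\<omega>. F0 (\<lambda>t. \<epsilon> * Y t \<omega>) \<partial>N) = jump_limit \<rho> \<zeta> K k \<epsilon>"
    unfolding jump_limit_def by (subst spectral_integral[OF e m0 wF0]) (simp add: F0_def)
  finally have "((\<lambda>x. p (\<epsilon> * x) / p x * tail_mean F (\<epsilon> * x)) \<longlongrightarrow> jump_limit \<rho> \<zeta> K k \<epsilon>) at_top" .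
  moreover have "\<forall>\<^sub>F x in at_top. p (\<epsilon> * x) / p x * tail_mean F (\<epsilon> * x)
     = (\<integral>\<omega>. indicator {\<omega> \<in> space M. \<epsilon> * x < \<bar>X 0 \<omega>\<bar>} \<omega> *
       jumpfun \<rho> \<zeta> K k (X 0 \<omega> / x) (\<lambda>i. big \<epsilon> (X (int i) \<omega> / x)) \<partial>M) / p x"
    using eventually_gt_at_top[of 0]
  proof eventually_elim
    case (elim x)
    have "F (\<lambda>t. X t \<omega> / (\<epsilon> * x)) = jumpfun \<rho> \<zeta> K k (X 0 \<omega> / x) (\<lambda>i. big \<epsilon> (X (int i) \<omega> / x))" for \<omega>
      using e by (simp add: F_def F0_def)
    then show ?case using p_pos[of "\<epsilon> * x"] by (simp add: tail_mean_def)
  qed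
  ultimately show ?thesis by (rule Lim_transform_eventually)
qed

end

section \<open>Domination and evaluation of the limit\<close>

context tail_pair
begin

definition abs_sum :: "'b \<Rightarrow> ennreal" where
  "abs_sum \<omega> = (\<Sum>i. ennreal \<bar>\<Theta> (1 + int i) \<omega>\<bar>)"

lemma abs_sum_measurable [measurable]: "abs_sum \<in> borel_measurable N"
  unfolding abs_sum_def[abs_def] by measurable

lemma measurable_ennreal_powr [measurable]: "(\<lambda>a. ennreal_powr a r) \<in> borel_measurable borel"
  unfolding ennreal_powr_def by measurable

lemma abs_sum_finite:
  assumes "(\<integral>\<^sup>+ \<omega>. ennreal_powr (abs_sum \<omega>) (\<alpha> - 1) \<partial>N) < \<infinity>"
  shows "AE \<omega> in N. abs_sum \<omega> < \<infinity>"
proof -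
  have "AE \<omega> in N. ennreal_powr (abs_sum \<omega>) (\<alpha> - 1) \<noteq> \<infinity>"
    by (rule nn_integral_noteq_infinite) (use assms in auto)
  then show ?thesis by eventually_elim (auto simp: ennreal_powr_def less_top[symmetric] split: if_splits)
qed

lemma summable_\<Theta>:
  assumes "abs_sum \<omega> < \<infinity>"
  shows "summable (\<lambda>i. \<bar>\<Theta> (int (Suc i)) \<omega>\<bar>)" "(\<Sum>i=1..k. \<bar>\<Theta> (int i) \<omega>\<bar>) \<le> enn2real (abs_sum \<omega>)"
proof -
  have eq: "1 + int i = int (Suc i)" for i by simp
  have *: "abs_sum \<omega> = (\<Sum>i. ennreal \<bar>\<Theta> (int (Suc i)) \<omega>\<bar>)" unfolding abs_sum_def eq ..
  then have fin: "(\<Sum>i. ennreal \<bar>\<Theta> (int (Suc i)) \<omega>\<bar>) \<noteq> top" using assms by (simp add: less_top)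
  show s: "summable (\<lambda>i. \<bar>\<Theta> (int (Suc i)) \<omega>\<bar>)" by (rule summable_suminf_not_top[OF _ fin]) simp
  have "(\<Sum>i=1..k. \<bar>\<Theta> (int i) \<omega>\<bar>) = (\<Sum>i<k. \<bar>\<Theta> (int (Suc i)) \<omega>\<bar>)"
    by (rule sum.reindex_bij_witness[of _ Suc "\<lambda>i. i - 1"]) auto
  also have "\<dots> \<le> (\<Sum>i. \<bar>\<Theta> (int (Suc i)) \<omega>\<bar>)" by (rule sum_le_suminf[OF s]) auto
  also have "\<dots> = enn2real (abs_sum \<omega>)"
    unfolding * suminf_ennreal_eq[OF abs_ge_zero summable_sums[OF s]]
    by (rule enn2real_ennreal[OF suminf_nonneg[OF s abs_ge_zero], symmetric])
  finally show "(\<Sum>i=1..k. \<bar>\<Theta> (int i) \<omega>\<bar>) \<le> enn2real (abs_sum \<omega>)" .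
qed

text \<open>The two bounds on \<open>jumpfun\<close> combined, using |\<Theta> 0| = 1. The level is
  1/2 instead of 1 because the levels in use only tend to 1 and are kept at or above 1/2.\<close>

definition envelope :: "real \<Rightarrow> 'b \<times> real \<Rightarrow> real" where
  "envelope \<rho> q = of_bool (0 < snd q) * (weight (snd q) * (snd q / \<rho>))
     * of_bool (1 / 2 \<le> snd q * (1 + enn2real (abs_sum (fst q))))"

text \<open>Integrating over y first leaves the integral of y^-\<alpha> above a threshold of order 1
  / (1 + T), hence (1 + T)^(\<alpha>-1) with T the sum of the |\<Theta> i|. This is where the
  assumed moment enters.\<close>

lemma integrable_envelope:
  assumes m: "(\<integral>\<^sup>+ \<omega>. ennreal_powr (abs_sum \<omega>) (\<alpha> - 1) \<partial>N) < \<infinity>" and \<rho>: "0 < \<rho>"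
  shows "integrable (N \<Otimes>\<^sub>M lborel) (envelope \<rho>)"
proof (rule integrableI_nonneg)
  show [measurable]: "envelope \<rho> \<in> borel_measurable (N \<Otimes>\<^sub>M lborel)"
    unfolding envelope_def[abs_def] by measurable
  show "AE q in N \<Otimes>\<^sub>M lborel. 0 \<le> envelope \<rho> q"
    using \<rho> by (intro AE_I2) (auto simp: envelope_def weight_nonneg)
  let ?C = "\<alpha> / (\<alpha> - 1) / \<rho> * 4 powr (\<alpha> - 1)"
  have C: "0 \<le> ?C" using alpha \<rho> by simp
  have inner: "(\<integral>\<^sup>+y. ennreal (envelope \<rho> (\<omega>, y)) \<partial>lborel) \<le> ennreal ?C * (1 + ennreal_powr (abs_sum \<omega>) (\<alpha> - 1))" for \<omega>
  proof -
    define T where "T = enn2real (abs_sum \<omega>)"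
    \<comment> \<open>The threshold in y at which the indicator in \<open>envelope\<close> switches
      on.\<close>
    define s where "s = 1 / (2 * (1 + T))"
    have T: "0 \<le> T" by (simp add: T_def)
    have s: "0 < s" using T by (simp add: s_def)
    have "ennreal (envelope \<rho> (\<omega>, y)) = ennreal (1 / \<rho>) * (ennreal (\<alpha> * y powr - \<alpha>) * indicator {s..} y)" for y
    proof -
      have "s \<le> y \<longleftrightarrow> 1 / 2 \<le> y * (1 + T)" using T by (auto simp: s_def field_simps)
      moreover have "weight y * (y / \<rho>) = 1 / \<rho> * (\<alpha> * y powr - \<alpha>)" if "0 < y"
        using that by (simp add: weight_def powr_diff)
      moreover have "0 < y" if "s \<le> y" using s that by linarith
      ultimately show ?thesis
        using \<rho> alpha by (auto simp: envelope_def T_def[symmetric] indicator_def ennreal_mult[symmetric])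
    qed
    then have "(\<integral>\<^sup>+y. ennreal (envelope \<rho> (\<omega>, y)) \<partial>lborel)
       = ennreal (1 / \<rho>) * (\<integral>\<^sup>+y. ennreal (\<alpha> * y powr - \<alpha>) * indicator {s..} y \<partial>lborel)"
      by (simp add: nn_integral_cmult)
    also have "\<dots> = ennreal (1 / \<rho>) * ennreal (\<alpha> / (\<alpha> - 1) * s powr (1 - \<alpha>))"
      by (subst nn_integral_powr_tail[OF s alpha]) simp
    also have "\<dots> = ennreal (\<alpha> / (\<alpha> - 1) / \<rho> * s powr (1 - \<alpha>))"
      using \<rho> alpha by (subst ennreal_mult[symmetric]) auto
    also have "s powr (1 - \<alpha>) = (2 * (1 + T)) powr (\<alpha> - 1)"
      using T powr_minus[of "2 * (1 + T)" "1 - \<alpha>"] by (simp add: s_def powr_divide inverse_eq_divide)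
    also have "ennreal (\<alpha> / (\<alpha> - 1) / \<rho> * (2 * (1 + T)) powr (\<alpha> - 1)) \<le> ennreal (?C * (1 + T powr (\<alpha> - 1)))"
    proof (rule ennreal_leI)
      \<comment> \<open>Passing through the maximum of 1 and T splits the power of the sum, whether
        the exponent \<alpha> - 1 is below or above 1.\<close>
      have "(2 * (1 + T)) powr (\<alpha> - 1) \<le> (4 * max 1 T) powr (\<alpha> - 1)"
        using T alpha by (intro powr_mono2) auto
      also have "\<dots> = 4 powr (\<alpha> - 1) * max 1 T powr (\<alpha> - 1)" using T by (simp add: powr_mult)
      also have "max 1 T powr (\<alpha> - 1) \<le> 1 + T powr (\<alpha> - 1)" by (auto simp: max_def)
      finally have "(2 * (1 + T)) powr (\<alpha> - 1) \<le> 4 powr (\<alpha> - 1) * (1 + T powr (\<alpha> - 1))" by simp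
      then show "\<alpha> / (\<alpha> - 1) / \<rho> * (2 * (1 + T)) powr (\<alpha> - 1) \<le> ?C * (1 + T powr (\<alpha> - 1))"
        unfolding mult.assoc using alpha \<rho> by (intro mult_left_mono) auto
    qed
    also have "ennreal (?C * (1 + T powr (\<alpha> - 1))) = ennreal ?C * (1 + ennreal (T powr (\<alpha> - 1)))"
      using C by (subst ennreal_mult) simp_all
    also have "\<dots> \<le> ennreal ?C * (1 + ennreal_powr (abs_sum \<omega>) (\<alpha> - 1))"
    proof -
      have "ennreal (T powr (\<alpha> - 1)) \<le> ennreal_powr (abs_sum \<omega>) (\<alpha> - 1)"
        by (cases "abs_sum \<omega> = \<infinity>") (simp_all add: ennreal_powr_def T_def)
      then show ?thesis by (intro mult_left_mono add_left_mono) simp_all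
    qed
    finally show ?thesis .
  qed
  have "(\<integral>\<^sup>+q. ennreal (envelope \<rho> q) \<partial>(N \<Otimes>\<^sub>M lborel)) = (\<integral>\<^sup>+\<omega>. \<integral>\<^sup>+y. ennreal (envelope \<rho> (\<omega>, y)) \<partial>lborel \<partial>N)"
    by (rule lborel.nn_integral_fst[symmetric]) measurable
  also have "\<dots> \<le> (\<integral>\<^sup>+\<omega>. ennreal ?C * (1 + ennreal_powr (abs_sum \<omega>) (\<alpha> - 1)) \<partial>N)"
    by (rule nn_integral_mono) (rule inner)
  also have "\<dots> = ennreal ?C * (1 + (\<integral>\<^sup>+\<omega>. ennreal_powr (abs_sum \<omega>) (\<alpha> - 1) \<partial>N))"
    by (subst nn_integral_cmult; (subst nn_integral_add)?) (auto simp: N.emeasure_space_1)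
  also have "\<dots> < \<infinity>" using m by (simp add: ennreal_mult_less_top)
  finally show "(\<integral>\<^sup>+q. ennreal (envelope \<rho> q) \<partial>(N \<Otimes>\<^sub>M lborel)) < \<infinity>" .
qed

definition peak :: "'b \<Rightarrow> real" where
  "peak \<omega> = max 0 (SUP t\<in>{1::nat..}. \<Sum>i=1..t. \<Theta> (int i) \<omega>)"

lemma peak_measurable [measurable]: "peak \<in> borel_measurable N"
  unfolding peak_def by (intro borel_measurable_max borel_measurable_real_SUP) auto

text \<open>The envelope does not depend on any of the four parameters, so they may tend to their
  limits simultaneously and at unrelated rates. This freedom is needed because
  \<open>\<epsilon>\<close> and \<open>k\<close> are supplied by the hypotheses.\<close>

lemma jump_limit_tendsto:
  assumes m: "(\<integral>\<^sup>+ \<omega>. ennreal_powr (abs_sum \<omega>) (\<alpha> - 1) \<partial>N) < \<infinity>" and \<rho>: "0 < \<rho>"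
    and \<zeta>: "\<zeta> \<longlonglongrightarrow> 1" "\<And>m. 1 / 2 \<le> \<zeta> m"
    and K: "filterlim K at_top sequentially" "\<And>m. 0 \<le> K m"
    and k: "filterlim k at_top sequentially"
    and \<epsilon>: "\<epsilon> \<longlonglongrightarrow> 0" "\<And>m. 0 < \<epsilon> m"
  shows "(\<lambda>m. jump_limit \<rho> (\<zeta> m) (K m) (k m) (\<epsilon> m)) \<longlonglongrightarrow>
    (\<integral>\<omega>. max 0 (SUP t::nat. \<Sum>i=0..t. \<Theta> (int i) \<omega>) powr \<alpha> - peak \<omega> powr \<alpha> \<partial>N) / ((\<alpha> - 1) * \<rho>)"
proof -
  interpret NL: pair_sigma_finite N lborel ..
  define f where "f m q = weight (snd q) * of_bool (\<epsilon> m \<le> snd q) *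
     jumpfun \<rho> (\<zeta> m) (K m) (k m) (snd q * \<Theta> 0 (fst q)) (\<lambda>i. big (\<epsilon> m) (snd q * \<Theta> (int i) (fst q)))" for m and q :: "'b \<times> real"
  define g where "g q = of_bool (0 < snd q) * weight (snd q) *
     (max 0 ((snd q * (\<Theta> 0 (fst q) + peak (fst q)) - 1) / \<rho>) - max 0 ((snd q * peak (fst q) - 1) / \<rho>))" for q :: "'b \<times> real"
  have f_eq: "jump_limit \<rho> (\<zeta> m) (K m) (k m) (\<epsilon> m) = (\<integral>q. f m q \<partial>(N \<Otimes>\<^sub>M lborel))" for m
    unfolding jump_limit_def f_def by (simp add: case_prod_beta')
  have AE1: "AE \<omega> in N. abs_sum \<omega> < \<infinity> \<and> \<bar>\<Theta> 0 \<omega>\<bar> = 1"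
    using abs_sum_finite[OF m] \<Theta>0 by eventually_elim simp
  have AE2: "AE q in N \<Otimes>\<^sub>M lborel. abs_sum (fst q) < \<infinity> \<and> \<bar>\<Theta> 0 (fst q)\<bar> = 1"
  proof (rule NL.AE_pair_measure)
    show "AE \<omega> in N. AE y in lborel. abs_sum (fst (\<omega>, y)) < \<infinity> \<and> \<bar>\<Theta> 0 (fst (\<omega>, y))\<bar> = 1"
      using AE1 by eventually_elim simp
  qed measurable
  have f_m [measurable]: "f m \<in> borel_measurable (N \<Otimes>\<^sub>M lborel)" for m
    unfolding f_def[abs_def] by measurable
  have g_m [measurable]: "g \<in> borel_measurable (N \<Otimes>\<^sub>M lborel)"
    unfolding g_def[abs_def] by measurable
  have le: "norm (f m q) \<le> envelope \<rho> q" if q: "abs_sum (fst q) < \<infinity> \<and> \<bar>\<Theta> 0 (fst q)\<bar> = 1" for m q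
  proof (cases "\<epsilon> m \<le> snd q")
    case False then show ?thesis using \<rho> by (auto simp: f_def envelope_def weight_nonneg)
  next
    case True
    then have y: "0 < snd q" using \<epsilon>(2)[of m] by linarith
    let ?J = "jumpfun \<rho> (\<zeta> m) (K m) (k m) (snd q * \<Theta> 0 (fst q)) (\<lambda>i. big (\<epsilon> m) (snd q * \<Theta> (int i) (fst q)))"
    have J: "\<bar>?J\<bar> \<le> snd q / \<rho>"
      using jumpfun_le[OF \<rho>, of "\<zeta> m" "K m" "k m" "snd q * \<Theta> 0 (fst q)"] q y by (simp add: abs_mult)
    have "\<bar>?J\<bar> \<le> snd q / \<rho> * of_bool (1 / 2 \<le> snd q * (1 + enn2real (abs_sum (fst q))))"
    proof (cases "1 / 2 \<le> snd q * (1 + enn2real (abs_sum (fst q)))")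
      case False
      have "(\<Sum>i=1..k m. \<bar>big (\<epsilon> m) (snd q * \<Theta> (int i) (fst q))\<bar>) \<le> (\<Sum>i=1..k m. snd q * \<bar>\<Theta> (int i) (fst q)\<bar>)"
        by (rule sum_mono, rule order.trans[OF abs_big_le]) (use y in \<open>simp add: abs_mult\<close>)
      also have "\<dots> \<le> snd q * enn2real (abs_sum (fst q))"
        unfolding sum_distrib_left[symmetric] using y q by (intro mult_left_mono summable_\<Theta>) auto
      finally have "?J = 0"
        using False q y \<zeta>(2)[of m] by (intro jumpfun_eq_0[OF \<rho> K(2)]) (simp add: abs_mult algebra_simps)
      then show ?thesis using False by simp
    qed (use J in simp)
    then have "weight (snd q) * \<bar>?J\<bar> \<le> weight (snd q) * (snd q / \<rho> * of_bool (1 / 2 \<le> snd q * (1 + enn2real (abs_sum (fst q)))))"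
      by (rule mult_left_mono[OF _ weight_nonneg])
    then show ?thesis using True y by (simp add: f_def envelope_def abs_mult weight_nonneg)
  qed
  have lim: "(\<lambda>m. f m q) \<longlonglongrightarrow> g q" if q: "abs_sum (fst q) < \<infinity> \<and> \<bar>\<Theta> 0 (fst q)\<bar> = 1" for q
  proof (cases "0 < snd q")
    case False
    then have "f m q = g q" for m using \<epsilon>(2)[of m] by (auto simp: f_def g_def)
    then show ?thesis by simp
  next
    case y: True
    let ?a = "\<lambda>i. snd q * \<Theta> (int i) (fst q)"
    have s: "summable (\<lambda>i. \<bar>\<Theta> (int (Suc i)) (fst q)\<bar>)" using summable_\<Theta>(1) q by blast
    then have sa: "summable (\<lambda>i. \<bar>?a (Suc i)\<bar>)" using y by (simp add: abs_mult summable_mult)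
    have "(\<lambda>k. maxsum k ?a) \<longlonglongrightarrow> max 0 (SUP t\<in>{1..}. \<Sum>i=1..t. ?a i)" by (rule maxsum_tendsto_SUP(1)[OF sa])
    \<comment> \<open>Comparing two limits of the same maxima shows that the supremum scales with
      y.\<close>
    moreover have "(\<lambda>k. maxsum k ?a) \<longlonglongrightarrow> snd q * peak (fst q)"
      using tendsto_mult_left[OF maxsum_tendsto_SUP(1)[OF s], of "snd q"] y
      by (simp add: maxsum_mult peak_def)
    ultimately have pk: "max 0 (SUP t\<in>{1..}. \<Sum>i=1..t. ?a i) = snd q * peak (fst q)" by (rule LIMSEQ_unique)
    have M: "(\<lambda>m. maxsum (k m) (\<lambda>i. big (\<epsilon> m) (?a i))) \<longlonglongrightarrow> snd q * peak (fst q)"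
      using maxsum_big_tendsto[OF sa k \<epsilon>(1)] unfolding pk .
    have "\<forall>\<^sub>F m in sequentially. \<epsilon> m < snd q" by (rule order_tendstoD(2)[OF \<epsilon>(1) y])
    then have "(\<lambda>m. of_bool (\<epsilon> m \<le> snd q) :: real) \<longlonglongrightarrow> 1"
      by (intro tendsto_eventually) (auto elim!: eventually_mono)
    moreover have "(\<lambda>m. jumpfun \<rho> (\<zeta> m) (K m) (k m) (?a 0) (\<lambda>i. big (\<epsilon> m) (?a i)))
       \<longlonglongrightarrow> max 0 ((?a 0 + snd q * peak (fst q) - 1) / \<rho>) - max 0 ((snd q * peak (fst q) - 1) / \<rho>)"
      unfolding jumpfun_def using \<rho>
      by (intro tendsto_diff cutoff_tendsto[OF K(1)] tendsto_divide tendsto_add M \<zeta>(1) tendsto_const) auto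
    ultimately have "(\<lambda>m. weight (snd q) * of_bool (\<epsilon> m \<le> snd q) * jumpfun \<rho> (\<zeta> m) (K m) (k m) (?a 0) (\<lambda>i. big (\<epsilon> m) (?a i)))
       \<longlonglongrightarrow> weight (snd q) * 1 * (max 0 ((?a 0 + snd q * peak (fst q) - 1) / \<rho>) - max 0 ((snd q * peak (fst q) - 1) / \<rho>))"
      by (intro tendsto_mult tendsto_const)
    then show ?thesis using y by (simp add: f_def g_def distrib_left)
  qed
  have dom: "(\<lambda>m. \<integral>q. f m q \<partial>(N \<Otimes>\<^sub>M lborel)) \<longlonglongrightarrow> (\<integral>q. g q \<partial>(N \<Otimes>\<^sub>M lborel))"
    "integrable (N \<Otimes>\<^sub>M lborel) g"
  proof -
    have 1: "AE q in N \<Otimes>\<^sub>M lborel. (\<lambda>m. f m q) \<longlonglongrightarrow> g q" using AE2 by eventually_elim (rule lim)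
    have 2: "AE q in N \<Otimes>\<^sub>M lborel. norm (f m q) \<le> envelope \<rho> q" for m using AE2 by eventually_elim (rule le)
    show "(\<lambda>m. \<integral>q. f m q \<partial>(N \<Otimes>\<^sub>M lborel)) \<longlonglongrightarrow> (\<integral>q. g q \<partial>(N \<Otimes>\<^sub>M lborel))"
      by (rule integral_dominated_convergence[OF g_m f_m integrable_envelope[OF m \<rho>] 1 2])
    show "integrable (N \<Otimes>\<^sub>M lborel) g"
      by (rule integrable_dominated_convergence[OF g_m f_m integrable_envelope[OF m \<rho>] 1 2])
  qed
  have "(\<integral>q. g q \<partial>(N \<Otimes>\<^sub>M lborel)) = (\<integral>\<omega>. (\<integral>y. g (\<omega>, y) \<partial>lborel) \<partial>N)"
    by (rule NL.integral_fst'[OF dom(2), symmetric])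
  also have "\<dots> = (\<integral>\<omega>. (max 0 (\<Theta> 0 \<omega> + peak \<omega>) powr \<alpha> - peak \<omega> powr \<alpha>) / ((\<alpha> - 1) * \<rho>) \<partial>N)"
  proof (rule Bochner_Integration.integral_cong)
    fix \<omega>
    let ?h = "\<lambda>c y. of_bool (0 < y) * (\<alpha> * y powr (- \<alpha> - 1)) * max 0 (y * c - 1)"
    \<comment> \<open>For fixed \<omega> both terms are integrable in y, so the difference may be
      split here. In the outer integral over \<omega> the two powers stay together, as neither is
      known to have a finite mean.\<close>
    have B: "has_bochner_integral lborel (\<lambda>y. (?h (\<Theta> 0 \<omega> + peak \<omega>) y - ?h (peak \<omega>) y) / \<rho>)
      ((max 0 (\<Theta> 0 \<omega> + peak \<omega>) powr \<alpha> / (\<alpha> - 1) - max 0 (peak \<omega>) powr \<alpha> / (\<alpha> - 1)) / \<rho>)"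
      by (intro has_bochner_integral_divide_zero has_bochner_integral_diff has_bochner_integral_positive_part alpha)
    have mx: "max 0 (z / \<rho>) = max 0 z / \<rho>" for z using \<rho> by (auto simp: max_def divide_le_0_iff zero_le_divide_iff)
    have gh: "g (\<omega>, y) = (?h (\<Theta> 0 \<omega> + peak \<omega>) y - ?h (peak \<omega>) y) / \<rho>" for y
      unfolding g_def fst_conv snd_conv mx by (simp add: weight_def diff_divide_distrib right_diff_distrib)
    have pk: "max 0 (peak \<omega>) = peak \<omega>" by (simp add: peak_def)
    have "(\<integral>y. g (\<omega>, y) \<partial>lborel) = (max 0 (\<Theta> 0 \<omega> + peak \<omega>) powr \<alpha> / (\<alpha> - 1) - peak \<omega> powr \<alpha> / (\<alpha> - 1)) / \<rho>"
      using has_bochner_integral_integral_eq[OF B] by (simp only: gh pk)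
    then show "(\<integral>y. g (\<omega>, y) \<partial>lborel) = (max 0 (\<Theta> 0 \<omega> + peak \<omega>) powr \<alpha> - peak \<omega> powr \<alpha>) / ((\<alpha> - 1) * \<rho>)"
      by (simp add: diff_divide_distrib)
  qed simp
  also have "\<dots> = (\<integral>\<omega>. max 0 (SUP t::nat. \<Sum>i=0..t. \<Theta> (int i) \<omega>) powr \<alpha> - peak \<omega> powr \<alpha> \<partial>N) / ((\<alpha> - 1) * \<rho>)"
    unfolding integral_divide_zero
  proof (intro arg_cong[of _ _ "\<lambda>I. I / ((\<alpha> - 1) * \<rho>)"] integral_cong_AE)
    have [measurable]: "(\<lambda>\<omega>. SUP t::nat. \<Sum>i=0..t. \<Theta> (int i) \<omega>) \<in> borel_measurable N"
      by (intro borel_measurable_real_SUP) auto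
    show "(\<lambda>\<omega>. max 0 (SUP t::nat. \<Sum>i=0..t. \<Theta> (int i) \<omega>) powr \<alpha> - peak \<omega> powr \<alpha>) \<in> borel_measurable N"
      by measurable
    show "AE \<omega> in N. max 0 (\<Theta> 0 \<omega> + peak \<omega>) powr \<alpha> - peak \<omega> powr \<alpha>
       = max 0 (SUP t::nat. \<Sum>i=0..t. \<Theta> (int i) \<omega>) powr \<alpha> - peak \<omega> powr \<alpha>"
      using abs_sum_finite[OF m]
    proof eventually_elim
      case (elim \<omega>)
      then show ?case
        using maxsum_tendsto_SUP(2)[of "\<lambda>i. \<Theta> (int i) \<omega>", OF summable_\<Theta>(1)] by (simp add: peak_def)
    qed
  qed measurable
  finally show ?thesis using dom(1) unfolding f_eq by simp
qed

end

section \<open>Clusters of large values\<close>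

lemma count_overshoot_le:
  assumes "0 < \<rho>"
  shows "(\<Sum>j=1..n. of_bool (z + \<rho> * real j < g)) \<le> cutoff (real n) ((g - z) / \<rho>)"
proof -
  have "(z + \<rho> * real j < g) = (real j < (g - z) / \<rho>)" for j using assms by (auto simp: field_simps)
  then show ?thesis using count_le_cutoff[of "(g - z) / \<rho>" n] by simp
qed

text \<open>Charging k further steps of drift moves the threshold (g - z) / \<rho> by k, which
  changes the length by at most k; the remaining 1 comes from
  \<open>cutoff_le_count\<close>.\<close>

lemma cutoff_le_count_overshoot:
  assumes "0 < \<rho>"
  shows "cutoff (real n) ((g - z) / \<rho>) \<le> real k + 1 + (\<Sum>j=1..n. of_bool (z + \<rho> * (real j + real k) < g))"
proof -
  have "(z + \<rho> * (real j + real k) < g) = (real j < (g - z) / \<rho> - real k)" for j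
    using assms by (auto simp: field_simps)
  then show ?thesis
    using cutoff_le_count[of n "(g - z) / \<rho> - real k"] cutoff_lipschitz[of "real n" "(g - z) / \<rho>" "(g - z) / \<rho> - real k"]
    by (simp add: abs_le_iff)
qed

lemma sum_of_bool_boundary_le: "(\<Sum>j=1..n. of_bool (n < j + k)) \<le> real k"
proof -
  have "(\<Sum>j=1..n. of_bool (n < j + k)) = real (card {j \<in> {1..n}. n < j + k})"
    by (simp add: Int_def)
  also have "card {j \<in> {1..n}. n < j + k} \<le> card {n - k<..n}" by (rule card_mono) auto
  finally show ?thesis by simp
qed

locale stationary_tail_pair = tail_pair +
  assumes stationary: "strictly_stationary M X"
begin

text \<open>Stationarity is stated on the product sigma-algebra. With countably many coordinates
  this is the Borel sigma-algebra of the product topology, which is the one carried by the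
  functionals of the tail process.\<close>

lemma stationary_integral:
  fixes F :: "(int \<Rightarrow> real) \<Rightarrow> real"
  assumes F: "F \<in> borel_measurable borel"
  shows "(\<integral>\<omega>. F (\<lambda>t. X (t + h) \<omega>) \<partial>M) = (\<integral>\<omega>. F (\<lambda>t. X t \<omega>) \<partial>M)"
proof -
  have F': "F \<in> borel_measurable (\<Pi>\<^sub>M t\<in>UNIV. borel)"
    using F measurable_cong_sets[OF sets_PiM_equal_borel refl] by blast
  have m: "(\<lambda>\<omega> t. X (t + h) \<omega>) \<in> M \<rightarrow>\<^sub>M (\<Pi>\<^sub>M t\<in>UNIV. borel)" for h
    by (rule measurable_PiM_single') auto
  have "distr M (\<Pi>\<^sub>M t\<in>UNIV. borel) (\<lambda>\<omega> t. X (t + h) \<omega>) = distr M (\<Pi>\<^sub>M t\<in>UNIV. borel) (\<lambda>\<omega> t. X t \<omega>)"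
    using stationary by (simp add: strictly_stationary_def)
  then show ?thesis
    using integral_distr[OF m[of h] F'] integral_distr[OF m[of 0] F'] by simp
qed

lemma stationary_prob:
  assumes [measurable]: "Measurable.pred borel Q"
  shows "\<P>(\<omega> in M. Q (\<lambda>t. X (t + h) \<omega>)) = \<P>(\<omega> in M. Q (\<lambda>t. X t \<omega>))"
proof -
  have "(\<integral>\<omega>. of_bool (Q (\<lambda>t. X (t + h) \<omega>)) \<partial>M) = (\<integral>\<omega>. of_bool (Q (\<lambda>t. X t \<omega>)) \<partial>M :: real)"
    by (rule stationary_integral) measurable
  moreover have "(\<integral>\<omega>. of_bool (Q (\<lambda>t. X (t + h) \<omega>)) \<partial>M :: real) = \<P>(\<omega> in M. Q (\<lambda>t. X (t + h) \<omega>))" for h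
    by (subst Bochner_Integration.integral_cong[OF refl, of _ _ "indicator {\<omega>. Q (\<lambda>t. X (t + h) \<omega>)}"])
      (auto simp: indicator_def Int_def conj_commute)
  from this[of h] this[of 0] have "(\<integral>\<omega>. of_bool (Q (\<lambda>t. X (t + h) \<omega>)) \<partial>M :: real) = \<P>(\<omega> in M. Q (\<lambda>t. X (t + h) \<omega>))"
    "(\<integral>\<omega>. of_bool (Q (\<lambda>t. X t \<omega>)) \<partial>M :: real) = \<P>(\<omega> in M. Q (\<lambda>t. X t \<omega>))" by simp_all
  ultimately show ?thesis by simp
qed

lemma p_shift: "\<P>(\<omega> in M. c < \<bar>X t \<omega>\<bar>) = p c"
  using stationary_prob[of "\<lambda>v. c < \<bar>v 0\<bar>" t] by (simp add: p_def)

definition recurrence :: "nat \<Rightarrow> nat \<Rightarrow> real \<Rightarrow> real" where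
  "recurrence k n c = \<P>(\<omega> in M. c < \<bar>X 0 \<omega>\<bar> \<and> (\<exists>i\<in>{k..n}. c < \<bar>X (int i) \<omega>\<bar>))"

text \<open>An unconditional mean in the original units; the horizon n is the stretch of time in
  which the cluster may start.\<close>

definition cluster_mean :: "real \<Rightarrow> real \<Rightarrow> nat \<Rightarrow> nat \<Rightarrow> real \<Rightarrow> real" where
  "cluster_mean \<rho> z n k c = (\<integral>\<omega>. of_bool (c < \<bar>X 0 \<omega>\<bar>) *
     jumpfun \<rho> z (real n) k (X 0 \<omega>) (\<lambda>i. big c (X (int i) \<omega>)) \<partial>M)"

lemma integrable_bounded:
  "f \<in> borel_measurable M \<Longrightarrow> (\<And>\<omega>. \<bar>f \<omega>\<bar> \<le> B) \<Longrightarrow> integrable M f" for f :: "'a \<Rightarrow> real"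
  by (rule integrable_const_bound[of _ B]) auto

lemma overshoot_measurable [measurable]:
  "Measurable.pred M (\<lambda>\<omega>. overshoot \<rho> z (\<lambda>i. big c (X (int i) \<omega>)) n j)"
  unfolding overshoot_def by measurable

lemma prob_eq_integral: "Measurable.pred M P \<Longrightarrow> \<P>(\<omega> in M. P \<omega>) = (\<integral>\<omega>. of_bool (P \<omega>) \<partial>M)"
  by (subst Bochner_Integration.integral_cong[OF refl, of _ _ "indicator {\<omega>. P \<omega>}"])
    (auto simp: indicator_def Int_def conj_commute)

text \<open>After the telescoping, stationarity moves every starting time j to 0, so that only the
  thresholds still depend on j. Summing them counts starting times, and replacing counts by lengths
  costs (k + 1) p c. The exceptional events, weighted by 2, cost 2 k p c at the right end and 2 n
  recurrences.\<close>

lemma cluster_estimate: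
  assumes z: "0 < z" and \<rho>: "0 < \<rho>" and k: "1 \<le> k" and c: "0 \<le> c"
  shows "\<bar>\<P>(\<omega> in M. overshoot \<rho> z (\<lambda>i. big c (X (int i) \<omega>)) n 1) - cluster_mean \<rho> z n k c\<bar>
    \<le> (3 * real k + 1) * p c + 2 * real n * recurrence k n c"
proof -
  define B where "B \<omega> i = big c (X (int i) \<omega>)" for \<omega> and i :: nat
  define G where "G v = maxsum k (\<lambda>i. big c (v (int i)))" for v :: "int \<Rightarrow> real"
  define I where "I v = (of_bool (c < \<bar>v 0\<bar>) :: real)" for v :: "int \<Rightarrow> real"
  define U where "U r v = (of_bool (r < v 0 + G v) :: real)" for r and v :: "int \<Rightarrow> real"
  define V where "V r v = (of_bool (r < G v) :: real)" for r and v :: "int \<Rightarrow> real"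
  define R where "R v = (of_bool (c < \<bar>v 0\<bar> \<and> (\<exists>i\<in>{k..n}. c < \<bar>v (int i)\<bar>)) :: real)" for v :: "int \<Rightarrow> real"
  define sh where "sh j \<omega> = (\<lambda>t. X (t + int j) \<omega>)" for j :: nat and \<omega>
  define path where "path \<omega> = (\<lambda>t. X t \<omega>)" for \<omega>
  have [measurable]: "G \<in> borel_measurable borel" unfolding G_def by measurable
  have [measurable]: "I \<in> borel_measurable borel" unfolding I_def by measurable
  have [measurable]: "U r \<in> borel_measurable borel" for r unfolding U_def by measurable
  have [measurable]: "V r \<in> borel_measurable borel" for r unfolding V_def by measurable
  have [measurable]: "R \<in> borel_measurable borel" unfolding R_def by measurable
  have path_m [measurable]: "path \<in> borel_measurable M" unfolding path_def by (rule path_measurable) simp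
  have sh_m [measurable]: "sh j \<in> borel_measurable M" for j unfolding sh_def by (rule path_measurable) simp
  have shift: "(\<integral>\<omega>. F (sh j \<omega>) \<partial>M) = (\<integral>\<omega>. F (path \<omega>) \<partial>M)" if "F \<in> borel_measurable borel" for F :: "(int \<Rightarrow> real) \<Rightarrow> real" and j
    unfolding sh_def path_def by (rule stationary_integral[OF that])
  have big0: "(big c r \<noteq> 0) = (c < \<bar>r\<bar>)" for r using c by (auto simp: big_def)
  have big_id: "c < \<bar>r\<bar> \<Longrightarrow> big c r = r" for r by (simp add: big_def)
  have B_sh: "B \<omega> (j + i) = big c (sh j \<omega> (int i))" "B \<omega> j = big c (sh j \<omega> 0)" for \<omega> j i
    by (simp_all add: B_def sh_def add.commute)
  have GB: "maxsum k (\<lambda>i. B \<omega> (j + i)) = G (sh j \<omega>)" for \<omega> j by (simp add: G_def B_sh(1))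
  let ?e = "\<lambda>j \<omega>. of_bool (overshoot \<rho> z (B \<omega>) n j) :: real"
  have e_m [measurable]: "?e j \<in> borel_measurable M" for j unfolding B_def by measurable
  define bad where "bad j v = R v + of_bool (n < j + k) * I v" for j v
  have [measurable]: "bad j \<in> borel_measurable borel" for j unfolding bad_def by measurable
  \<comment> \<open>The pathwise bounds are written as functions of the path shifted by j, the form
    in which stationarity applies to each summand.\<close>
  have up: "?e j \<omega> - ?e (Suc j) \<omega> \<le> I (sh j \<omega>) * (U (z + \<rho> * real j) (sh j \<omega>) - V (z + \<rho> * (real j + real k)) (sh j \<omega>)) + 2 * bad j (sh j \<omega>)"
    and lo: "I (sh j \<omega>) * (U (z + \<rho> * (real j + real k)) (sh j \<omega>) - V (z + \<rho> * real j) (sh j \<omega>)) - 2 * bad j (sh j \<omega>) \<le> ?e j \<omega> - ?e (Suc j) \<omega>" for j \<omega>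
  proof -
    have *: "of_bool (B \<omega> j \<noteq> 0) = I (sh j \<omega>)" by (simp add: B_sh(2) I_def big0)
    have **: "I (sh j \<omega>) * (of_bool (s < B \<omega> j + G (sh j \<omega>)) - w) = I (sh j \<omega>) * (U s (sh j \<omega>) - w)" for s w
      by (auto simp: I_def U_def B_sh(2) big_id)
    have ***: "of_bool (B \<omega> j \<noteq> 0 \<and> (\<exists>i\<in>{k..n}. B \<omega> (j + i) \<noteq> 0)) + of_bool (n < j + k \<and> B \<omega> j \<noteq> 0) = bad j (sh j \<omega>)"
      unfolding B_sh(1) unfolding B_sh(2) big0 bad_def R_def I_def by auto
    show "?e j \<omega> - ?e (Suc j) \<omega> \<le> I (sh j \<omega>) * (U (z + \<rho> * real j) (sh j \<omega>) - V (z + \<rho> * (real j + real k)) (sh j \<omega>)) + 2 * bad j (sh j \<omega>)"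
      using overshoot_diff_le[OF z less_imp_le[OF \<rho>] k, of "B \<omega>" n j]
      unfolding GB * ** *** V_def[symmetric] .
    show "I (sh j \<omega>) * (U (z + \<rho> * (real j + real k)) (sh j \<omega>) - V (z + \<rho> * real j) (sh j \<omega>)) - 2 * bad j (sh j \<omega>) \<le> ?e j \<omega> - ?e (Suc j) \<omega>"
      using overshoot_diff_ge[OF z less_imp_le[OF \<rho>] k, of "B \<omega>" j n]
      unfolding GB * ** *** V_def[symmetric] .
  qed
  have bnd: "\<bar>I v\<bar> \<le> 1" "\<bar>U r v\<bar> \<le> 1" "\<bar>V r v\<bar> \<le> 1" "\<bar>R v\<bar> \<le> 1" for r v
    by (auto simp: I_def U_def V_def R_def)
  have bnd2: "\<bar>I v * (U r v - V s v)\<bar> \<le> 1" "\<bar>bad j v\<bar> \<le> 2" for r s j v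
    by (auto simp: I_def U_def V_def R_def bad_def)
  have int1: "integrable M (\<lambda>\<omega>. I (f \<omega>) * (U r (f \<omega>) - V s (f \<omega>)))" and int2: "integrable M (\<lambda>\<omega>. bad j (f \<omega>))"
    if [measurable]: "f \<in> borel_measurable M" for f r s j
    by (rule integrable_bounded[OF _ bnd2(1)], measurable) (rule integrable_bounded[OF _ bnd2(2)], measurable)
  have ie: "integrable M (?e j)" for j by (rule integrable_bounded[OF e_m, of _ 1]) auto
  have P: "\<P>(\<omega> in M. overshoot \<rho> z (\<lambda>i. big c (X (int i) \<omega>)) n 1) = (\<Sum>j=1..n. \<integral>\<omega>. ?e j \<omega> - ?e (Suc j) \<omega> \<partial>M)"
  proof -
    have "\<P>(\<omega> in M. overshoot \<rho> z (\<lambda>i. big c (X (int i) \<omega>)) n 1) = (\<integral>\<omega>. ?e 1 \<omega> \<partial>M)"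
      unfolding B_def by (rule prob_eq_integral) measurable
    also have "\<dots> = (\<integral>\<omega>. (\<Sum>j=1..n. ?e j \<omega> - ?e (Suc j) \<omega>) \<partial>M)"
      using overshoot_telescope[of \<rho> z "B _" n] by simp
    also have "\<dots> = (\<Sum>j=1..n. \<integral>\<omega>. ?e j \<omega> - ?e (Suc j) \<omega> \<partial>M)"
      by (rule Bochner_Integration.integral_sum) (intro Bochner_Integration.integrable_diff ie)
    finally show ?thesis .
  qed
  have iI: "(\<integral>\<omega>. I (path \<omega>) \<partial>M) = p c"
    unfolding p_def I_def path_def by (rule prob_eq_integral[symmetric]) measurable
  have iR: "(\<integral>\<omega>. R (path \<omega>) \<partial>M) = recurrence k n c"
    unfolding recurrence_def R_def path_def by (rule prob_eq_integral[symmetric]) measurable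
  have integrable_path: "integrable M (\<lambda>\<omega>. I (path \<omega>))" "integrable M (\<lambda>\<omega>. R (path \<omega>))"
    by (rule integrable_bounded[OF _ bnd(1)], measurable) (rule integrable_bounded[OF _ bnd(4)], measurable)
  have p0: "0 \<le> p c" by (simp add: p_def)
  \<comment> \<open>A return is possible for each of the n starting times, whereas at most k of them
    lie within k steps of the end.\<close>
  have bad_sum: "(\<Sum>j=1..n. \<integral>\<omega>. bad j (path \<omega>) \<partial>M) \<le> real n * recurrence k n c + real k * p c"
  proof -
    have "(\<Sum>j=1..n. \<integral>\<omega>. bad j (path \<omega>) \<partial>M) = (\<Sum>j=1..n. recurrence k n c + of_bool (n < j + k) * p c)"
      unfolding bad_def using integrable_path by (intro sum.cong) (auto simp: iI iR)
    also have "\<dots> = real n * recurrence k n c + (\<Sum>j=1..n. of_bool (n < j + k)) * p c"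
      by (simp add: sum.distrib sum_distrib_right del: sum_of_bool_eq)
    also have "\<dots> \<le> real n * recurrence k n c + real k * p c"
      using sum_of_bool_boundary_le[of n k] p0 by (intro add_left_mono mult_right_mono) auto
    finally show ?thesis .
  qed
  define J where "J v = jumpfun \<rho> z (real n) k (v 0) (\<lambda>i. big c (v (int i)))" for v :: "int \<Rightarrow> real"
  have [measurable]: "J \<in> borel_measurable borel" unfolding J_def by measurable
  have J: "J v = cutoff (real n) ((v 0 + G v - z) / \<rho>) - cutoff (real n) ((G v - z) / \<rho>)" for v
    by (simp add: J_def G_def jumpfun_def)
  have iJ: "integrable M (\<lambda>\<omega>. I (path \<omega>) * J (path \<omega>))"
    by (rule integrable_bounded[of _ "real n"]) (auto simp: I_def J_def jumpfun_bounded)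
  have cm: "cluster_mean \<rho> z n k c = (\<integral>\<omega>. I (path \<omega>) * J (path \<omega>) \<partial>M)"
    by (simp add: cluster_mean_def I_def J_def path_def)
  \<comment> \<open>For one fixed path the sum over j counts the thresholds that are exceeded, hence
    is a difference of two lengths up to k + 1.\<close>
  have up_sum: "(\<Sum>j=1..n. I v * (U (z + \<rho> * real j) v - V (z + \<rho> * (real j + real k)) v)) \<le> I v * J v + (real k + 1) * I v" for v
  proof -
    have "(\<Sum>j=1..n. U (z + \<rho> * real j) v - V (z + \<rho> * (real j + real k)) v) \<le> J v + (real k + 1)"
      unfolding sum_subtractf U_def V_def J
      using count_overshoot_le[OF \<rho>, where n=n and z=z and g="v 0 + G v"] cutoff_le_count_overshoot[OF \<rho>, of n "G v" z k] by linarith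
    then have "I v * (\<Sum>j=1..n. U (z + \<rho> * real j) v - V (z + \<rho> * (real j + real k)) v) \<le> I v * (J v + (real k + 1))"
      by (rule mult_left_mono) (simp add: I_def)
    then show ?thesis by (simp add: sum_distrib_left algebra_simps)
  qed
  have lo_sum: "I v * J v - (real k + 1) * I v \<le> (\<Sum>j=1..n. I v * (U (z + \<rho> * (real j + real k)) v - V (z + \<rho> * real j) v))" for v
  proof -
    have "J v - (real k + 1) \<le> (\<Sum>j=1..n. U (z + \<rho> * (real j + real k)) v - V (z + \<rho> * real j) v)"
      unfolding sum_subtractf U_def V_def J
      using count_overshoot_le[OF \<rho>, where n=n and z=z and g="G v"] cutoff_le_count_overshoot[OF \<rho>, of n "v 0 + G v" z k] by linarith
    then have "I v * (J v - (real k + 1)) \<le> I v * (\<Sum>j=1..n. U (z + \<rho> * (real j + real k)) v - V (z + \<rho> * real j) v)"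
      by (rule mult_left_mono) (simp add: I_def)
    then show ?thesis by (simp add: sum_distrib_left algebra_simps)
  qed
  have "\<P>(\<omega> in M. overshoot \<rho> z (\<lambda>i. big c (X (int i) \<omega>)) n 1)
     \<le> cluster_mean \<rho> z n k c + (3 * real k + 1) * p c + 2 * real n * recurrence k n c"
  proof -
    have "\<P>(\<omega> in M. overshoot \<rho> z (\<lambda>i. big c (X (int i) \<omega>)) n 1)
      \<le> (\<Sum>j=1..n. \<integral>\<omega>. I (sh j \<omega>) * (U (z + \<rho> * real j) (sh j \<omega>) - V (z + \<rho> * (real j + real k)) (sh j \<omega>)) + 2 * bad j (sh j \<omega>) \<partial>M)"
      unfolding P by (intro sum_mono integral_mono Bochner_Integration.integrable_diff ie Bochner_Integration.integrable_add
        int1 integrable_mult_right int2 sh_m up)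
    also have "\<dots> = (\<Sum>j=1..n. \<integral>\<omega>. I (path \<omega>) * (U (z + \<rho> * real j) (path \<omega>) - V (z + \<rho> * (real j + real k)) (path \<omega>)) + 2 * bad j (path \<omega>) \<partial>M)"
      by (intro sum.cong refl shift[of "\<lambda>v. I v * (U (z + \<rho> * real _) v - V (z + \<rho> * (real _ + real k)) v) + 2 * bad _ v"]) measurable
    also have "\<dots> = (\<integral>\<omega>. (\<Sum>j=1..n. I (path \<omega>) * (U (z + \<rho> * real j) (path \<omega>) - V (z + \<rho> * (real j + real k)) (path \<omega>))) \<partial>M)
        + 2 * (\<Sum>j=1..n. \<integral>\<omega>. bad j (path \<omega>) \<partial>M)"
      by (simp add: Bochner_Integration.integral_add Bochner_Integration.integral_sum int1 int2 sum.distrib sum_distrib_left)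
    also have "(\<integral>\<omega>. (\<Sum>j=1..n. I (path \<omega>) * (U (z + \<rho> * real j) (path \<omega>) - V (z + \<rho> * (real j + real k)) (path \<omega>))) \<partial>M)
       \<le> (\<integral>\<omega>. I (path \<omega>) * J (path \<omega>) + (real k + 1) * I (path \<omega>) \<partial>M)"
      by (intro integral_mono Bochner_Integration.integrable_sum int1 path_m Bochner_Integration.integrable_add iJ integrable_mult_right integrable_path up_sum)
    also have "\<dots> = cluster_mean \<rho> z n k c + (real k + 1) * p c"
      using iJ integrable_path by (simp add: cm iI)
    finally show ?thesis using bad_sum by (simp add: algebra_simps)
  qed
  moreover have "cluster_mean \<rho> z n k c - (3 * real k + 1) * p c - 2 * real n * recurrence k n c
     \<le> \<P>(\<omega> in M. overshoot \<rho> z (\<lambda>i. big c (X (int i) \<omega>)) n 1)"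
  proof -
    have "cluster_mean \<rho> z n k c - (real k + 1) * p c = (\<integral>\<omega>. I (path \<omega>) * J (path \<omega>) - (real k + 1) * I (path \<omega>) \<partial>M)"
      using iJ integrable_path by (simp add: cm iI)
    also have "\<dots> \<le> (\<integral>\<omega>. (\<Sum>j=1..n. I (path \<omega>) * (U (z + \<rho> * (real j + real k)) (path \<omega>) - V (z + \<rho> * real j) (path \<omega>))) \<partial>M)"
      by (intro integral_mono Bochner_Integration.integrable_sum int1 path_m Bochner_Integration.integrable_diff iJ integrable_mult_right integrable_path lo_sum)
    also have "\<dots> - 2 * (\<Sum>j=1..n. \<integral>\<omega>. bad j (path \<omega>) \<partial>M)
      = (\<Sum>j=1..n. \<integral>\<omega>. I (path \<omega>) * (U (z + \<rho> * (real j + real k)) (path \<omega>) - V (z + \<rho> * real j) (path \<omega>)) - 2 * bad j (path \<omega>) \<partial>M)"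
      by (simp add: Bochner_Integration.integral_diff Bochner_Integration.integral_sum int1 int2 sum_subtractf sum_distrib_left)
    also have "\<dots> = (\<Sum>j=1..n. \<integral>\<omega>. I (sh j \<omega>) * (U (z + \<rho> * (real j + real k)) (sh j \<omega>) - V (z + \<rho> * real j) (sh j \<omega>)) - 2 * bad j (sh j \<omega>) \<partial>M)"
      by (intro sum.cong refl shift[of "\<lambda>v. I v * (U (z + \<rho> * (real _ + real k)) v - V (z + \<rho> * real _) v) - 2 * bad _ v", symmetric]) measurable
    also have "\<dots> \<le> \<P>(\<omega> in M. overshoot \<rho> z (\<lambda>i. big c (X (int i) \<omega>)) n 1)"
      unfolding P by (intro sum_mono integral_mono Bochner_Integration.integrable_diff ie
        int1 integrable_mult_right int2 sh_m lo)
    finally show ?thesis using bad_sum by (simp add: algebra_simps)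
  qed
  ultimately show ?thesis by (simp add: abs_le_iff)
qed

end

section \<open>Limits at high levels\<close>

lemma filterlim_nat_floor: "0 < K \<Longrightarrow> filterlim (\<lambda>x::real. nat \<lfloor>K * x\<rfloor>) at_top at_top"
  by (rule filterlim_compose[OF filterlim_nat_sequentially filterlim_compose[OF filterlim_floor_sequentially]],
      rule filterlim_tendsto_pos_mult_at_top[OF tendsto_const _ filterlim_ident])

text \<open>With n = floor (K x) the level x lies in [C1 n, C2 n] for C1 = 1/K and C2 = 2/K; the
  factor 2 absorbs the rounding, since K x \<le> n + 1 \<le> 2 n. Thus hypotheses along n become
  statements along x.\<close>

lemma nat_floor_window:
  assumes "0 < K" "1 \<le> nat \<lfloor>K * x\<rfloor>"
  shows "x \<in> {1 / K * real (nat \<lfloor>K * x\<rfloor>)..2 / K * real (nat \<lfloor>K * x\<rfloor>)}"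
    and "real (nat \<lfloor>K * x\<rfloor>) \<le> K * x" "K * x \<le> real (nat \<lfloor>K * x\<rfloor>) + 1" "K * x / 2 \<le> real (nat \<lfloor>K * x\<rfloor>)"
proof -
  have n: "real (nat \<lfloor>K * x\<rfloor>) = of_int \<lfloor>K * x\<rfloor>" using assms(2) by (simp add: of_nat_nat)
  have 1: "1 \<le> real (nat \<lfloor>K * x\<rfloor>)" using assms(2) by simp
  show le: "real (nat \<lfloor>K * x\<rfloor>) \<le> K * x" and ge: "K * x \<le> real (nat \<lfloor>K * x\<rfloor>) + 1"
    unfolding n by linarith+
  show "K * x / 2 \<le> real (nat \<lfloor>K * x\<rfloor>)" using ge 1 by linarith
  have "K * x \<le> 2 * real (nat \<lfloor>K * x\<rfloor>)" using ge 1 by linarith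
  then show "x \<in> {1 / K * real (nat \<lfloor>K * x\<rfloor>)..2 / K * real (nat \<lfloor>K * x\<rfloor>)}"
    using le assms(1) by (auto simp: field_simps)
qed

lemma jumpfun_scale:
  assumes "0 < x"
  shows "x * jumpfun \<rho> \<zeta> K k (u / x) (\<lambda>i. a i / x) = jumpfun \<rho> (\<zeta> * x) (x * K) k u a"
proof -
  have m: "maxsum k (\<lambda>i. a i / x) = maxsum k a / x"
    using maxsum_mult[of "1 / x" k a] assms by simp
  have "x * cutoff K (r / \<rho>) = cutoff (x * K) ((x * r) / \<rho>)" for r
    using cutoff_mult[of x K "r / \<rho>"] assms by simp
  then show ?thesis using assms by (simp add: jumpfun_def m right_diff_distrib distrib_left mult.commute)
qed

text \<open>Used to pass from the integer horizon floor (K x) to K x, at a cost of at most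
  2.\<close>

lemma jumpfun_horizon: "\<bar>jumpfun \<rho> \<zeta> K k u a - jumpfun \<rho> \<zeta> L k u a\<bar> \<le> 2 * \<bar>K - L\<bar>"
proof -
  have *: "\<bar>a - c - (b - e)\<bar> \<le> 2 * d" if "\<bar>a - b\<bar> \<le> d" "\<bar>c - e\<bar> \<le> d" for a b c d e :: real
    using that by linarith
  show ?thesis unfolding jumpfun_def by (intro * cutoff_lipschitz_left)
qed

section \<open>The hypotheses along n as estimates along x\<close>

locale ruin = stationary_tail_pair +
  fixes \<rho> :: real
  assumes \<rho>: "0 < \<rho>"
    and anticlustering:
      "\<And>C1 C2 \<delta>. 0 < C1 \<Longrightarrow> C1 < C2 \<Longrightarrow> \<delta> > 0 \<Longrightarrow>
         (\<lambda>k::nat. limsup (\<lambda>n::nat. SUP x\<in>{C1 * real n..C2 * real n}.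
            ereal (\<P>(\<omega> in M. (MAX i\<in>{k..n}. \<bar>X (int i) \<omega>\<bar>) > x * \<delta> \<bar> \<bar>X 0 \<omega>\<bar> > x * \<delta>))))
         \<longlonglongrightarrow> 0"
    and vanishing_small_values:
      "\<And>C1 C2 \<delta>. 0 < C1 \<Longrightarrow> C1 < C2 \<Longrightarrow> \<delta> > 0 \<Longrightarrow>
         ((\<lambda>\<epsilon>. limsup (\<lambda>n::nat. SUP x\<in>{C1 * real n..C2 * real n}.
            ereal (\<P>(\<omega> in M. (MAX t\<in>{0..n}. \<bar>psum (truncated (\<epsilon> * x) X) t \<omega>\<bar>) / x > \<delta>)
                   / (real n * \<P>(\<omega> in M. \<bar>X 0 \<omega>\<bar> > x)))))
         \<longlongrightarrow> 0) (at_right 0)"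
begin

lemma p_le:
  assumes "0 < u" shows "\<forall>\<^sub>F x in at_top. p (u * x) \<le> 2 * u powr - \<alpha> * p x"
proof -
  have "\<forall>\<^sub>F x in at_top. p (u * x) / p x < 2 * u powr - \<alpha>"
    by (rule order_tendstoD(2)[OF p_regular[OF assms]]) (use assms in simp)
  then show ?thesis
  proof eventually_elim
    case (elim x)
    then show ?case using p_pos[of x] by (simp add: field_simps)
  qed
qed

text \<open>The bound \<open>k0\<close> does not depend on x, whereas the point from which the
  estimate holds may depend on k.\<close>

lemma recurrence_small:
  assumes K: "0 < K" and \<epsilon>: "0 < \<epsilon>" and \<eta>: "0 < \<eta>"
  shows "\<exists>k0. \<forall>k\<ge>k0. \<forall>\<^sub>F x in at_top. recurrence k (nat \<lfloor>K * x\<rfloor>) (\<epsilon> * x) \<le> \<eta> * p x"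
proof -
  \<comment> \<open>The factor 2 \<epsilon>^-\<alpha> bounds p (\<epsilon> x) / p x, which is lost
    when the conditional probability is turned into \<open>recurrence\<close>.\<close>
  define \<eta>' where "\<eta>' = \<eta> / (2 * \<epsilon> powr - \<alpha>)"
  have \<eta>': "0 < \<eta>'" using \<eta> \<epsilon> by (simp add: \<eta>'_def)
  let ?c = "\<lambda>k n x. \<P>(\<omega> in M. (MAX i\<in>{k..n}. \<bar>X (int i) \<omega>\<bar>) > x * \<epsilon> \<bar> \<bar>X 0 \<omega>\<bar> > x * \<epsilon>)"
  let ?S = "\<lambda>k n. SUP x\<in>{1 / K * real n..2 / K * real n}. ereal (?c k n x)"
  have "(\<lambda>k. limsup (?S k)) \<longlonglongrightarrow> 0"
    by (rule anticlustering) (use K \<epsilon> in \<open>auto simp: divide_strict_right_mono\<close>)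
  then have "\<forall>\<^sub>F k in sequentially. limsup (?S k) < ereal \<eta>'"
    by (rule order_tendstoD(2)) (use \<eta>' in simp)
  then obtain k0 where k0: "\<And>k. k0 \<le> k \<Longrightarrow> limsup (?S k) < ereal \<eta>'"
    by (auto simp: eventually_sequentially)
  have "\<forall>\<^sub>F x in at_top. recurrence k (nat \<lfloor>K * x\<rfloor>) (\<epsilon> * x) \<le> \<eta> * p x" if "k0 \<le> k" for k
  proof -
    have "\<forall>\<^sub>F n in sequentially. ?S k n < ereal \<eta>'" by (rule Limsup_lessD[OF k0[OF that]])
    then have "\<forall>\<^sub>F n in sequentially. max 1 k \<le> n \<and> ?S k n < ereal \<eta>'"
      by (intro eventually_conj eventually_ge_at_top)
    then have "\<forall>\<^sub>F x in at_top. max 1 k \<le> nat \<lfloor>K * x\<rfloor> \<and> ?S k (nat \<lfloor>K * x\<rfloor>) < ereal \<eta>'"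
      by (rule eventually_compose_filterlim[OF _ filterlim_nat_floor[OF K]])
    then show ?thesis using p_le[OF \<epsilon>]
    proof eventually_elim
      case (elim x)
      let ?n = "nat \<lfloor>K * x\<rfloor>"
      have n: "1 \<le> ?n" "k \<le> ?n" using elim by auto
      have "ereal (?c k ?n x) \<le> ?S k ?n" by (rule SUP_upper[OF nat_floor_window(1)[OF K n(1)]])
      also have "\<dots> < ereal \<eta>'" using elim by simp
      finally have "?c k ?n x < \<eta>'" by simp
      \<comment> \<open>The maximum can be read as an existential statement only over a nonempty
        range, hence the condition k \<le> n above.\<close>
      moreover have "?c k ?n x = recurrence k ?n (\<epsilon> * x) / p (\<epsilon> * x)"
        unfolding cond_prob_def recurrence_def p_def using n(2)
        by (simp add: Max_gr_iff mult.commute[of x] conj_commute)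
      ultimately have "recurrence k ?n (\<epsilon> * x) / p (\<epsilon> * x) < \<eta>'" by simp
      then have "recurrence k ?n (\<epsilon> * x) \<le> \<eta>' * p (\<epsilon> * x)"
        using p_pos[of "\<epsilon> * x"] by (simp add: pos_divide_less_eq)
      also have "\<dots> \<le> \<eta>' * (2 * \<epsilon> powr - \<alpha> * p x)"
        using elim \<eta>' by (intro mult_left_mono) auto
      also have "\<dots> = \<eta> * p x" using \<epsilon> by (simp add: \<eta>'_def)
      finally show ?case .
    qed
  qed
  then show ?thesis by blast
qed

text \<open>All levels of the window are kept because there are two uses: with x = n on dyadic
  blocks, and with n = floor (K x).\<close>

lemma vanishing_sequence:
  assumes "0 < C1" "C1 < C2" and \<delta>: "0 < \<delta>" and \<eta>: "0 < \<eta>"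
  shows "\<exists>\<epsilon>0>0. \<forall>\<epsilon>. 0 < \<epsilon> \<and> \<epsilon> < \<epsilon>0 \<longrightarrow> (\<forall>\<^sub>F n in sequentially. \<forall>x\<in>{C1 * real n..C2 * real n}.
    \<P>(\<omega> in M. \<exists>t\<in>{0..n}. \<delta> * x < \<bar>psum (truncated (\<epsilon> * x) X) t \<omega>\<bar>) \<le> \<eta> * (real n * p x))"
proof -
  let ?c = "\<lambda>\<epsilon> n x. \<P>(\<omega> in M. (MAX t\<in>{0..n}. \<bar>psum (truncated (\<epsilon> * x) X) t \<omega>\<bar>) / x > \<delta>)
                   / (real n * \<P>(\<omega> in M. \<bar>X 0 \<omega>\<bar> > x))"
  let ?S = "\<lambda>\<epsilon> n. SUP x\<in>{C1 * real n..C2 * real n}. ereal (?c \<epsilon> n x)"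
  have "((\<lambda>\<epsilon>. limsup (?S \<epsilon>)) \<longlongrightarrow> 0) (at_right 0)"
    by (rule vanishing_small_values) (use assms in auto)
  then have "\<forall>\<^sub>F \<epsilon> in at_right 0. limsup (?S \<epsilon>) < ereal \<eta>"
    by (rule order_tendstoD(2)) (use \<eta> in simp)
  then obtain \<epsilon>0 where \<epsilon>0: "0 < \<epsilon>0" "\<And>\<epsilon>. 0 < \<epsilon> \<Longrightarrow> \<epsilon> < \<epsilon>0 \<Longrightarrow> limsup (?S \<epsilon>) < ereal \<eta>"
    by (auto simp: eventually_at_right[OF zero_less_one])
  have "\<forall>\<^sub>F n in sequentially. \<forall>x\<in>{C1 * real n..C2 * real n}.
    \<P>(\<omega> in M. \<exists>t\<in>{0..n}. \<delta> * x < \<bar>psum (truncated (\<epsilon> * x) X) t \<omega>\<bar>) \<le> \<eta> * (real n * p x)"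
    if "0 < \<epsilon>" "\<epsilon> < \<epsilon>0" for \<epsilon>
  proof -
    have "\<forall>\<^sub>F n in sequentially. ?S \<epsilon> n < ereal \<eta>" by (rule Limsup_lessD[OF \<epsilon>0(2)[OF that]])
    then show ?thesis using eventually_ge_at_top[of 1]
    proof eventually_elim
      case (elim n)
      show ?case
      proof
        fix x assume x: "x \<in> {C1 * real n..C2 * real n}"
        have "0 < C1 * real n" using assms(1) elim by simp
        then have x0: "0 < x" using x by auto
        have "ereal (?c \<epsilon> n x) \<le> ?S \<epsilon> n" by (rule SUP_upper[OF x])
        also have "\<dots> < ereal \<eta>" using elim by simp
        finally have "?c \<epsilon> n x < \<eta>" by simp
        moreover have "\<delta> < (MAX t\<in>{0..n}. \<bar>psum (truncated (\<epsilon> * x) X) t \<omega>\<bar>) / x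
           \<longleftrightarrow> (\<exists>t\<in>{0..n}. \<delta> * x < \<bar>psum (truncated (\<epsilon> * x) X) t \<omega>\<bar>)" for \<omega>
          unfolding pos_less_divide_eq[OF x0] by (subst Max_gr_iff) auto
        ultimately show "\<P>(\<omega> in M. \<exists>t\<in>{0..n}. \<delta> * x < \<bar>psum (truncated (\<epsilon> * x) X) t \<omega>\<bar>) \<le> \<eta> * (real n * p x)"
          using p_pos[of x] elim by (simp add: p_def[symmetric] field_simps)
      qed
    qed
  qed
  then show ?thesis using \<epsilon>0(1) by blast
qed

lemma vanishing_small:
  assumes K: "0 < K" and \<delta>: "0 < \<delta>" and \<eta>: "0 < \<eta>"
  shows "\<exists>\<epsilon>0>0. \<forall>\<epsilon>. 0 < \<epsilon> \<and> \<epsilon> < \<epsilon>0 \<longrightarrow> (\<forall>\<^sub>F x in at_top.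
    \<P>(\<omega> in M. \<exists>t\<in>{0..nat \<lfloor>K * x\<rfloor>}. \<delta> * x < \<bar>psum (truncated (\<epsilon> * x) X) t \<omega>\<bar>) \<le> \<eta> * (x * p x))"
proof -
  obtain \<epsilon>0 where \<epsilon>0: "0 < \<epsilon>0" "\<And>\<epsilon>. 0 < \<epsilon> \<Longrightarrow> \<epsilon> < \<epsilon>0 \<Longrightarrow> (\<forall>\<^sub>F n in sequentially. \<forall>x\<in>{1 / K * real n..2 / K * real n}.
    \<P>(\<omega> in M. \<exists>t\<in>{0..n}. \<delta> * x < \<bar>psum (truncated (\<epsilon> * x) X) t \<omega>\<bar>) \<le> \<eta> / K * (real n * p x))"
    using vanishing_sequence[of "1 / K" "2 / K" \<delta> "\<eta> / K"] assms by (auto simp: divide_strict_right_mono)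
  have "\<forall>\<^sub>F x in at_top.
    \<P>(\<omega> in M. \<exists>t\<in>{0..nat \<lfloor>K * x\<rfloor>}. \<delta> * x < \<bar>psum (truncated (\<epsilon> * x) X) t \<omega>\<bar>) \<le> \<eta> * (x * p x)"
    if "0 < \<epsilon>" "\<epsilon> < \<epsilon>0" for \<epsilon>
    using eventually_compose_filterlim[OF eventually_conj[OF eventually_ge_at_top[of 1] \<epsilon>0(2)[OF that]] filterlim_nat_floor[OF K]]
  proof eventually_elim
    case (elim x)
    let ?n = "nat \<lfloor>K * x\<rfloor>"
    have n: "1 \<le> ?n" using elim by simp
    have "\<P>(\<omega> in M. \<exists>t\<in>{0..?n}. \<delta> * x < \<bar>psum (truncated (\<epsilon> * x) X) t \<omega>\<bar>) \<le> \<eta> / K * (real ?n * p x)"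
      using elim nat_floor_window(1)[OF K n] by blast
    also have "\<dots> \<le> \<eta> / K * (K * x * p x)"
      using nat_floor_window(2)[OF K n] p_pos[of x] K \<eta> by (intro mult_left_mono mult_right_mono) auto
    finally show ?case using K by simp
  qed
  then show ?thesis using \<epsilon>0(1) by blast
qed

text \<open>After division by x p x, the terms with p (\<epsilon> x) vanish: 3 k + 1 of them come
  from \<open>cluster_estimate\<close> and 2 from rounding the horizon. The recurrences contribute 2
  K \<eta>, and the last \<eta> covers the vanishing terms and the convergence in
  \<open>tail_jump\<close>.\<close>

lemma overshoot_limit:
  assumes K: "0 < K" and \<epsilon>: "0 < \<epsilon>" and \<eta>: "0 < \<eta>" and \<zeta>: "0 < \<zeta>" and k: "1 \<le> k"
    and rec: "\<forall>\<^sub>F x in at_top. recurrence k (nat \<lfloor>K * x\<rfloor>) (\<epsilon> * x) \<le> \<eta> * p x"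
  shows "\<forall>\<^sub>F x in at_top. \<bar>\<P>(\<omega> in M. overshoot \<rho> (\<zeta> * x) (\<lambda>i. big (\<epsilon> * x) (X (int i) \<omega>)) (nat \<lfloor>K * x\<rfloor>) 1) / (x * p x)
     - jump_limit \<rho> \<zeta> K k \<epsilon>\<bar> \<le> (2 * K + 1) * \<eta>"
proof -
  define f where "f x = (\<integral>\<omega>. indicator {\<omega> \<in> space M. \<epsilon> * x < \<bar>X 0 \<omega>\<bar>} \<omega> *
       jumpfun \<rho> \<zeta> K k (X 0 \<omega> / x) (\<lambda>i. big \<epsilon> (X (int i) \<omega> / x)) \<partial>M) / p x" for x
  have f: "(f \<longlongrightarrow> jump_limit \<rho> \<zeta> K k \<epsilon>) at_top"
    unfolding f_def[abs_def] by (rule tail_jump[OF \<epsilon> less_imp_le[OF K] \<rho>])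
  have r: "((\<lambda>x. (3 * real k + 3) * (p (\<epsilon> * x) / p x) * inverse x) \<longlongrightarrow> (3 * real k + 3) * \<epsilon> powr - \<alpha> * 0) at_top"
    by (intro tendsto_mult tendsto_const p_regular[OF \<epsilon>] tendsto_inverse_0_at_top filterlim_ident)
  have "((\<lambda>x. (3 * real k + 3) * (p (\<epsilon> * x) / p x) * inverse x + \<bar>f x - jump_limit \<rho> \<zeta> K k \<epsilon>\<bar>)
     \<longlongrightarrow> (3 * real k + 3) * \<epsilon> powr - \<alpha> * 0 + \<bar>jump_limit \<rho> \<zeta> K k \<epsilon> - jump_limit \<rho> \<zeta> K k \<epsilon>\<bar>) at_top"
    by (intro tendsto_add r tendsto_rabs tendsto_diff f tendsto_const)
  then have "\<forall>\<^sub>F x in at_top. (3 * real k + 3) * (p (\<epsilon> * x) / p x) * inverse x + \<bar>f x - jump_limit \<rho> \<zeta> K k \<epsilon>\<bar> < \<eta>"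
    by (rule order_tendstoD(2)) (use \<eta> in simp)
  moreover have "\<forall>\<^sub>F x in at_top. 1 \<le> nat \<lfloor>K * x\<rfloor>"
    by (rule eventually_compose_filterlim[OF eventually_ge_at_top filterlim_nat_floor[OF K]])
  ultimately show ?thesis using rec eventually_gt_at_top[of 0]
  proof eventually_elim
    case (elim x)
    let ?n = "nat \<lfloor>K * x\<rfloor>" and ?P = "\<P>(\<omega> in M. overshoot \<rho> (\<zeta> * x) (\<lambda>i. big (\<epsilon> * x) (X (int i) \<omega>)) (nat \<lfloor>K * x\<rfloor>) 1)"
    let ?A = "{\<omega> \<in> space M. \<epsilon> * x < \<bar>X 0 \<omega>\<bar>}"
    have x: "0 < x" and n: "1 \<le> ?n" using elim by auto
    have xp: "0 < x * p x" using x p_pos by simp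
    have nK: "real ?n \<le> K * x" "\<bar>real ?n - x * K\<bar> \<le> 1"
      using nat_floor_window(2,3)[OF K n] unfolding mult.commute[of x K] by linarith+
    have 1: "\<bar>?P - cluster_mean \<rho> (\<zeta> * x) ?n k (\<epsilon> * x)\<bar> \<le> (3 * real k + 1) * p (\<epsilon> * x) + 2 * real ?n * recurrence k ?n (\<epsilon> * x)"
      by (rule cluster_estimate) (use x \<zeta> \<epsilon> \<rho> k in auto)
    let ?J = "\<lambda>\<omega>. jumpfun \<rho> (\<zeta> * x) (real ?n) k (X 0 \<omega>) (\<lambda>i. big (\<epsilon> * x) (X (int i) \<omega>))"
    let ?J' = "\<lambda>\<omega>. jumpfun \<rho> \<zeta> K k (X 0 \<omega> / x) (\<lambda>i. big \<epsilon> (X (int i) \<omega> / x))"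
    have J': "x * ?J' \<omega> = jumpfun \<rho> (\<zeta> * x) (x * K) k (X 0 \<omega>) (\<lambda>i. big (\<epsilon> * x) (X (int i) \<omega>))" for \<omega>
    proof -
      have "big \<epsilon> (r / x) = big (\<epsilon> * x) r / x" for r using big_mult[OF x, of \<epsilon> "r / x"] x by simp
      then show ?thesis using jumpfun_scale[OF x] by simp
    qed
    have iJ: "integrable M (\<lambda>\<omega>. indicator ?A \<omega> * ?J \<omega>)"
      by (rule integrable_bounded[of _ "real ?n"]) (auto simp: indicator_def jumpfun_bounded)
    have iJ': "integrable M (\<lambda>\<omega>. indicator ?A \<omega> * ?J' \<omega>)"
      by (rule integrable_bounded[of _ K]) (use K in \<open>auto simp: indicator_def jumpfun_bounded\<close>)
    have "?A \<in> events" by simp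
    then have iA: "integrable M (indicator ?A :: 'a \<Rightarrow> real)"
      by (intro integrable_bounded[of _ 1] borel_measurable_indicator) (auto simp: indicator_def)
    have cm: "cluster_mean \<rho> (\<zeta> * x) ?n k (\<epsilon> * x) = (\<integral>\<omega>. indicator ?A \<omega> * ?J \<omega> \<partial>M)"
      unfolding cluster_mean_def by (rule Bochner_Integration.integral_cong) (auto simp: indicator_def)
    have "\<bar>cluster_mean \<rho> (\<zeta> * x) ?n k (\<epsilon> * x) - x * (\<integral>\<omega>. indicator ?A \<omega> * ?J' \<omega> \<partial>M)\<bar>
      = \<bar>\<integral>\<omega>. indicator ?A \<omega> * ?J \<omega> - x * (indicator ?A \<omega> * ?J' \<omega>) \<partial>M\<bar>"
      using iJ iJ' by (simp add: cm)
    also have "\<dots> \<le> (\<integral>\<omega>. \<bar>indicator ?A \<omega> * ?J \<omega> - x * (indicator ?A \<omega> * ?J' \<omega>)\<bar> \<partial>M)"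
      by (rule integral_abs_bound)
    also have "\<dots> \<le> (\<integral>\<omega>. 2 * indicator ?A \<omega> \<partial>M)"
    proof (intro integral_mono integrable_abs Bochner_Integration.integrable_diff integrable_mult_right iJ iJ')
      fix \<omega>
      have "\<bar>?J \<omega> - x * ?J' \<omega>\<bar> \<le> 2 * \<bar>real ?n - x * K\<bar>" unfolding J' by (rule jumpfun_horizon)
      then show "\<bar>indicator ?A \<omega> * ?J \<omega> - x * (indicator ?A \<omega> * ?J' \<omega>)\<bar> \<le> 2 * indicator ?A \<omega>"
        using nK(2) by (auto simp: indicator_def)
    qed (rule iA)
    also have "\<dots> = 2 * p (\<epsilon> * x)" by (simp add: p_def)
    finally have 2: "\<bar>cluster_mean \<rho> (\<zeta> * x) ?n k (\<epsilon> * x) - x * p x * f x\<bar> \<le> 2 * p (\<epsilon> * x)"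
      using p_pos[of x] by (simp add: f_def)
    have 3: "2 * real ?n * recurrence k ?n (\<epsilon> * x) \<le> 2 * (K * x) * (\<eta> * p x)"
      using nK(1) elim K x by (intro mult_mono mult_left_mono) (auto simp: recurrence_def)
    have "\<bar>?P - x * p x * f x\<bar> \<le> (3 * real k + 3) * p (\<epsilon> * x) + 2 * (K * x) * (\<eta> * p x)"
    proof -
      have "(3 * real k + 3) * p (\<epsilon> * x) = (3 * real k + 1) * p (\<epsilon> * x) + 2 * p (\<epsilon> * x)"
        by (simp add: algebra_simps)
      then show ?thesis using 1 2 3 by linarith
    qed
    then have "\<bar>?P - x * p x * f x\<bar> / (x * p x) \<le> ((3 * real k + 3) * p (\<epsilon> * x) + 2 * (K * x) * (\<eta> * p x)) / (x * p x)"
      using xp by (intro divide_right_mono) auto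
    also have "\<dots> = (3 * real k + 3) * (p (\<epsilon> * x) / p x) * inverse x + 2 * K * \<eta>"
      using x p_pos[of x] by (simp add: field_simps)
    also have "\<bar>?P - x * p x * f x\<bar> / (x * p x) = \<bar>?P / (x * p x) - f x\<bar>"
    proof -
      have "?P / (x * p x) - f x = (?P - x * p x * f x) / (x * p x)"
        using x p_pos[of x] by (simp add: field_simps)
      then show ?thesis using xp by (simp add: abs_divide)
    qed
    finally show ?case using elim(1) by (simp add: algebra_simps)
  qed
qed

end

section \<open>Late overshoots and the ruin probability\<close>

lemma psum_eq_truncated_plus_big:
  "psum X t \<omega> = psum (truncated c X) t \<omega> + (\<Sum>i=1..t. big c (X (int i) \<omega>))"
  unfolding psum_def sum.distrib[symmetric]
  by (rule sum.cong) (auto simp: truncated_def big_def)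

lemma dyadic_block:
  assumes "1 \<le> n" "n \<le> (t::nat)"
  shows "\<exists>j. 2 ^ j * n \<le> t \<and> t \<le> 2 ^ Suc j * n"
proof -
  define P where "P j \<longleftrightarrow> t < 2 ^ j * n" for j
  have "t < 2 ^ t" by (rule less_exp)
  also have "(2::nat) ^ t \<le> 2 ^ t * n" using assms by simp
  finally have "P t" by (simp add: P_def)
  define j where "j = (LEAST j. P j)"
  have Pj: "P j" unfolding j_def by (rule LeastI[of P t]) fact
  have "j \<noteq> 0" using Pj assms by (auto simp: P_def intro: gr0I)
  then obtain i where i: "j = Suc i" by (cases j) auto
  have "\<not> P i" using not_less_Least[of i P] i by (simp add: j_def)
  then show ?thesis using Pj i by (intro exI[of _ i]) (auto simp: P_def)
qed

context ruin
begin

lemma psum_measurable [measurable]: "psum X t \<in> borel_measurable M"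
  unfolding psum_def[abs_def] by measurable

lemma psum_truncated_measurable [measurable]: "psum (truncated c X) t \<in> borel_measurable M"
  unfolding psum_def[abs_def] truncated_def by measurable

text \<open>Either some |X_i| with i \<le> m exceeds \<epsilon> m, which has probability at most m p
  (\<epsilon> m), or the sums agree with the truncated ones. The level is \<rho> / 2 because in a
  dyadic block the drift is at least half of its value at the right end.\<close>

lemma psum_block_bound:
  "\<exists>C>0. \<forall>\<^sub>F m in sequentially. \<P>(\<omega> in M. \<exists>t\<in>{0..m}. \<rho> / 2 * real m < \<bar>psum X t \<omega>\<bar>) \<le> C * (real m * p (real m))"
proof -
  obtain \<epsilon>0 where \<epsilon>0: "0 < \<epsilon>0" "\<And>\<epsilon>. 0 < \<epsilon> \<Longrightarrow> \<epsilon> < \<epsilon>0 \<Longrightarrow> (\<forall>\<^sub>F n in sequentially. \<forall>x\<in>{1 / 2 * real n..2 * real n}.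
    \<P>(\<omega> in M. \<exists>t\<in>{0..n}. \<rho> / 2 * x < \<bar>psum (truncated (\<epsilon> * x) X) t \<omega>\<bar>) \<le> 1 * (real n * p x))"
    using vanishing_sequence[of "1 / 2" 2 "\<rho> / 2" 1] \<rho> by auto
  define \<epsilon> where "\<epsilon> = \<epsilon>0 / 2"
  have \<epsilon>: "0 < \<epsilon>" "\<epsilon> < \<epsilon>0" using \<epsilon>0(1) by (auto simp: \<epsilon>_def)
  have "\<forall>\<^sub>F m in sequentially. p (\<epsilon> * real m) \<le> 2 * \<epsilon> powr - \<alpha> * p (real m)"
    by (rule eventually_compose_filterlim[OF p_le[OF \<epsilon>(1)] filterlim_real_sequentially])
  with \<epsilon>0(2)[OF \<epsilon>]
  have "\<forall>\<^sub>F m in sequentially. \<P>(\<omega> in M. \<exists>t\<in>{0..m}. \<rho> / 2 * real m < \<bar>psum X t \<omega>\<bar>)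
    \<le> (1 + 2 * \<epsilon> powr - \<alpha>) * (real m * p (real m))"
  proof eventually_elim
    case (elim m)
    let ?c = "\<epsilon> * real m"
    have "\<P>(\<omega> in M. \<exists>t\<in>{0..m}. \<rho> / 2 * real m < \<bar>psum X t \<omega>\<bar>)
      \<le> prob ({\<omega> \<in> space M. \<exists>t\<in>{0..m}. \<rho> / 2 * real m < \<bar>psum (truncated ?c X) t \<omega>\<bar>}
          \<union> (\<Union>i\<in>{1..m}. {\<omega> \<in> space M. ?c < \<bar>X (int i) \<omega>\<bar>}))"
    proof (rule finite_measure_mono)
      show "{\<omega> \<in> space M. \<exists>t\<in>{0..m}. \<rho> / 2 * real m < \<bar>psum X t \<omega>\<bar>}
        \<subseteq> {\<omega> \<in> space M. \<exists>t\<in>{0..m}. \<rho> / 2 * real m < \<bar>psum (truncated ?c X) t \<omega>\<bar>}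
          \<union> (\<Union>i\<in>{1..m}. {\<omega> \<in> space M. ?c < \<bar>X (int i) \<omega>\<bar>})"
      proof
        fix \<omega> assume \<omega>: "\<omega> \<in> {\<omega> \<in> space M. \<exists>t\<in>{0..m}. \<rho> / 2 * real m < \<bar>psum X t \<omega>\<bar>}"
        show "\<omega> \<in> {\<omega> \<in> space M. \<exists>t\<in>{0..m}. \<rho> / 2 * real m < \<bar>psum (truncated ?c X) t \<omega>\<bar>}
          \<union> (\<Union>i\<in>{1..m}. {\<omega> \<in> space M. ?c < \<bar>X (int i) \<omega>\<bar>})"
        proof (cases "\<exists>i\<in>{1..m}. ?c < \<bar>X (int i) \<omega>\<bar>")
          case True then show ?thesis using \<omega> by auto
        next
          case False
          then have "psum X t \<omega> = psum (truncated ?c X) t \<omega>" if "t \<le> m" for t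
            unfolding psum_eq_truncated_plus_big[of X t \<omega> ?c] using that by (auto simp: big_def)
          then show ?thesis using \<omega> by auto
        qed
      qed
    qed measurable
    also have "\<dots> \<le> \<P>(\<omega> in M. \<exists>t\<in>{0..m}. \<rho> / 2 * real m < \<bar>psum (truncated ?c X) t \<omega>\<bar>)
        + prob (\<Union>i\<in>{1..m}. {\<omega> \<in> space M. ?c < \<bar>X (int i) \<omega>\<bar>})"
      by (rule measure_Un_le) measurable
    also have "prob (\<Union>i\<in>{1..m}. {\<omega> \<in> space M. ?c < \<bar>X (int i) \<omega>\<bar>}) \<le> (\<Sum>i\<in>{1..m}. p ?c)"
      by (rule order.trans[OF finite_measure_subadditive_finite]) (auto simp: p_shift)
    also have "(\<Sum>i\<in>{1..m}. p ?c) = real m * p ?c" by simp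
    also have "\<P>(\<omega> in M. \<exists>t\<in>{0..m}. \<rho> / 2 * real m < \<bar>psum (truncated ?c X) t \<omega>\<bar>) \<le> real m * p (real m)"
      using elim(1) by auto
    also have "real m * p ?c \<le> real m * (2 * \<epsilon> powr - \<alpha> * p (real m))"
      using elim(2) by (intro mult_left_mono) auto
    finally show ?case by (simp add: algebra_simps)
  qed
  moreover have "0 < 1 + 2 * \<epsilon> powr - \<alpha>" by (simp add: add_pos_nonneg)
  ultimately show ?thesis by blast
qed

text \<open>Since \<alpha> > 1, a number q fits strictly between 2^-\<alpha> and 1/2, and eventually
  each doubling of the level multiplies \<open>p\<close> by at most q. As 2 q < 1, the quantities m
  p m are summable along dyadic blocks.\<close>

lemma p_geometric:
  "\<exists>q y0. 0 < q \<and> q < 1 / 2 \<and> (\<forall>y\<ge>y0. \<forall>j. p (2 ^ j * y) \<le> q ^ j * p y)"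
proof -
  define q where "q = (2 powr - \<alpha> + 1 / 2) / 2"
  have a: "(2::real) powr - \<alpha> < 1 / 2"
    using powr_less_mono[of "- \<alpha>" "- 1" "2::real"] alpha by (simp add: powr_minus)
  then have q: "0 < q" "q < 1 / 2" "2 powr - \<alpha> < q" by (auto simp: q_def add_pos_pos)
  have "\<forall>\<^sub>F y in at_top. p (2 * y) / p y < q"
    by (rule order_tendstoD(2)[OF p_regular]) (use q in auto)
  then obtain y1 where y1: "\<And>y. y1 \<le> y \<Longrightarrow> p (2 * y) / p y < q"
    by (auto simp: eventually_at_top_linorder)
  have step: "p (2 * y) \<le> q * p y" if "y1 \<le> y" for y
    using y1[OF that] p_pos[of y] by (simp add: pos_divide_less_eq)
  have "p (2 ^ j * y) \<le> q ^ j * p y" if y: "max 0 y1 \<le> y" for y j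
  proof (induction j)
    case (Suc j)
    have "1 * y \<le> 2 ^ j * y" by (rule mult_right_mono) (use y in auto)
    then have "p (2 * (2 ^ j * y)) \<le> q * p (2 ^ j * y)" by (intro step) (use y in auto)
    also have "\<dots> \<le> q * (q ^ j * p y)" using Suc q by (intro mult_left_mono) auto
    finally show ?case by (simp add: mult.assoc)
  qed simp
  then show ?thesis using q by blast
qed

text \<open>The block bounds sum geometrically to a multiple of n p n with n = floor (K x), and
  regular variation turns this into K^(1-\<alpha>) x p x. The constant is chosen before K; only the
  range of x depends on K.\<close>

lemma late_overshoot:
  "\<exists>C>0. \<forall>K>0. \<forall>\<^sub>F x in at_top.
     \<P>(\<omega> in M. \<exists>t>nat \<lfloor>K * x\<rfloor>. x < psum X t \<omega> - \<rho> * real t) \<le> C * K powr (1 - \<alpha>) * (x * p x)"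
proof -
  obtain C where C: "0 < C" and ev: "\<forall>\<^sub>F m in sequentially.
    \<P>(\<omega> in M. \<exists>t\<in>{0..m}. \<rho> / 2 * real m < \<bar>psum X t \<omega>\<bar>) \<le> C * (real m * p (real m))"
    using psum_block_bound by blast
  then obtain m0 where m0: "\<And>m. m0 \<le> m \<Longrightarrow>
    \<P>(\<omega> in M. \<exists>t\<in>{0..m}. \<rho> / 2 * real m < \<bar>psum X t \<omega>\<bar>) \<le> C * (real m * p (real m))"
    unfolding eventually_sequentially by blast
  obtain q y0 where q: "0 < q" "q < 1 / 2" and geo: "\<And>y j. y0 \<le> y \<Longrightarrow> p (2 ^ j * y) \<le> q ^ j * p y"
    using p_geometric by blast
  define D where "D = C / (1 - 2 * q)"
  have D: "0 < D" using C q by (simp add: D_def)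
  have late: "\<P>(\<omega> in M. \<exists>t>n. \<rho> * real t < psum X t \<omega>) \<le> D * (real n * p (real n))"
    if n: "1 \<le> n" "m0 \<le> n" "y0 \<le> real n" for n
  proof -
    let ?A = "\<lambda>j::nat. {\<omega> \<in> space M. \<exists>t\<in>{0..2 ^ Suc j * n}. \<rho> / 2 * real (2 ^ Suc j * n) < \<bar>psum X t \<omega>\<bar>}"
    have A: "prob (?A j) \<le> C * (real n * p (real n)) * (2 * q) ^ j" for j
    proof -
      have "n \<le> 2 ^ Suc j * n" by simp
      then have "prob (?A j) \<le> C * (real (2 ^ Suc j * n) * p (real (2 ^ Suc j * n)))"
        using n(2) by (intro m0) linarith
      also have "real (2 ^ Suc j * n) = 2 ^ Suc j * real n" by simp
      also have "C * (2 ^ Suc j * real n * p (2 ^ Suc j * real n)) \<le> C * (2 ^ Suc j * real n * (q ^ Suc j * p (real n)))"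
        by (intro mult_left_mono geo n(3)) (use C in auto)
      also have "\<dots> = C * (real n * p (real n)) * ((2 * q) * (2 * q) ^ j)"
        by (simp add: power_mult_distrib algebra_simps)
      also have "\<dots> \<le> C * (real n * p (real n)) * (1 * (2 * q) ^ j)"
        using C q p_pos[of "real n"] by (intro mult_left_mono mult_right_mono) auto
      finally show ?thesis by simp
    qed
    have geom: "summable (\<lambda>j. C * (real n * p (real n)) * (2 * q) ^ j)"
      using q by (intro summable_mult summable_geometric) simp
    have sA: "summable (\<lambda>j. prob (?A j))"
      by (rule summable_comparison_test'[OF geom, of 0]) (use A in auto)
    have "\<P>(\<omega> in M. \<exists>t>n. \<rho> * real t < psum X t \<omega>) \<le> prob (\<Union>j. ?A j)"
    proof (rule finite_measure_mono)
      show "{\<omega> \<in> space M. \<exists>t>n. \<rho> * real t < psum X t \<omega>} \<subseteq> (\<Union>j. ?A j)"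
      proof safe
        fix \<omega> t assume \<omega>: "\<omega> \<in> space M" and t: "n < t" "\<rho> * real t < psum X t \<omega>"
        obtain j where j: "2 ^ j * n \<le> t" "t \<le> 2 ^ Suc j * n" using dyadic_block[OF n(1), of t] t by auto
        have "real (2 ^ j * n) \<le> real t" using j(1) by (rule of_nat_mono)
        then have "\<rho> * real (2 ^ j * n) \<le> \<rho> * real t" using \<rho> by (intro mult_left_mono) auto
        then have "\<rho> / 2 * real (2 ^ Suc j * n) < \<bar>psum X t \<omega>\<bar>" using t by simp
        then show "\<omega> \<in> (\<Union>j. ?A j)" using \<omega> j(2) by (intro UN_I[of j]) auto
      qed
    qed measurable
    also have "\<dots> \<le> (\<Sum>j. prob (?A j))"
    proof (rule finite_measure_subadditive_countably[OF _ sA])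
      have "?A j \<in> events" for j by measurable
      then show "range ?A \<subseteq> events" by blast
    qed
    also have "\<dots> \<le> (\<Sum>j. C * (real n * p (real n)) * (2 * q) ^ j)" by (rule suminf_le[OF A sA geom])
    also have "\<dots> = C * (real n * p (real n)) * (1 / (1 - 2 * q))"
      using q by (subst suminf_mult) (auto simp: suminf_geometric intro!: summable_geometric)
    finally show ?thesis by (simp add: D_def)
  qed
  have "\<forall>\<^sub>F x in at_top. \<P>(\<omega> in M. \<exists>t>nat \<lfloor>K * x\<rfloor>. x < psum X t \<omega> - \<rho> * real t)
      \<le> D * 2 * (1 / 2) powr - \<alpha> * K powr (1 - \<alpha>) * (x * p x)" if K: "0 < K" for K
  proof -
    have "\<forall>\<^sub>F n in sequentially. 1 \<le> n \<and> m0 \<le> n \<and> y0 \<le> real n"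
      by (intro eventually_conj eventually_ge_at_top eventually_compose_filterlim[OF eventually_ge_at_top filterlim_real_sequentially])
    then have "\<forall>\<^sub>F x in at_top. 1 \<le> nat \<lfloor>K * x\<rfloor> \<and> m0 \<le> nat \<lfloor>K * x\<rfloor> \<and> y0 \<le> real (nat \<lfloor>K * x\<rfloor>)"
      by (rule eventually_compose_filterlim[OF _ filterlim_nat_floor[OF K]])
    moreover have "\<forall>\<^sub>F x in at_top. p (K / 2 * x) \<le> 2 * (K / 2) powr - \<alpha> * p x" by (rule p_le) (use K in simp)
    ultimately show ?thesis using eventually_gt_at_top[of 0]
    proof eventually_elim
      case (elim x)
      let ?n = "nat \<lfloor>K * x\<rfloor>"
      have n: "1 \<le> ?n" using elim by simp
      \<comment> \<open>The level x > 0 is discarded: at late times the drift alone is a sufficient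
        obstacle.\<close>
      have "\<P>(\<omega> in M. \<exists>t>?n. x < psum X t \<omega> - \<rho> * real t) \<le> \<P>(\<omega> in M. \<exists>t>?n. \<rho> * real t < psum X t \<omega>)"
        by (rule finite_measure_mono) (use elim in \<open>auto intro!: exI\<close>)
      also have "\<dots> \<le> D * (real ?n * p (real ?n))" by (rule late) (use elim in auto)
      also have "\<dots> \<le> D * (K * x * (2 * (K / 2) powr - \<alpha> * p x))"
      proof (intro mult_left_mono mult_mono)
        have "p (real ?n) \<le> p (K / 2 * x)" by (rule p_antimono) (use nat_floor_window(4)[OF K n] in simp)
        then show "p (real ?n) \<le> 2 * (K / 2) powr - \<alpha> * p x" using elim by linarith
        show "0 \<le> p (real ?n)" using p_pos less_imp_le by blast
      qed (use D K elim nat_floor_window(2)[OF K n] in auto)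
      also have "(K / 2) powr - \<alpha> = K powr - \<alpha> * (1 / 2) powr - \<alpha>"
        using powr_mult[of K "1 / 2" "- \<alpha>"] K by simp
      also have "D * (K * x * (2 * (K powr - \<alpha> * (1 / 2) powr - \<alpha>) * p x))
        = D * 2 * (1 / 2) powr - \<alpha> * (K powr 1 * K powr - \<alpha>) * (x * p x)"
        using K by (simp add: algebra_simps)
      also have "K powr 1 * K powr - \<alpha> = K powr (1 - \<alpha>)" by (subst powr_add[symmetric]) simp
      finally show ?case .
    qed
  qed
  moreover have "0 < D * 2 * (1 / 2) powr - \<alpha>" using D by simp
  ultimately show ?thesis by blast
qed

section \<open>The ruin probability between two cluster limits\<close>

definition ruin_prob :: "real \<Rightarrow> real" where
  "ruin_prob x = \<P>(\<omega> in M. \<exists>t. x < psum X t \<omega> - \<rho> * real t)"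

text \<open>Outside the event of probability S, the sums up to n and those of the large values
  differ by at most \<delta> x, which shifts the level from x to (1 - \<delta>) x or (1 + \<delta>)
  x. Late times enter only the upper bound.\<close>

lemma ruin_prob_sandwich:
  fixes \<epsilon> \<delta> :: real and n :: nat
  assumes x: "0 < x"
  defines "V \<equiv> \<lambda>z. \<P>(\<omega> in M. overshoot \<rho> z (\<lambda>i. big (\<epsilon> * x) (X (int i) \<omega>)) n 1)"
    and "S \<equiv> \<P>(\<omega> in M. \<exists>t\<in>{0..n}. \<delta> * x < \<bar>psum (truncated (\<epsilon> * x) X) t \<omega>\<bar>)"
    and "T \<equiv> \<P>(\<omega> in M. \<exists>t>n. x < psum X t \<omega> - \<rho> * real t)"
  shows "ruin_prob x \<le> V ((1 - \<delta>) * x) + S + T" "V ((1 + \<delta>) * x) \<le> ruin_prob x + S"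
proof -
  let ?b = "\<lambda>\<omega> i. big (\<epsilon> * x) (X (int i) \<omega>)"
  let ?O = "\<lambda>z. {\<omega> \<in> space M. overshoot \<rho> z (?b \<omega>) n 1}"
  let ?S = "{\<omega> \<in> space M. \<exists>t\<in>{0..n}. \<delta> * x < \<bar>psum (truncated (\<epsilon> * x) X) t \<omega>\<bar>}"
  let ?T = "{\<omega> \<in> space M. \<exists>t>n. x < psum X t \<omega> - \<rho> * real t}"
  let ?R = "{\<omega> \<in> space M. \<exists>t. x < psum X t \<omega> - \<rho> * real t}"
  note split = psum_eq_truncated_plus_big[of X _ _ "\<epsilon> * x"]
  have "?R \<subseteq> (?O ((1 - \<delta>) * x) \<union> ?S) \<union> ?T"
  proof safe
    fix \<omega> t
    assume \<omega>: "\<omega> \<in> space M" and t: "x < psum X t \<omega> - \<rho> * real t"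
      and nT: "\<not> (\<exists>t>n. x < psum X t \<omega> - \<rho> * real t)"
      and nS: "\<not> (\<exists>t\<in>{0..n}. \<delta> * x < \<bar>psum (truncated (\<epsilon> * x) X) t \<omega>\<bar>)"
    have tn: "t \<le> n" using t nT not_le by blast
    \<comment> \<open>Overshoot times start at 1, while t = 0 gives the value 0 < x.\<close>
    have "t \<noteq> 0"
    proof
      assume "t = 0"
      then show False using t x by (simp add: psum_def)
    qed
    have "\<bar>psum (truncated (\<epsilon> * x) X) t \<omega>\<bar> \<le> \<delta> * x" using nS tn by (auto simp: not_less)
    then have "(1 - \<delta>) * x < (\<Sum>i=1..t. ?b \<omega> i) - \<rho> * real t"
      using t unfolding split[of t \<omega>] by (simp add: algebra_simps abs_le_iff)
    then show "overshoot \<rho> ((1 - \<delta>) * x) (?b \<omega>) n 1"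
      unfolding overshoot_def using tn \<open>t \<noteq> 0\<close> by (intro bexI[of _ t]) auto
  qed
  then have "ruin_prob x \<le> prob ((?O ((1 - \<delta>) * x) \<union> ?S) \<union> ?T)"
    unfolding ruin_prob_def by (rule finite_measure_mono) measurable
  also have "\<dots> \<le> prob (?O ((1 - \<delta>) * x) \<union> ?S) + prob ?T"
    by (rule measure_Un_le) measurable
  also have "prob (?O ((1 - \<delta>) * x) \<union> ?S) \<le> prob (?O ((1 - \<delta>) * x)) + prob ?S"
    by (rule measure_Un_le) measurable
  finally show "ruin_prob x \<le> V ((1 - \<delta>) * x) + S + T" by (simp add: V_def S_def T_def)
  have "?O ((1 + \<delta>) * x) \<subseteq> ?R \<union> ?S"
  proof safe
    fix \<omega>
    assume \<omega>: "\<omega> \<in> space M" and o: "overshoot \<rho> ((1 + \<delta>) * x) (?b \<omega>) n 1"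
      and nS: "\<not> (\<exists>t\<in>{0..n}. \<delta> * x < \<bar>psum (truncated (\<epsilon> * x) X) t \<omega>\<bar>)"
    obtain t where t: "t \<le> n" "(1 + \<delta>) * x < (\<Sum>i=1..t. ?b \<omega> i) - \<rho> * real t"
      using o by (auto simp: overshoot_def)
    have "\<bar>psum (truncated (\<epsilon> * x) X) t \<omega>\<bar> \<le> \<delta> * x" using nS t by (auto simp: not_less)
    then have "x < psum X t \<omega> - \<rho> * real t"
      using t(2) unfolding split[of t \<omega>] by (simp add: algebra_simps abs_le_iff)
    then show "\<exists>t. x < psum X t \<omega> - \<rho> * real t" ..
  qed
  then have "V ((1 + \<delta>) * x) \<le> prob (?R \<union> ?S)"
    unfolding V_def by (rule finite_measure_mono) measurable
  also have "\<dots> \<le> prob ?R + prob ?S" by (rule measure_Un_le) measurable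
  finally show "V ((1 + \<delta>) * x) \<le> ruin_prob x + S" by (simp add: ruin_prob_def S_def)
qed

text \<open>One \<eta> pays for the small values and one for \<open>overshoot_limit\<close>; L pays
  for late times. Forcing \<epsilon> < \<eta> and k > 1/\<eta> makes both parameters converge once
  \<eta> tends to 0.\<close>

lemma ruin_prob_near_jump_limit:
  assumes K: "0 < K" and \<delta>: "0 < \<delta>" "\<delta> < 1" and \<eta>: "0 < \<eta>"
    and late: "\<forall>\<^sub>F x in at_top. \<P>(\<omega> in M. \<exists>t>nat \<lfloor>K * x\<rfloor>. x < psum X t \<omega> - \<rho> * real t) \<le> L * (x * p x)"
  shows "\<exists>\<epsilon> k. 0 < \<epsilon> \<and> \<epsilon> < \<eta> \<and> 1 / \<eta> < real k \<and> (\<forall>\<^sub>F x in at_top.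
     jump_limit \<rho> (1 + \<delta>) K k \<epsilon> - 2 * \<eta> \<le> ruin_prob x / (x * p x) \<and>
     ruin_prob x / (x * p x) \<le> jump_limit \<rho> (1 - \<delta>) K k \<epsilon> + 2 * \<eta> + L)"
proof -
  obtain \<epsilon>0 where \<epsilon>0: "0 < \<epsilon>0" "\<And>\<epsilon>. 0 < \<epsilon> \<Longrightarrow> \<epsilon> < \<epsilon>0 \<Longrightarrow> (\<forall>\<^sub>F x in at_top.
    \<P>(\<omega> in M. \<exists>t\<in>{0..nat \<lfloor>K * x\<rfloor>}. \<delta> * x < \<bar>psum (truncated (\<epsilon> * x) X) t \<omega>\<bar>) \<le> \<eta> * (x * p x))"
    using vanishing_small[OF K \<delta>(1) \<eta>] by blast
  define \<epsilon> where "\<epsilon> = min \<epsilon>0 \<eta> / 2"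
  have \<epsilon>: "0 < \<epsilon>" "\<epsilon> < \<epsilon>0" "\<epsilon> < \<eta>" using \<epsilon>0(1) \<eta> by (auto simp: \<epsilon>_def min_def)
  \<comment> \<open>Chosen so that the error (2 K + 1) \<eta>' of \<open>overshoot_limit\<close> is
    exactly \<eta>.\<close>
  define \<eta>' where "\<eta>' = \<eta> / (2 * K + 1)"
  have \<eta>': "0 < \<eta>'" "(2 * K + 1) * \<eta>' = \<eta>" using \<eta> K by (auto simp: \<eta>'_def)
  obtain k0 where k0: "\<And>k. k0 \<le> k \<Longrightarrow> \<forall>\<^sub>F x in at_top. recurrence k (nat \<lfloor>K * x\<rfloor>) (\<epsilon> * x) \<le> \<eta>' * p x"
    using recurrence_small[OF K \<epsilon>(1) \<eta>'(1)] by blast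
  define k where "k = max k0 (max 1 (Suc (nat \<lceil>1 / \<eta>\<rceil>)))"
  have k: "k0 \<le> k" "1 \<le> k" "1 / \<eta> < real k"
  proof -
    have "1 / \<eta> \<le> real (nat \<lceil>1 / \<eta>\<rceil>)" by (rule real_nat_ceiling_ge)
    also have "\<dots> < real (Suc (nat \<lceil>1 / \<eta>\<rceil>))" by simp
    also have "\<dots> \<le> real k" unfolding k_def by simp
    finally show "1 / \<eta> < real k" .
  qed (auto simp: k_def)
  have up: "\<forall>\<^sub>F x in at_top. \<bar>\<P>(\<omega> in M. overshoot \<rho> ((1 - \<delta>) * x) (\<lambda>i. big (\<epsilon> * x) (X (int i) \<omega>)) (nat \<lfloor>K * x\<rfloor>) 1) / (x * p x)
     - jump_limit \<rho> (1 - \<delta>) K k \<epsilon>\<bar> \<le> (2 * K + 1) * \<eta>'"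
    by (rule overshoot_limit[OF K \<epsilon>(1) \<eta>'(1) _ k(2) k0[OF k(1)]]) (use \<delta> in simp)
  have lo: "\<forall>\<^sub>F x in at_top. \<bar>\<P>(\<omega> in M. overshoot \<rho> ((1 + \<delta>) * x) (\<lambda>i. big (\<epsilon> * x) (X (int i) \<omega>)) (nat \<lfloor>K * x\<rfloor>) 1) / (x * p x)
     - jump_limit \<rho> (1 + \<delta>) K k \<epsilon>\<bar> \<le> (2 * K + 1) * \<eta>'"
    by (rule overshoot_limit[OF K \<epsilon>(1) \<eta>'(1) _ k(2) k0[OF k(1)]]) (use \<delta> in simp)
  have "\<forall>\<^sub>F x in at_top.
     jump_limit \<rho> (1 + \<delta>) K k \<epsilon> - 2 * \<eta> \<le> ruin_prob x / (x * p x) \<and>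
     ruin_prob x / (x * p x) \<le> jump_limit \<rho> (1 - \<delta>) K k \<epsilon> + 2 * \<eta> + L"
    using up lo \<epsilon>0(2)[OF \<epsilon>(1,2)] late eventually_gt_at_top[of 0]
  proof eventually_elim
    case (elim x)
    have xp: "0 < x * p x" using elim p_pos by simp
    let ?O = "\<lambda>z. \<P>(\<omega> in M. overshoot \<rho> z (\<lambda>i. big (\<epsilon> * x) (X (int i) \<omega>)) (nat \<lfloor>K * x\<rfloor>) 1)"
    let ?S = "\<P>(\<omega> in M. \<exists>t\<in>{0..nat \<lfloor>K * x\<rfloor>}. \<delta> * x < \<bar>psum (truncated (\<epsilon> * x) X) t \<omega>\<bar>)"
    let ?T = "\<P>(\<omega> in M. \<exists>t>nat \<lfloor>K * x\<rfloor>. x < psum X t \<omega> - \<rho> * real t)"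
    note sand = ruin_prob_sandwich[OF elim(5), where \<epsilon>=\<epsilon> and n="nat \<lfloor>K * x\<rfloor>" and \<delta>=\<delta>]
    have S: "?S / (x * p x) \<le> \<eta>" and T: "?T / (x * p x) \<le> L"
      using elim xp by (simp_all add: pos_divide_le_eq)
    have up: "r \<le> j + 2 * e + l" if "r \<le> v + s + w" "\<bar>v - j\<bar> \<le> e" "s \<le> e" "w \<le> l" for r j e l v s w :: real
      using that by linarith
    have lo: "j - 2 * e \<le> r" if "v \<le> r + s" "\<bar>v - j\<bar> \<le> e" "s \<le> e" for r j e v s :: real
      using that by linarith
    have "ruin_prob x / (x * p x) \<le> (?O ((1 - \<delta>) * x) + ?S + ?T) / (x * p x)"
      by (rule divide_right_mono[OF sand(1)]) (use xp in simp)
    then have "ruin_prob x / (x * p x) \<le> jump_limit \<rho> (1 - \<delta>) K k \<epsilon> + 2 * \<eta> + L"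
      unfolding add_divide_distrib by (rule up[OF _ elim(1)[unfolded \<eta>'(2)] S T])
    moreover have "?O ((1 + \<delta>) * x) / (x * p x) \<le> (ruin_prob x + ?S) / (x * p x)"
      by (rule divide_right_mono[OF sand(2)]) (use xp in simp)
    then have "jump_limit \<rho> (1 + \<delta>) K k \<epsilon> - 2 * \<eta> \<le> ruin_prob x / (x * p x)"
      unfolding add_divide_distrib by (rule lo[OF _ elim(2)[unfolded \<eta>'(2)] S])
    ultimately show ?case by blast
  qed
  then show ?thesis using \<epsilon> k by blast
qed

text \<open>For each m the ruin ratio is eventually between two numbers that depend on m alone, and
  both sequences of numbers tend to the claimed limit.\<close>

lemma ruin_prob_limit:
  assumes m: "(\<integral>\<^sup>+ \<omega>. ennreal_powr (abs_sum \<omega>) (\<alpha> - 1) \<partial>N) < \<infinity>"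
  shows "((\<lambda>x. ruin_prob x / (x * p x)) \<longlongrightarrow>
    (\<integral>\<omega>. max 0 (SUP t::nat. \<Sum>i=0..t. \<Theta> (int i) \<omega>) powr \<alpha> - peak \<omega> powr \<alpha> \<partial>N) / ((\<alpha> - 1) * \<rho>)) at_top"
    (is "(_ \<longlongrightarrow> ?L) _")
proof -
  obtain C where C: "0 < C" and late: "\<And>K. 0 < K \<Longrightarrow> \<forall>\<^sub>F x in at_top.
     \<P>(\<omega> in M. \<exists>t>nat \<lfloor>K * x\<rfloor>. x < psum X t \<omega> - \<rho> * real t) \<le> C * K powr (1 - \<alpha>) * (x * p x)"
    using late_overshoot by blast
  define K where "K m = real (Suc m)" for m
  \<comment> \<open>The shift by 2 gives \<delta> m \<le> 1/2, so the levels 1 - \<delta> m stay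
    above the threshold of \<open>envelope\<close>.\<close>
  define \<delta> where "\<delta> m = 1 / real (m + 2)" for m
  define \<eta> where "\<eta> m = 1 / real (Suc m)" for m
  have K: "0 < K m" and \<delta>: "0 < \<delta> m" "\<delta> m \<le> 1 / 2" and \<eta>: "0 < \<eta> m" for m
    by (auto simp: K_def \<delta>_def \<eta>_def field_simps)
  have \<delta>1: "\<delta> m < 1" for m using \<delta>(2)[of m] by linarith
  define Q where "Q m \<epsilon> k \<longleftrightarrow> 0 < \<epsilon> \<and> \<epsilon> < \<eta> m \<and> 1 / \<eta> m < real k \<and> (\<forall>\<^sub>F x in at_top.
     jump_limit \<rho> (1 + \<delta> m) (K m) k \<epsilon> - 2 * \<eta> m \<le> ruin_prob x / (x * p x) \<and>
     ruin_prob x / (x * p x) \<le> jump_limit \<rho> (1 - \<delta> m) (K m) k \<epsilon> + 2 * \<eta> m + C * K m powr (1 - \<alpha>))" for m \<epsilon> k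
  have "\<exists>\<epsilon> k. Q m \<epsilon> k" for m
    unfolding Q_def by (rule ruin_prob_near_jump_limit[OF K \<delta>(1) \<delta>1 \<eta> late[OF K]])
  then obtain \<epsilon> k where "\<And>m. Q m (\<epsilon> m) (k m)" by metis
  then have \<epsilon>: "\<And>m. 0 < \<epsilon> m" "\<And>m. \<epsilon> m < \<eta> m" and k: "\<And>m. 1 / \<eta> m < real (k m)"
    and bound: "\<And>m. \<forall>\<^sub>F x in at_top.
     jump_limit \<rho> (1 + \<delta> m) (K m) (k m) (\<epsilon> m) - 2 * \<eta> m \<le> ruin_prob x / (x * p x) \<and>
     ruin_prob x / (x * p x) \<le> jump_limit \<rho> (1 - \<delta> m) (K m) (k m) (\<epsilon> m) + 2 * \<eta> m + C * K m powr (1 - \<alpha>)"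
    unfolding Q_def by blast+
  have \<eta>0: "\<eta> \<longlonglongrightarrow> 0" unfolding \<eta>_def by (rule LIMSEQ_Suc[OF lim_1_over_n])
  have \<delta>0: "\<delta> \<longlonglongrightarrow> 0" unfolding \<delta>_def by (rule LIMSEQ_ignore_initial_segment[OF lim_1_over_n])
  have Kinf: "filterlim K at_top sequentially"
    unfolding K_def[abs_def] by (rule filterlim_compose[OF filterlim_real_sequentially filterlim_Suc])
  have kinf: "filterlim k at_top sequentially"
  proof (rule filterlim_at_top_mono[OF filterlim_ident])
    have "m \<le> k m" for m using k[of m] by (simp add: \<eta>_def)
    then show "\<forall>\<^sub>F m in sequentially. m \<le> k m" by simp
  qed
  have \<epsilon>lim: "\<epsilon> \<longlonglongrightarrow> 0"
    by (rule tendsto_sandwich[OF _ _ tendsto_const \<eta>0]) (use \<epsilon> in \<open>auto intro!: always_eventually less_imp_le\<close>)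
  have lo: "(\<lambda>m. jump_limit \<rho> (1 + \<delta> m) (K m) (k m) (\<epsilon> m)) \<longlonglongrightarrow> ?L"
    using tendsto_add[OF tendsto_const \<delta>0, of 1] \<delta> K
    by (intro jump_limit_tendsto[OF m \<rho> _ _ Kinf _ kinf \<epsilon>lim \<epsilon>(1)]) (auto simp: less_imp_le intro: add_increasing2)
  have up: "(\<lambda>m. jump_limit \<rho> (1 - \<delta> m) (K m) (k m) (\<epsilon> m)) \<longlonglongrightarrow> ?L"
  proof (rule jump_limit_tendsto[OF m \<rho> _ _ Kinf _ kinf \<epsilon>lim \<epsilon>(1)])
    show "(\<lambda>m. 1 - \<delta> m) \<longlonglongrightarrow> 1" using tendsto_diff[OF tendsto_const \<delta>0, of 1] by simp
    show "1 / 2 \<le> 1 - \<delta> m" for m using \<delta>(2)[of m] by simp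
    show "0 \<le> K m" for m using K[of m] by simp
  qed
  have Kp: "(\<lambda>m. C * K m powr (1 - \<alpha>)) \<longlonglongrightarrow> C * 0"
    using alpha by (intro tendsto_mult_left tendsto_neg_powr Kinf) simp
  have lo': "(\<lambda>m. jump_limit \<rho> (1 + \<delta> m) (K m) (k m) (\<epsilon> m) - 2 * \<eta> m) \<longlonglongrightarrow> ?L - 2 * 0"
    by (intro tendsto_diff lo tendsto_mult_left \<eta>0)
  have up': "(\<lambda>m. jump_limit \<rho> (1 - \<delta> m) (K m) (k m) (\<epsilon> m) + 2 * \<eta> m + C * K m powr (1 - \<alpha>)) \<longlonglongrightarrow> ?L + 2 * 0 + C * 0"
    by (intro tendsto_add up tendsto_mult_left[of \<eta>] \<eta>0 Kp)
  show ?thesis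
  \<comment> \<open>A single m, chosen once a is given, is enough; no uniformity in m of the bounds
    in x is required.\<close>
  proof (rule order_tendstoI)
    fix a assume "a < ?L"
    then have "\<forall>\<^sub>F m in sequentially. a < jump_limit \<rho> (1 + \<delta> m) (K m) (k m) (\<epsilon> m) - 2 * \<eta> m"
      by (intro order_tendstoD(1)[OF lo']) simp
    then obtain m where "a < jump_limit \<rho> (1 + \<delta> m) (K m) (k m) (\<epsilon> m) - 2 * \<eta> m"
      using eventually_happens'[OF sequentially_bot] by blast
    then show "\<forall>\<^sub>F x in at_top. a < ruin_prob x / (x * p x)"
      using bound[of m] by (auto elim!: eventually_mono)
  next
    fix a assume "?L < a"
    then have "\<forall>\<^sub>F m in sequentially. jump_limit \<rho> (1 - \<delta> m) (K m) (k m) (\<epsilon> m) + 2 * \<eta> m + C * K m powr (1 - \<alpha>) < a"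
      by (intro order_tendstoD(2)[OF up']) simp
    then obtain m where "jump_limit \<rho> (1 - \<delta> m) (K m) (k m) (\<epsilon> m) + 2 * \<eta> m + C * K m powr (1 - \<alpha>) < a"
      using eventually_happens'[OF sequentially_bot] by blast
    then show "\<forall>\<^sub>F x in at_top. ruin_prob x / (x * p x) < a"
      using bound[of m] by (auto elim!: eventually_mono)
  qed
qed

end

theorem theorem4p9:
  fixes M :: "'a measure" and X :: "int \<Rightarrow> 'a \<Rightarrow> real"
    and N :: "'b measure" and Y \<Theta> :: "int \<Rightarrow> 'b \<Rightarrow> real"
    and \<alpha> \<rho> :: real
  assumes "prob_space M"
    and "\<And>t. X t \<in> borel_measurable M"
    and "strictly_stationary M X"
    and "\<alpha> > 1"
    and "regularly_varying_sequence M X \<alpha>"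
    and "integrable M (X 0)" and "(\<integral>\<omega>. X 0 \<omega> \<partial>M) = 0"
    and "tail_process M X \<alpha> N Y"
    and "\<Theta> = spectral_process Y"
    and anticlustering:
      "\<And>C1 C2 \<delta>. 0 < C1 \<Longrightarrow> C1 < C2 \<Longrightarrow> \<delta> > 0 \<Longrightarrow>
         (\<lambda>k::nat. limsup (\<lambda>n::nat. SUP x\<in>{C1 * real n..C2 * real n}.
            ereal (\<P>(\<omega> in M. (MAX i\<in>{k..n}. \<bar>X (int i) \<omega>\<bar>) > x * \<delta> \<bar> \<bar>X 0 \<omega>\<bar> > x * \<delta>))))
         \<longlonglongrightarrow> 0"
    and vanishing_small_values:
      "\<And>C1 C2 \<delta>. 0 < C1 \<Longrightarrow> C1 < C2 \<Longrightarrow> \<delta> > 0 \<Longrightarrow>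
         ((\<lambda>\<epsilon>. limsup (\<lambda>n::nat. SUP x\<in>{C1 * real n..C2 * real n}.
            ereal (\<P>(\<omega> in M. (MAX t\<in>{0..n}. \<bar>psum (truncated (\<epsilon> * x) X) t \<omega>\<bar>) / x > \<delta>)
                   / (real n * \<P>(\<omega> in M. \<bar>X 0 \<omega>\<bar> > x)))))
         \<longlongrightarrow> 0) (at_right 0)"
    and "(\<integral>\<^sup>+ \<omega>. ennreal_powr (\<Sum>i. ennreal \<bar>\<Theta> (1 + int i) \<omega>\<bar>) (\<alpha> - 1) \<partial>N) < \<infinity>"
    and "\<rho> > 0"
  shows
    "((\<lambda>x. \<P>(\<omega> in M. (SUP t::nat. ereal (psum X t \<omega> - \<rho> * real t)) > ereal x)
           / (x * \<P>(\<omega> in M. \<bar>X 0 \<omega>\<bar> > x)))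
      \<longlongrightarrow>
      (\<integral>\<omega>. (max 0 (SUP t::nat. \<Sum>i=0..t. \<Theta> (int i) \<omega>) powr \<alpha>
            - max 0 (SUP t\<in>{1::nat..}. \<Sum>i=1..t. \<Theta> (int i) \<omega>) powr \<alpha>) \<partial>N)
      / ((\<alpha> - 1) * \<rho>)) at_top"
proof -
  interpret prob_space M by fact
  interpret R: ruin M X \<alpha> N Y \<rho>
    by unfold_locales (fact assms)+
  have \<Theta>: "R.\<Theta> = \<Theta>" using assms(9) by (simp add: R.\<Theta>_def)
  have "(\<integral>\<^sup>+ \<omega>. ennreal_powr (R.abs_sum \<omega>) (\<alpha> - 1) \<partial>N) < \<infinity>"
    unfolding R.abs_sum_def \<Theta> by fact
  note R.ruin_prob_limit[OF this]
  \<comment> \<open>The extended supremum may be infinite; in either case it exceeds x exactly when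
    some term does.\<close>
  moreover have "(ereal x < (SUP t::nat. ereal (psum X t \<omega> - \<rho> * real t))) = (\<exists>t. x < psum X t \<omega> - \<rho> * real t)" for x \<omega>
    by (simp add: less_SUP_iff)
  ultimately show ?thesis
    by (simp add: R.ruin_prob_def R.p_def R.peak_def \<Theta>)
qed

end
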